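(* Let $V$ be a vector space over a field $\mathbb{K}$ and let $*:V\otimes V\longrightarrow V$ be a bilinear product on $V$ (with no further assumption). Then $*$ can be uniquely extended to a linear map $*:T(V)\otimes T(V)\longrightarrow T(V)$ such that for all $f,g,h\in T(V)$ and all $x,y\in V$: 1. $f*1=f$; 2. $1*f=\varepsilon(f)1$; 3. $x*(fy)=(x*f)*y-x*(f*y)$; 4. $(fg)*h=\sum \left(f*h^{(1)}\right)\left(g*h^{(2)}\right)$.
   Context: $T(V)=\bigoplus_{n\ge 0}V^{\otimes n}$ is the tensor algebra with concatenation product (written by juxtaposition) and unit $1$. It is a Hopf algebra with the cocommutative deshuffling coproduct $\Delta_{sh}$, the algebra morphism with $\Delta_{sh}(x)=x\otimes 1+1\otimes x$ for $x\in V$, and counit $\varepsilon$ ($\varepsilon(1)=1$, $\varepsilon(V^{\otimes n})=0$ for $n\geq 1$). Sweedler notation: $\Delta_{sh}(h)=\sum h^{(1)}\otimes h^{(2)}$. *)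

theory Defs
  imports "HOL-Algebra.QuotRing" "HOL-Algebra.Module"
begin

definition linear_maps ::
    "('k, 'm) ring_scheme \<Rightarrow> ('k, 'a, 'p) module_scheme \<Rightarrow> ('k, 'b, 'q) module_scheme \<Rightarrow> ('a \<Rightarrow> 'b) set"
  where "linear_maps K M N =
    {h \<in> carrier M \<rightarrow> carrier N.
       (\<forall>x\<in>carrier M. \<forall>y\<in>carrier M. h (x \<oplus>\<^bsub>M\<^esub> y) = h x \<oplus>\<^bsub>N\<^esub> h y) \<and>
       (\<forall>c\<in>carrier K. \<forall>x\<in>carrier M. h (c \<odot>\<^bsub>M\<^esub> x) = c \<odot>\<^bsub>N\<^esub> h x)}"

definition bilinear_maps ::
    "('k, 'm) ring_scheme \<Rightarrow> ('k, 'a, 'p) module_scheme \<Rightarrow> ('k, 'b, 'q) module_scheme \<Rightarrow>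
     ('k, 'c, 'r) module_scheme \<Rightarrow> ('a \<Rightarrow> 'b \<Rightarrow> 'c) set"
  where "bilinear_maps K M N P =
    {h. (\<forall>x\<in>carrier M. h x \<in> linear_maps K N P) \<and>
        (\<forall>y\<in>carrier N. (\<lambda>x. h x y) \<in> linear_maps K M P)}"

definition algebra_homs ::
    "('k, 'm) ring_scheme \<Rightarrow> ('k, 'a, 'p) module_scheme \<Rightarrow> ('k, 'b, 'q) module_scheme \<Rightarrow> ('a \<Rightarrow> 'b) set"
  where "algebra_homs K A B = ring_hom A B \<inter> linear_maps K A B"

definition self_module :: "('k, 'm) ring_scheme \<Rightarrow> ('k, 'k) module"
  where "self_module K =
    \<lparr>carrier = carrier K, monoid.mult = monoid.mult K, one = one K, zero = zero K, add = add K,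
     smult = monoid.mult K\<rparr>"

definition submodule_span ::
    "('k, 'm) ring_scheme \<Rightarrow> ('k, 'a, 'p) module_scheme \<Rightarrow> 'a set \<Rightarrow> 'a set"
  where "submodule_span K M S = \<Inter>{N. submodule N K M \<and> S \<subseteq> N}"

text \<open>The quotient by \<open>N\<close>: the library's quotient ring, with the induced scalar multiplication
  (meaningful when \<open>N\<close> is an ideal as well as a submodule).\<close>

definition quotient_algebra :: "('k, 'a, 'p) module_scheme \<Rightarrow> 'a set \<Rightarrow> ('k, 'a set) module"
  where "quotient_algebra A N =
    \<lparr>carrier = carrier (A Quot N), monoid.mult = monoid.mult (A Quot N), one = one (A Quot N),
     zero = zero (A Quot N), add = add (A Quot N),
     smult = (\<lambda>c X. \<Union>a\<in>X. N +>\<^bsub>A\<^esub> (c \<odot>\<^bsub>A\<^esub> a))\<rparr>"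

text \<open>The free module on the carrier of a monoid \<open>M\<close>, realised as the finitely supported functions
  on it, with the product extending that of \<open>M\<close> bilinearly (convolution).\<close>

definition monoid_algebra ::
    "('k, 'm) ring_scheme \<Rightarrow> ('a, 'p) monoid_scheme \<Rightarrow> ('k, 'a \<Rightarrow> 'k) module"
  where "monoid_algebra K M =
    \<lparr>carrier = {f. (\<forall>z. f z \<in> carrier K) \<and> {z. f z \<noteq> \<zero>\<^bsub>K\<^esub>} \<subseteq> carrier M \<and>
                   finite {z. f z \<noteq> \<zero>\<^bsub>K\<^esub>}},
     monoid.mult = (\<lambda>f g z. \<Oplus>\<^bsub>K\<^esub>p\<in>{(x, y). f x \<noteq> \<zero>\<^bsub>K\<^esub> \<and> g y \<noteq> \<zero>\<^bsub>K\<^esub> \<and> x \<otimes>\<^bsub>M\<^esub> y = z}.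
               f (fst p) \<otimes>\<^bsub>K\<^esub> g (snd p)),
     one = (\<lambda>z. if z = \<one>\<^bsub>M\<^esub> then \<one>\<^bsub>K\<^esub> else \<zero>\<^bsub>K\<^esub>),
     zero = (\<lambda>z. \<zero>\<^bsub>K\<^esub>),
     add = (\<lambda>f g z. f z \<oplus>\<^bsub>K\<^esub> g z),
     smult = (\<lambda>c f z. c \<otimes>\<^bsub>K\<^esub> f z)\<rparr>"

definition basis_elt :: "('k, 'm) ring_scheme \<Rightarrow> 'a \<Rightarrow> 'a \<Rightarrow> 'k"
  where "basis_elt K a = (\<lambda>z. if z = a then \<one>\<^bsub>K\<^esub> else \<zero>\<^bsub>K\<^esub>)"

text \<open>The free module on \<open>A \<times> B\<close> modulo the bilinearity relations. The product is
  \<open>(a \<otimes> b) (c \<otimes> d) = (a c) \<otimes> (b d)\<close>, because it is induced by the direct product of the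
  multiplicative monoids.\<close>

definition tensor_prod_relations ::
    "('k, 'm) ring_scheme \<Rightarrow> ('k, 'a, 'p) module_scheme \<Rightarrow> ('k, 'b, 'q) module_scheme \<Rightarrow>
     ('a \<times> 'b \<Rightarrow> 'k) set"
  where "tensor_prod_relations K A B = (let F = monoid_algebra K (A \<times>\<times> B); e = basis_elt K in
      {e (a \<oplus>\<^bsub>A\<^esub> a', b) \<ominus>\<^bsub>F\<^esub> (e (a, b) \<oplus>\<^bsub>F\<^esub> e (a', b)) | a a' b.
         a \<in> carrier A \<and> a' \<in> carrier A \<and> b \<in> carrier B} \<union>
      {e (a, b \<oplus>\<^bsub>B\<^esub> b') \<ominus>\<^bsub>F\<^esub> (e (a, b) \<oplus>\<^bsub>F\<^esub> e (a, b')) | a b b'.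
         a \<in> carrier A \<and> b \<in> carrier B \<and> b' \<in> carrier B} \<union>
      {e (c \<odot>\<^bsub>A\<^esub> a, b) \<ominus>\<^bsub>F\<^esub> (c \<odot>\<^bsub>F\<^esub> e (a, b)) | c a b.
         c \<in> carrier K \<and> a \<in> carrier A \<and> b \<in> carrier B} \<union>
      {e (a, c \<odot>\<^bsub>B\<^esub> b) \<ominus>\<^bsub>F\<^esub> (c \<odot>\<^bsub>F\<^esub> e (a, b)) | c a b.
         c \<in> carrier K \<and> a \<in> carrier A \<and> b \<in> carrier B})"

definition tensor_prod_null ::
    "('k, 'm) ring_scheme \<Rightarrow> ('k, 'a, 'p) module_scheme \<Rightarrow> ('k, 'b, 'q) module_scheme \<Rightarrow>
     ('a \<times> 'b \<Rightarrow> 'k) set"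
  where "tensor_prod_null K A B =
    submodule_span K (monoid_algebra K (A \<times>\<times> B)) (tensor_prod_relations K A B)"

definition tensor_prod ::
    "('k, 'm) ring_scheme \<Rightarrow> ('k, 'a, 'p) module_scheme \<Rightarrow> ('k, 'b, 'q) module_scheme \<Rightarrow>
     ('k, ('a \<times> 'b \<Rightarrow> 'k) set) module"
  where "tensor_prod K A B =
    quotient_algebra (monoid_algebra K (A \<times>\<times> B)) (tensor_prod_null K A B)"

definition pure_tensor ::
    "('k, 'm) ring_scheme \<Rightarrow> ('k, 'a, 'p) module_scheme \<Rightarrow> ('k, 'b, 'q) module_scheme \<Rightarrow>
     'a \<Rightarrow> 'b \<Rightarrow> ('a \<times> 'b \<Rightarrow> 'k) set"
  where "pure_tensor K A B a b =
    tensor_prod_null K A B +>\<^bsub>monoid_algebra K (A \<times>\<times> B)\<^esub> basis_elt K (a, b)"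

definition word_monoid :: "('k, 'v, 'p) module_scheme \<Rightarrow> 'v list monoid"
  where "word_monoid V = \<lparr>carrier = lists (carrier V), monoid.mult = (@), one = []\<rparr>"

text \<open>Multilinearity in every letter. Each relation only involves words of one length \<open>n\<close>, so
  the quotient of the free module on all words is the direct sum over \<open>n\<close> of the quotients of the
  free modules on \<open>V\<^sup>n\<close>, that is, of the \<open>n\<close>-fold tensor powers of \<open>V\<close>.\<close>

definition multilinear_relations ::
    "('k, 'm) ring_scheme \<Rightarrow> ('k, 'v, 'p) module_scheme \<Rightarrow> ('v list \<Rightarrow> 'k) set"
  where "multilinear_relations K V = (let F = monoid_algebra K (word_monoid V); e = basis_elt K in
      {e (u @ [x \<oplus>\<^bsub>V\<^esub> y] @ w) \<ominus>\<^bsub>F\<^esub> (e (u @ [x] @ w) \<oplus>\<^bsub>F\<^esub> e (u @ [y] @ w)) | u w x y.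
         u \<in> lists (carrier V) \<and> w \<in> lists (carrier V) \<and> x \<in> carrier V \<and> y \<in> carrier V} \<union>
      {e (u @ [c \<odot>\<^bsub>V\<^esub> x] @ w) \<ominus>\<^bsub>F\<^esub> (c \<odot>\<^bsub>F\<^esub> e (u @ [x] @ w)) | u w c x.
         u \<in> lists (carrier V) \<and> w \<in> lists (carrier V) \<and> c \<in> carrier K \<and> x \<in> carrier V})"

definition multilinear_null ::
    "('k, 'm) ring_scheme \<Rightarrow> ('k, 'v, 'p) module_scheme \<Rightarrow> ('v list \<Rightarrow> 'k) set"
  where "multilinear_null K V =
    submodule_span K (monoid_algebra K (word_monoid V)) (multilinear_relations K V)"

definition tensor_algebra ::
    "('k, 'm) ring_scheme \<Rightarrow> ('k, 'v, 'p) module_scheme \<Rightarrow> ('k, ('v list \<Rightarrow> 'k) set) module"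
  where "tensor_algebra K V =
    quotient_algebra (monoid_algebra K (word_monoid V)) (multilinear_null K V)"

definition word_tensor ::
    "('k, 'm) ring_scheme \<Rightarrow> ('k, 'v, 'p) module_scheme \<Rightarrow> 'v list \<Rightarrow> ('v list \<Rightarrow> 'k) set"
  where "word_tensor K V w =
    multilinear_null K V +>\<^bsub>monoid_algebra K (word_monoid V)\<^esub> basis_elt K w"

definition letter ::
    "('k, 'm) ring_scheme \<Rightarrow> ('k, 'v, 'p) module_scheme \<Rightarrow> 'v \<Rightarrow> ('v list \<Rightarrow> 'k) set"
  where "letter K V x = word_tensor K V [x]"

definition tensor_power ::
    "('k, 'm) ring_scheme \<Rightarrow> ('k, 'v, 'p) module_scheme \<Rightarrow> nat \<Rightarrow> ('v list \<Rightarrow> 'k) set set"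
  where "tensor_power K V n =
    submodule_span K (tensor_algebra K V)
      {word_tensor K V w | w. w \<in> lists (carrier V) \<and> length w = n}"

definition counit ::
    "('k, 'm) ring_scheme \<Rightarrow> ('k, 'v, 'p) module_scheme \<Rightarrow> ('v list \<Rightarrow> 'k) set \<Rightarrow> 'k"
  where "counit K V = (THE e. e \<in> extensional (carrier (tensor_algebra K V)) \<and>
      e \<in> linear_maps K (tensor_algebra K V) (self_module K) \<and>
      e \<one>\<^bsub>tensor_algebra K V\<^esub> = \<one>\<^bsub>K\<^esub> \<and>
      (\<forall>n\<ge>1. \<forall>z\<in>tensor_power K V n. e z = \<zero>\<^bsub>K\<^esub>))"

definition deshuffle ::
    "('k, 'm) ring_scheme \<Rightarrow> ('k, 'v, 'p) module_scheme \<Rightarrow>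
     ('v list \<Rightarrow> 'k) set \<Rightarrow> (('v list \<Rightarrow> 'k) set \<times> ('v list \<Rightarrow> 'k) set \<Rightarrow> 'k) set"
  where "deshuffle K V =
    (let T = tensor_algebra K V; TT = tensor_prod K T T; tens = pure_tensor K T T in
     THE d. d \<in> extensional (carrier T) \<and> d \<in> algebra_homs K T TT \<and>
       (\<forall>x\<in>carrier V.
          d (letter K V x) = tens (letter K V x) \<one>\<^bsub>T\<^esub> \<oplus>\<^bsub>TT\<^esub> tens \<one>\<^bsub>T\<^esub> (letter K V x)))"

text \<open>Sweedler notation: \<open>s\<close> is the value of \<open>\<Sum> B(h\<^sup>1, h\<^sup>2)\<close> in \<open>P\<close> if the sum \<open>\<Sum> B(a\<^sub>i, b\<^sub>i)\<close> equals
  \<open>s\<close> for every way of writing the coproduct of \<open>h\<close> as a finite sum of pure tensors \<open>a\<^sub>i \<otimes> b\<^sub>i\<close>. For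
  bilinear \<open>B\<close> the choice does not matter, and at least one such expression exists.\<close>

definition sweedler_sum_eq ::
    "('k, 'm) ring_scheme \<Rightarrow> ('k, 'v, 'p) module_scheme \<Rightarrow> ('c, 'r) ring_scheme \<Rightarrow>
     (('v list \<Rightarrow> 'k) set \<Rightarrow> ('v list \<Rightarrow> 'k) set \<Rightarrow> 'c) \<Rightarrow> ('v list \<Rightarrow> 'k) set \<Rightarrow> 'c \<Rightarrow> bool"
  where "sweedler_sum_eq K V P B h s \<longleftrightarrow>
    (let T = tensor_algebra K V; TT = tensor_prod K T T in
     \<forall>(n::nat) a b. (\<forall>i<n. a i \<in> carrier T \<and> b i \<in> carrier T) \<and>
       deshuffle K V h = (\<Oplus>\<^bsub>TT\<^esub>i\<in>{..<n}. pure_tensor K T T (a i) (b i)) \<longrightarrow>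
       s = (\<Oplus>\<^bsub>P\<^esub>i\<in>{..<n}. B (a i) (b i)))"

end

theory Submission
  imports Defs
begin

text \<open>Condition 4 reduces \<open>*\<close> to \<open>x * h\<close> with \<open>x \<in> V\<close>. For a letter \<open>y\<close>, the map \<open>f \<mapsto> f * y\<close> is the
  derivation of \<open>T(V)\<close> extending \<open>x \<mapsto> x * y\<close>, so it preserves the length of words; hence condition 3
  determines \<open>x * (w y)\<close> from the products of letters with words of the length of \<open>w\<close>, and \<open>x * w\<close> stays
  in \<open>V\<close>. This gives uniqueness, and read as a definition it gives an explicit product of words.
  That product is multilinear in all letters, so it descends to \<open>T(V) \<otimes> T(V)\<close>, and condition 4 for it
  is an induction on the left word using the coassociativity of the deshuffling.\<close>

section \<open>Linear maps and submodules\<close>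

text \<open>The obstacle is that the recursion behind condition 3 is not structural:
  \<open>x * (w y)\<close> refers to \<open>x * (w * y)\<close>, and \<open>w * y\<close> is a sum
  of words that are no sublists of \<open>w y\<close>. Only their length is under control, so the
  recursion, and every induction that mirrors it, runs on a natural number. Condition 3 takes the
  last letter off the right factor, condition 4 the first letter off the left factor; hence there
  are two recursions, \<open>letter_star\<close> for a single letter on the left and
  \<open>word_star\<close> on top of it. Since T(V) is a quotient, nothing is defined on its
  elements directly. A map is given on lists, shown linear in every letter, and only then pushed to
  the quotient; an identity is proved by checking that both sides are linear and comparing them on
  words. There the coproduct is a finite sum over splittings of the word into complementary
  subwords, so Sweedler sums turn into the recursion \<open>deshuffle_sum\<close>, and the counit
  and coassociativity laws become list inductions.\<close>

lemma linear_maps_closed: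
  "h \<in> linear_maps K M N \<Longrightarrow> x \<in> carrier M \<Longrightarrow> h x \<in> carrier N"
  by (auto simp: linear_maps_def)

lemma linear_maps_add:
  "h \<in> linear_maps K M N \<Longrightarrow> x \<in> carrier M \<Longrightarrow> y \<in> carrier M \<Longrightarrow>
    h (x \<oplus>\<^bsub>M\<^esub> y) = h x \<oplus>\<^bsub>N\<^esub> h y"
  by (auto simp: linear_maps_def)

lemma linear_maps_smult:
  "h \<in> linear_maps K M N \<Longrightarrow> c \<in> carrier K \<Longrightarrow> x \<in> carrier M \<Longrightarrow>
    h (c \<odot>\<^bsub>M\<^esub> x) = c \<odot>\<^bsub>N\<^esub> h x"
  by (auto simp: linear_maps_def)

lemma linear_mapsI:
  assumes "\<And>x. x \<in> carrier M \<Longrightarrow> h x \<in> carrier N"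
    and "\<And>x y. x \<in> carrier M \<Longrightarrow> y \<in> carrier M \<Longrightarrow> h (x \<oplus>\<^bsub>M\<^esub> y) = h x \<oplus>\<^bsub>N\<^esub> h y"
    and "\<And>c x. c \<in> carrier K \<Longrightarrow> x \<in> carrier M \<Longrightarrow> h (c \<odot>\<^bsub>M\<^esub> x) = c \<odot>\<^bsub>N\<^esub> h x"
  shows "h \<in> linear_maps K M N"
  using assms by (auto simp: linear_maps_def)

lemma linear_maps_comp:
  "g \<in> linear_maps K N P \<Longrightarrow> h \<in> linear_maps K M N \<Longrightarrow> (\<lambda>x. g (h x)) \<in> linear_maps K M P"
  by (auto simp: linear_maps_def Pi_iff)

lemma linear_maps_id: "(\<lambda>x. x) \<in> linear_maps K M M"
  by (auto simp: linear_maps_def)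

text \<open>Only the values on the carrier matter, so a lifted map may be replaced by its
  \<open>restrict\<close>, which the extensionality clauses in \<open>counit\<close>,
  \<open>deshuffle\<close> and the theorem require.\<close>

lemma linear_maps_cong:
  assumes "module K M" "\<And>x. x \<in> carrier M \<Longrightarrow> g x = h x"
  shows "g \<in> linear_maps K M N \<longleftrightarrow> h \<in> linear_maps K M N"
proof -
  interpret module K M by fact
  show ?thesis using assms(2) by (auto simp: linear_maps_def Pi_iff)
qed

context
  fixes K :: "('k, 'm) ring_scheme" and M :: "('k, 'a, 'p) module_scheme"
    and N :: "('k, 'b, 'q) module_scheme"
  assumes M: "module K M" and N: "module K N"
begin

interpretation M: module K M by (rule M)
interpretation N: module K N by (rule N)

lemma linear_maps_zero:
  assumes "h \<in> linear_maps K M N"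
  shows "h \<zero>\<^bsub>M\<^esub> = \<zero>\<^bsub>N\<^esub>"
proof -
  have "h (\<zero>\<^bsub>K\<^esub> \<odot>\<^bsub>M\<^esub> \<zero>\<^bsub>M\<^esub>) = \<zero>\<^bsub>K\<^esub> \<odot>\<^bsub>N\<^esub> h \<zero>\<^bsub>M\<^esub>"
    by (rule linear_maps_smult[OF assms]) auto
  then show ?thesis using linear_maps_closed[OF assms M.zero_closed] by simp
qed

lemma linear_maps_a_inv:
  assumes h: "h \<in> linear_maps K M N" and x: "x \<in> carrier M"
  shows "h (\<ominus>\<^bsub>M\<^esub> x) = \<ominus>\<^bsub>N\<^esub> h x"
proof -
  have hx: "h x \<in> carrier N" "h (\<ominus>\<^bsub>M\<^esub> x) \<in> carrier N"
    using linear_maps_closed[OF h] x by auto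
  have "h (\<ominus>\<^bsub>M\<^esub> x) \<oplus>\<^bsub>N\<^esub> h x = \<zero>\<^bsub>N\<^esub>"
    using linear_maps_add[OF h, of "\<ominus>\<^bsub>M\<^esub> x" x] x linear_maps_zero[OF h]
    by (simp add: M.M.l_neg)
  then show ?thesis using hx by (metis N.minus_equality)
qed

lemma linear_maps_minus:
  assumes "h \<in> linear_maps K M N" "x \<in> carrier M" "y \<in> carrier M"
  shows "h (x \<ominus>\<^bsub>M\<^esub> y) = h x \<ominus>\<^bsub>N\<^esub> h y"
  using assms by (simp add: a_minus_def linear_maps_add linear_maps_a_inv)

lemma linear_maps_finsum:
  assumes h: "h \<in> linear_maps K M N" and "finite I" "\<And>i. i \<in> I \<Longrightarrow> f i \<in> carrier M"
  shows "h (\<Oplus>\<^bsub>M\<^esub>i\<in>I. f i) = (\<Oplus>\<^bsub>N\<^esub>i\<in>I. h (f i))"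
  using assms(2,3)
proof (induction I rule: finite_induct)
  case empty
  then show ?case using linear_maps_zero[OF h] by simp
next
  case (insert i I)
  then show ?case
    by (simp add: Pi_iff linear_maps_add[OF h] linear_maps_closed[OF h])
qed

lemma linear_maps_const_zero: "(\<lambda>x. \<zero>\<^bsub>N\<^esub>) \<in> linear_maps K M N"
  by (rule linear_mapsI) auto

lemma linear_maps_plus:
  assumes "g \<in> linear_maps K M N" "h \<in> linear_maps K M N"
  shows "(\<lambda>x. g x \<oplus>\<^bsub>N\<^esub> h x) \<in> linear_maps K M N"
  using assms
  by (intro linear_mapsI)
     (auto simp: linear_maps_closed linear_maps_add linear_maps_smult N.smult_r_distr N.M.add.m_ac)

lemma linear_maps_diff:
  assumes g: "g \<in> linear_maps K M N" and h: "h \<in> linear_maps K M N"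
  shows "(\<lambda>x. g x \<ominus>\<^bsub>N\<^esub> h x) \<in> linear_maps K M N"
  using linear_maps_closed[OF g] linear_maps_closed[OF h]
  by (intro linear_mapsI)
     (auto simp: a_minus_def linear_maps_add[OF g] linear_maps_add[OF h] linear_maps_smult[OF g]
       linear_maps_smult[OF h] N.smult_r_distr N.smult_r_minus N.M.minus_add N.M.add.m_ac)

text \<open>The scalars \<open>c\<close> and \<open>d\<close> have to change places, which is where
  commutativity of \<open>K\<close> enters.\<close>

lemma linear_maps_scale:
  assumes "c \<in> carrier K" "h \<in> linear_maps K M N"
  shows "(\<lambda>x. c \<odot>\<^bsub>N\<^esub> h x) \<in> linear_maps K M N"
proof (rule linear_mapsI)
  fix d x assume d: "d \<in> carrier K" and x: "x \<in> carrier M"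
  have "c \<odot>\<^bsub>N\<^esub> (d \<odot>\<^bsub>N\<^esub> h x) = (c \<otimes>\<^bsub>K\<^esub> d) \<odot>\<^bsub>N\<^esub> h x"
    using d x assms linear_maps_closed[OF assms(2)] by (simp add: N.smult_assoc1)
  also have "\<dots> = d \<odot>\<^bsub>N\<^esub> (c \<odot>\<^bsub>N\<^esub> h x)"
    using d x assms linear_maps_closed[OF assms(2)]
    by (subst M.R.m_comm) (simp_all add: N.smult_assoc1)
  finally show "c \<odot>\<^bsub>N\<^esub> h (d \<odot>\<^bsub>M\<^esub> x) = d \<odot>\<^bsub>N\<^esub> (c \<odot>\<^bsub>N\<^esub> h x)"
    using d x assms by (simp add: linear_maps_smult)
qed (use assms in \<open>auto simp: linear_maps_closed linear_maps_add N.smult_r_distr\<close>)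

text \<open>The point is that two linear maps which agree on generators agree on the whole span.
  Most identities below are proved in this way.\<close>

lemma submodule_equalizer:
  assumes g: "g \<in> linear_maps K M N" and h: "h \<in> linear_maps K M N"
  shows "submodule {x \<in> carrier M. g x = h x} K M"
  by (rule M.submoduleI)
     (auto simp: linear_maps_zero[OF g] linear_maps_zero[OF h] linear_maps_a_inv[OF g]
       linear_maps_a_inv[OF h] linear_maps_add[OF g] linear_maps_add[OF h]
       linear_maps_smult[OF g] linear_maps_smult[OF h])

lemma linear_maps_eq_on_span:
  assumes "g \<in> linear_maps K M N" "h \<in> linear_maps K M N"
    and "S \<subseteq> carrier M" "\<And>x. x \<in> S \<Longrightarrow> g x = h x" and "x \<in> submodule_span K M S"
  shows "g x = h x"
  using submodule_equalizer[OF assms(1,2)] assms(3-5) unfolding submodule_span_def by blast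

end

text \<open>Since \<open>S\<close> lies in the carrier, the carrier itself is one of the intersected
  submodules; the family is not empty and the intersection stays inside the carrier.\<close>

lemma (in module) submodule_submodule_span:
  assumes "S \<subseteq> carrier M"
  shows "submodule (submodule_span R M S) R M"
  unfolding submodule_span_def
  by (rule submoduleI)
     (use assms carrier_is_submodule in
       \<open>auto simp: submoduleE(3,4,5) dest: submoduleE intro: subgroup.one_closed[OF submodule.axioms(1), simplified]\<close>)

lemma submodule_span_superset: "S \<subseteq> submodule_span K M S"
  unfolding submodule_span_def by blast

lemma submodule_span_least: "submodule N K M \<Longrightarrow> S \<subseteq> N \<Longrightarrow> submodule_span K M S \<subseteq> N"
  unfolding submodule_span_def by blast

lemma (in module) submodule_span_subset: "S \<subseteq> carrier M \<Longrightarrow> submodule_span R M S \<subseteq> carrier M"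
  by (rule submodule_span_least[OF carrier_is_submodule])

lemma (in module) submodule_zero: "submodule H R M \<Longrightarrow> \<zero>\<^bsub>M\<^esub> \<in> H"
  using subgroup.one_closed[OF submodule.axioms(1), of H R M] by simp

text \<open>T(V) and its tensor square are not commutative in general, so scalars have to be allowed
  to pass through the product on either side.\<close>

locale assoc_algebra = module K A + A?: ring A for K (structure) and A (structure) +
  assumes smult_mult_left: "\<lbrakk>c \<in> carrier K; x \<in> carrier A; y \<in> carrier A\<rbrakk> \<Longrightarrow>
      (c \<odot>\<^bsub>A\<^esub> x) \<otimes>\<^bsub>A\<^esub> y = c \<odot>\<^bsub>A\<^esub> (x \<otimes>\<^bsub>A\<^esub> y)"
    and smult_mult_right: "\<lbrakk>c \<in> carrier K; x \<in> carrier A; y \<in> carrier A\<rbrakk> \<Longrightarrow>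
      x \<otimes>\<^bsub>A\<^esub> (c \<odot>\<^bsub>A\<^esub> y) = c \<odot>\<^bsub>A\<^esub> (x \<otimes>\<^bsub>A\<^esub> y)"
begin

lemma linear_maps_mult_left:
  "a \<in> carrier A \<Longrightarrow> (\<lambda>x. a \<otimes>\<^bsub>A\<^esub> x) \<in> linear_maps K A A"
  by (rule linear_mapsI) (auto simp: A.r_distr smult_mult_right)

lemma linear_maps_mult_right:
  "a \<in> carrier A \<Longrightarrow> (\<lambda>x. x \<otimes>\<^bsub>A\<^esub> a) \<in> linear_maps K A A"
  by (rule linear_mapsI) (auto simp: A.l_distr smult_mult_left)

end

section \<open>The monoid algebra\<close>

locale monoid_ring = K?: cring K + Mon: monoid M
  for K :: "('k, 'm) ring_scheme" (structure) and M :: "('a, 'p) monoid_scheme"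
begin

abbreviation F :: "('k, 'a \<Rightarrow> 'k) module" where "F \<equiv> monoid_algebra K M"
abbreviation supp :: "('a \<Rightarrow> 'k) \<Rightarrow> 'a set" where "supp f \<equiv> {z. f z \<noteq> \<zero>}"

lemma carrier_F:
  "f \<in> carrier F \<longleftrightarrow> (\<forall>z. f z \<in> carrier K) \<and> supp f \<subseteq> carrier M \<and> finite (supp f)"
  by (simp add: monoid_algebra_def)

lemma F_simps:
  "f \<oplus>\<^bsub>F\<^esub> g = (\<lambda>z. f z \<oplus> g z)" "\<zero>\<^bsub>F\<^esub> = (\<lambda>z. \<zero>)" "c \<odot>\<^bsub>F\<^esub> f = (\<lambda>z. c \<otimes> f z)"
  "\<one>\<^bsub>F\<^esub> = basis_elt K \<one>\<^bsub>M\<^esub>"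
  by (simp_all add: monoid_algebra_def basis_elt_def)

lemma F_add_closed:
  assumes "f \<in> carrier F" "g \<in> carrier F" shows "f \<oplus>\<^bsub>F\<^esub> g \<in> carrier F"
proof -
  have "supp (\<lambda>z. f z \<oplus> g z) \<subseteq> supp f \<union> supp g" by auto
  then show ?thesis using assms unfolding carrier_F F_simps
    by (auto intro: finite_subset)
qed

lemma F_smult_closed:
  assumes "c \<in> carrier K" "f \<in> carrier F" shows "c \<odot>\<^bsub>F\<^esub> f \<in> carrier F"
proof -
  have "supp (\<lambda>z. c \<otimes> f z) \<subseteq> supp f" using assms by auto
  then show ?thesis using assms unfolding carrier_F F_simps
    by (auto intro: finite_subset)
qed

lemma module_F: "module K F"
proof (rule moduleI)
  show "abelian_group F"
  proof (rule abelian_groupI)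
    fix f assume f: "f \<in> carrier F"
    then have "supp (\<lambda>z. \<ominus> f z) = supp f"
      by (auto simp: carrier_F)
    then have "(\<lambda>z. \<ominus> f z) \<in> carrier F" using f by (simp add: carrier_F)
    moreover have "(\<lambda>z. \<ominus> f z) \<oplus>\<^bsub>F\<^esub> f = \<zero>\<^bsub>F\<^esub>"
      using f by (simp add: F_simps carrier_F l_neg)
    ultimately show "\<exists>g\<in>carrier F. g \<oplus>\<^bsub>F\<^esub> f = \<zero>\<^bsub>F\<^esub>" by blast
  qed (auto simp: F_add_closed F_smult_closed, auto simp: F_simps carrier_F a_ac)
qed (auto simp: is_cring F_smult_closed, auto simp: F_simps carrier_F l_distr r_distr m_assoc)

sublocale F: module K F by (rule module_F)

lemma basis_elt_closed: "m \<in> carrier M \<Longrightarrow> basis_elt K m \<in> carrier F"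
  by (auto simp: carrier_F basis_elt_def)

lemma F_span: "submodule_span K F (basis_elt K ` carrier M) = carrier F"
proof
  show "submodule_span K F (basis_elt K ` carrier M) \<subseteq> carrier F"
    by (rule F.submodule_span_subset) (auto simp: basis_elt_closed)
next
  let ?E = "basis_elt K ` carrier M"
  have sm: "submodule (submodule_span K F ?E) K F"
    by (rule F.submodule_submodule_span) (auto simp: basis_elt_closed)
  \<comment> \<open>The induction is over a finite set \<open>S\<close> that contains the support,
    not over the support itself. Setting one value to zero then shrinks \<open>S\<close>, and a
    point of \<open>S\<close> at which \<open>f\<close> already vanishes is simply dropped.\<close>
  have "f \<in> submodule_span K F ?E" if "finite S" "f \<in> carrier F" "supp f \<subseteq> S" for S f
    using that
  proof (induction S arbitrary: f rule: finite_induct)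
    case empty
    then have "f = \<zero>\<^bsub>F\<^esub>" by (auto simp: F_simps)
    then show ?case using F.submodule_zero[OF sm] by simp
  next
    case (insert z S)
    show ?case
    proof (cases "f z = \<zero>")
      case True
      then have "supp f \<subseteq> S" using insert.prems by auto
      then show ?thesis using insert by blast
    next
      case False
      then have z: "z \<in> carrier M" and fz: "f z \<in> carrier K"
        using insert.prems by (auto simp: carrier_F)
      let ?f = "f(z := \<zero>)"
      have s: "supp ?f \<subseteq> supp f" by auto
      have f': "?f \<in> carrier F"
        using insert.prems(1) finite_subset[OF s] s unfolding carrier_F by auto
      have "supp ?f \<subseteq> S" using insert.prems by auto
      then have "?f \<in> submodule_span K F ?E" by (rule insert.IH[OF f'])
      moreover have "f z \<odot>\<^bsub>F\<^esub> basis_elt K z \<in> submodule_span K F ?E"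
        using submodule_span_superset[of ?E K F] z fz F.submoduleE(4)[OF sm] by blast
      ultimately have "?f \<oplus>\<^bsub>F\<^esub> f z \<odot>\<^bsub>F\<^esub> basis_elt K z \<in> submodule_span K F ?E"
        using F.submoduleE(5)[OF sm] by blast
      also have "?f \<oplus>\<^bsub>F\<^esub> f z \<odot>\<^bsub>F\<^esub> basis_elt K z = f"
        using insert.prems(1) by (auto simp: F_simps basis_elt_def fun_eq_iff carrier_F)
      finally show ?thesis .
    qed
  qed
  then show "carrier F \<subseteq> submodule_span K F ?E" by (auto simp: carrier_F)
qed

section \<open>Universal property of the free module\<close>

definition free_ext :: "('k, 'b, 'r) module_scheme \<Rightarrow> ('a \<Rightarrow> 'b) \<Rightarrow> ('a \<Rightarrow> 'k) \<Rightarrow> 'b"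
  where "free_ext P \<phi> f = (\<Oplus>\<^bsub>P\<^esub>z\<in>supp f. f z \<odot>\<^bsub>P\<^esub> \<phi> z)"

context
  fixes P :: "('k, 'b, 'r) module_scheme" and \<phi> :: "'a \<Rightarrow> 'b"
  assumes P: "module K P" and \<phi>: "\<And>z. z \<in> carrier M \<Longrightarrow> \<phi> z \<in> carrier P"
begin

interpretation P: module K P by (rule P)

text \<open>The defining sum ranges over the support, which changes with \<open>f\<close>. Padding
  to a common finite index set adds only zero terms and makes the sums for different
  \<open>f\<close> comparable.\<close>

lemma free_ext_superset:
  assumes "f \<in> carrier F" "finite S" "supp f \<subseteq> S" "S \<subseteq> carrier M"
  shows "free_ext P \<phi> f = (\<Oplus>\<^bsub>P\<^esub>z\<in>S. f z \<odot>\<^bsub>P\<^esub> \<phi> z)"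
  unfolding free_ext_def
  by (rule P.M.add.finprod_mono_neutral_cong_left) (use assms \<phi> in \<open>auto simp: carrier_F\<close>)

lemma free_ext_linear: "free_ext P \<phi> \<in> linear_maps K F P"
proof (rule linear_mapsI)
  fix f g assume f: "f \<in> carrier F" and g: "g \<in> carrier F"
  let ?S = "supp f \<union> supp g"
  have S: "finite ?S" "?S \<subseteq> carrier M" and cf: "\<And>z. f z \<in> carrier K" "\<And>z. g z \<in> carrier K"
    using f g by (auto simp: carrier_F)
  have "free_ext P \<phi> (f \<oplus>\<^bsub>F\<^esub> g) = (\<Oplus>\<^bsub>P\<^esub>z\<in>?S. (f \<oplus>\<^bsub>F\<^esub> g) z \<odot>\<^bsub>P\<^esub> \<phi> z)"
    by (rule free_ext_superset) (use S f g in \<open>auto simp: F_add_closed\<close>, auto simp: F_simps cf)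
  also have "\<dots> = (\<Oplus>\<^bsub>P\<^esub>z\<in>?S. f z \<odot>\<^bsub>P\<^esub> \<phi> z \<oplus>\<^bsub>P\<^esub> g z \<odot>\<^bsub>P\<^esub> \<phi> z)"
    by (rule P.M.finsum_cong') (use S \<phi> cf in \<open>auto simp: F_simps P.smult_l_distr subset_iff\<close>)
  also have "\<dots> = (\<Oplus>\<^bsub>P\<^esub>z\<in>?S. f z \<odot>\<^bsub>P\<^esub> \<phi> z) \<oplus>\<^bsub>P\<^esub> (\<Oplus>\<^bsub>P\<^esub>z\<in>?S. g z \<odot>\<^bsub>P\<^esub> \<phi> z)"
    by (rule P.M.finsum_addf) (use S \<phi> cf in auto)
  also have "\<dots> = free_ext P \<phi> f \<oplus>\<^bsub>P\<^esub> free_ext P \<phi> g"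
    using free_ext_superset[OF f S(1) _ S(2)] free_ext_superset[OF g S(1) _ S(2)] by simp
  finally show "free_ext P \<phi> (f \<oplus>\<^bsub>F\<^esub> g) = free_ext P \<phi> f \<oplus>\<^bsub>P\<^esub> free_ext P \<phi> g" .
next
  fix c f assume c: "c \<in> carrier K" and f: "f \<in> carrier F"
  have S: "finite (supp f)" "supp f \<subseteq> carrier M" and cf: "\<And>z. f z \<in> carrier K"
    using f by (auto simp: carrier_F)
  have "free_ext P \<phi> (c \<odot>\<^bsub>F\<^esub> f) = (\<Oplus>\<^bsub>P\<^esub>z\<in>supp f. (c \<odot>\<^bsub>F\<^esub> f) z \<odot>\<^bsub>P\<^esub> \<phi> z)"
    by (rule free_ext_superset) (use S c f in \<open>auto simp: F_smult_closed\<close>, use c in \<open>auto simp: F_simps\<close>)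
  also have "\<dots> = (\<Oplus>\<^bsub>P\<^esub>z\<in>supp f. c \<odot>\<^bsub>P\<^esub> (f z \<odot>\<^bsub>P\<^esub> \<phi> z))"
    by (rule P.M.finsum_cong') (use S c \<phi> cf in \<open>auto simp: F_simps P.smult_assoc1 subset_iff\<close>)
  also have "\<dots> = c \<odot>\<^bsub>P\<^esub> free_ext P \<phi> f"
    unfolding free_ext_def by (rule P.finsum_smult_ldistr[symmetric]) (use S c \<phi> cf in auto)
  finally show "free_ext P \<phi> (c \<odot>\<^bsub>F\<^esub> f) = c \<odot>\<^bsub>P\<^esub> free_ext P \<phi> f" .
next
  fix f assume "f \<in> carrier F"
  then show "free_ext P \<phi> f \<in> carrier P"
    unfolding free_ext_def by (intro P.M.finsum_closed) (use \<phi> in \<open>auto simp: carrier_F\<close>)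
qed

lemma free_ext_basis_elt:
  assumes m: "m \<in> carrier M"
  shows "free_ext P \<phi> (basis_elt K m) = \<phi> m"
proof -
  have "free_ext P \<phi> (basis_elt K m) = (\<Oplus>\<^bsub>P\<^esub>z\<in>{m}. basis_elt K m z \<odot>\<^bsub>P\<^esub> \<phi> z)"
    by (rule free_ext_superset) (use m basis_elt_closed[OF m] in \<open>auto simp: basis_elt_def\<close>)
  also have "\<dots> = \<phi> m" using \<phi>[OF m] by (simp add: basis_elt_def)
  finally show ?thesis .
qed

end

text \<open>The index set in the definition of the product depends on \<open>f\<close>,
  \<open>g\<close> and \<open>z\<close>. Here it becomes a rectangle around both supports, with the
  condition on \<open>z\<close> moved into the summand, so that linearity can be read off term by
  term.\<close>

lemma F_mult_superset:
  assumes "f \<in> carrier F" "g \<in> carrier F" "finite S" "finite S'" "supp f \<subseteq> S" "supp g \<subseteq> S'"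
  shows "(f \<otimes>\<^bsub>F\<^esub> g) z =
    (\<Oplus>p\<in>S \<times> S'. if fst p \<otimes>\<^bsub>M\<^esub> snd p = z then f (fst p) \<otimes> g (snd p) else \<zero>)"
proof -
  have "(f \<otimes>\<^bsub>F\<^esub> g) z =
      (\<Oplus>p\<in>{(x, y). f x \<noteq> \<zero> \<and> g y \<noteq> \<zero> \<and> x \<otimes>\<^bsub>M\<^esub> y = z}. f (fst p) \<otimes> g (snd p))"
    by (simp add: monoid_algebra_def)
  also have "\<dots> = (\<Oplus>p\<in>S \<times> S'. if fst p \<otimes>\<^bsub>M\<^esub> snd p = z then f (fst p) \<otimes> g (snd p) else \<zero>)"
  proof (rule K.add.finprod_mono_neutral_cong_left)
    have cf: "f z \<in> carrier K" "g z \<in> carrier K" for z using assms by (auto simp: carrier_F)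
    show "\<And>i. i \<in> S \<times> S' - {(x, y). f x \<noteq> \<zero> \<and> g y \<noteq> \<zero> \<and> x \<otimes>\<^bsub>M\<^esub> y = z} \<Longrightarrow>
        (if fst i \<otimes>\<^bsub>M\<^esub> snd i = z then f (fst i) \<otimes> g (snd i) else \<zero>) = \<zero>"
      using cf by auto
    show "(\<lambda>p. if fst p \<otimes>\<^bsub>M\<^esub> snd p = z then f (fst p) \<otimes> g (snd p) else \<zero>)
        \<in> S \<times> S' \<rightarrow> carrier K" using cf by auto
  qed (use assms in auto)
  finally show ?thesis .
qed

lemma F_mult_closed:
  assumes f: "f \<in> carrier F" and g: "g \<in> carrier F"
  shows "f \<otimes>\<^bsub>F\<^esub> g \<in> carrier F"
proof -
  have cf: "f z \<in> carrier K" "g z \<in> carrier K" for z using assms by (auto simp: carrier_F)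
  have eq: "(f \<otimes>\<^bsub>F\<^esub> g) z =
      (\<Oplus>p\<in>supp f \<times> supp g. if fst p \<otimes>\<^bsub>M\<^esub> snd p = z then f (fst p) \<otimes> g (snd p) else \<zero>)" for z
    by (rule F_mult_superset) (use assms in \<open>auto simp: carrier_F\<close>)
  have c: "(f \<otimes>\<^bsub>F\<^esub> g) z \<in> carrier K" for z
    unfolding eq by (rule K.finsum_closed) (use cf in auto)
  \<comment> \<open>Outside the set of products of support elements every guarded summand is
    zero.\<close>
  have "supp (f \<otimes>\<^bsub>F\<^esub> g) \<subseteq> (\<lambda>p. fst p \<otimes>\<^bsub>M\<^esub> snd p) ` (supp f \<times> supp g)" (is "_ \<subseteq> ?I")
  proof
    fix z assume z: "z \<in> supp (f \<otimes>\<^bsub>F\<^esub> g)"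
    show "z \<in> ?I"
    proof (rule ccontr)
      assume "z \<notin> ?I"
      then have "(f \<otimes>\<^bsub>F\<^esub> g) z = (\<Oplus>p\<in>supp f \<times> supp g. \<zero>)"
        unfolding eq by (intro K.finsum_cong') (auto intro!: rev_image_eqI)
      then show False using z by simp
    qed
  qed
  moreover have "finite ?I" using assms by (auto simp: carrier_F)
  moreover have "?I \<subseteq> carrier M" using assms by (fastforce simp: carrier_F)
  ultimately show ?thesis using c unfolding carrier_F by (meson finite_subset subset_trans)
qed

lemma F_mult_linear:
  assumes f: "f \<in> carrier F"
  shows "(\<lambda>g. f \<otimes>\<^bsub>F\<^esub> g) \<in> linear_maps K F F" "(\<lambda>g. g \<otimes>\<^bsub>F\<^esub> f) \<in> linear_maps K F F"
proof -
  have cf: "f z \<in> carrier K" for z using f by (auto simp: carrier_F)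
  show "(\<lambda>g. f \<otimes>\<^bsub>F\<^esub> g) \<in> linear_maps K F F"
  proof (rule linear_mapsI)
    fix g h assume gh: "g \<in> carrier F" "h \<in> carrier F"
    have cgh: "g z \<in> carrier K" "h z \<in> carrier K" for z using gh by (auto simp: carrier_F)
    let ?S = "supp g \<union> supp h"
    have fin: "finite (supp f)" "finite ?S" using f gh by (auto simp: carrier_F)
    show "f \<otimes>\<^bsub>F\<^esub> (g \<oplus>\<^bsub>F\<^esub> h) = f \<otimes>\<^bsub>F\<^esub> g \<oplus>\<^bsub>F\<^esub> f \<otimes>\<^bsub>F\<^esub> h"
    proof
      fix z
      let ?t = "\<lambda>g p. if fst p \<otimes>\<^bsub>M\<^esub> snd p = z then f (fst p) \<otimes> g (snd p) else \<zero>"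
      have "(f \<otimes>\<^bsub>F\<^esub> (g \<oplus>\<^bsub>F\<^esub> h)) z = (\<Oplus>p\<in>supp f \<times> ?S. ?t (g \<oplus>\<^bsub>F\<^esub> h) p)"
        by (rule F_mult_superset) (use f gh fin in \<open>auto simp: F_add_closed\<close>, auto simp: F_simps cgh)
      also have "\<dots> = (\<Oplus>p\<in>supp f \<times> ?S. ?t g p \<oplus> ?t h p)"
        by (rule K.finsum_cong') (use cf cgh in \<open>auto simp: F_simps r_distr\<close>)
      also have "\<dots> = (\<Oplus>p\<in>supp f \<times> ?S. ?t g p) \<oplus> (\<Oplus>p\<in>supp f \<times> ?S. ?t h p)"
        by (rule K.finsum_addf) (use cf cgh in auto)
      also have "\<dots> = (f \<otimes>\<^bsub>F\<^esub> g) z \<oplus> (f \<otimes>\<^bsub>F\<^esub> h) z"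
        using F_mult_superset[OF f gh(1) fin] F_mult_superset[OF f gh(2) fin] by simp
      also have "\<dots> = (f \<otimes>\<^bsub>F\<^esub> g \<oplus>\<^bsub>F\<^esub> f \<otimes>\<^bsub>F\<^esub> h) z" by (simp add: F_simps)
      finally show "(f \<otimes>\<^bsub>F\<^esub> (g \<oplus>\<^bsub>F\<^esub> h)) z = (f \<otimes>\<^bsub>F\<^esub> g \<oplus>\<^bsub>F\<^esub> f \<otimes>\<^bsub>F\<^esub> h) z" .
    qed
  next
    fix c g assume c: "c \<in> carrier K" and g: "g \<in> carrier F"
    have cg: "g z \<in> carrier K" for z using g by (auto simp: carrier_F)
    have fin: "finite (supp f)" "finite (supp g)" using f g by (auto simp: carrier_F)
    show "f \<otimes>\<^bsub>F\<^esub> (c \<odot>\<^bsub>F\<^esub> g) = c \<odot>\<^bsub>F\<^esub> (f \<otimes>\<^bsub>F\<^esub> g)"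
    proof
      fix z
      let ?t = "\<lambda>g p. if fst p \<otimes>\<^bsub>M\<^esub> snd p = z then f (fst p) \<otimes> g (snd p) else \<zero>"
      have "(f \<otimes>\<^bsub>F\<^esub> (c \<odot>\<^bsub>F\<^esub> g)) z = (\<Oplus>p\<in>supp f \<times> supp g. ?t (c \<odot>\<^bsub>F\<^esub> g) p)"
        by (rule F_mult_superset) (use f g fin c in \<open>auto simp: F_smult_closed\<close>, use c in \<open>auto simp: F_simps\<close>)
      also have "\<dots> = (\<Oplus>p\<in>supp f \<times> supp g. c \<otimes> ?t g p)"
        by (rule K.finsum_cong') (use c cf cg in \<open>auto simp: F_simps m_lcomm\<close>)
      also have "\<dots> = c \<otimes> (\<Oplus>p\<in>supp f \<times> supp g. ?t g p)"
        by (rule K.finsum_rdistr[symmetric]) (use fin c cf cg in auto)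
      also have "\<dots> = (c \<odot>\<^bsub>F\<^esub> (f \<otimes>\<^bsub>F\<^esub> g)) z"
        using F_mult_superset[OF f g fin] by (simp add: F_simps)
      finally show "(f \<otimes>\<^bsub>F\<^esub> (c \<odot>\<^bsub>F\<^esub> g)) z = (c \<odot>\<^bsub>F\<^esub> (f \<otimes>\<^bsub>F\<^esub> g)) z" .
    qed
  qed (use f in \<open>auto simp: F_mult_closed\<close>)
  show "(\<lambda>g. g \<otimes>\<^bsub>F\<^esub> f) \<in> linear_maps K F F"
  proof (rule linear_mapsI)
    fix g h assume gh: "g \<in> carrier F" "h \<in> carrier F"
    have cgh: "g z \<in> carrier K" "h z \<in> carrier K" for z using gh by (auto simp: carrier_F)
    let ?S = "supp g \<union> supp h"
    have fin: "finite ?S" "finite (supp f)" using f gh by (auto simp: carrier_F)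
    show "(g \<oplus>\<^bsub>F\<^esub> h) \<otimes>\<^bsub>F\<^esub> f = g \<otimes>\<^bsub>F\<^esub> f \<oplus>\<^bsub>F\<^esub> h \<otimes>\<^bsub>F\<^esub> f"
    proof
      fix z
      let ?t = "\<lambda>g p. if fst p \<otimes>\<^bsub>M\<^esub> snd p = z then g (fst p) \<otimes> f (snd p) else \<zero>"
      have "((g \<oplus>\<^bsub>F\<^esub> h) \<otimes>\<^bsub>F\<^esub> f) z = (\<Oplus>p\<in>?S \<times> supp f. ?t (g \<oplus>\<^bsub>F\<^esub> h) p)"
        by (rule F_mult_superset) (use f gh fin in \<open>auto simp: F_add_closed\<close>, auto simp: F_simps cgh)
      also have "\<dots> = (\<Oplus>p\<in>?S \<times> supp f. ?t g p \<oplus> ?t h p)"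
        by (rule K.finsum_cong') (use cf cgh in \<open>auto simp: F_simps l_distr\<close>)
      also have "\<dots> = (\<Oplus>p\<in>?S \<times> supp f. ?t g p) \<oplus> (\<Oplus>p\<in>?S \<times> supp f. ?t h p)"
        by (rule K.finsum_addf) (use cf cgh in auto)
      also have "\<dots> = (g \<otimes>\<^bsub>F\<^esub> f) z \<oplus> (h \<otimes>\<^bsub>F\<^esub> f) z"
        using F_mult_superset[OF gh(1) f fin] F_mult_superset[OF gh(2) f fin] by simp
      also have "\<dots> = (g \<otimes>\<^bsub>F\<^esub> f \<oplus>\<^bsub>F\<^esub> h \<otimes>\<^bsub>F\<^esub> f) z" by (simp add: F_simps)
      finally show "((g \<oplus>\<^bsub>F\<^esub> h) \<otimes>\<^bsub>F\<^esub> f) z = (g \<otimes>\<^bsub>F\<^esub> f \<oplus>\<^bsub>F\<^esub> h \<otimes>\<^bsub>F\<^esub> f) z" .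
    qed
  next
    fix c g assume c: "c \<in> carrier K" and g: "g \<in> carrier F"
    have cg: "g z \<in> carrier K" for z using g by (auto simp: carrier_F)
    have fin: "finite (supp g)" "finite (supp f)" using f g by (auto simp: carrier_F)
    show "(c \<odot>\<^bsub>F\<^esub> g) \<otimes>\<^bsub>F\<^esub> f = c \<odot>\<^bsub>F\<^esub> (g \<otimes>\<^bsub>F\<^esub> f)"
    proof
      fix z
      let ?t = "\<lambda>g p. if fst p \<otimes>\<^bsub>M\<^esub> snd p = z then g (fst p) \<otimes> f (snd p) else \<zero>"
      have "((c \<odot>\<^bsub>F\<^esub> g) \<otimes>\<^bsub>F\<^esub> f) z = (\<Oplus>p\<in>supp g \<times> supp f. ?t (c \<odot>\<^bsub>F\<^esub> g) p)"
        by (rule F_mult_superset) (use f g fin c in \<open>auto simp: F_smult_closed\<close>, use c in \<open>auto simp: F_simps\<close>)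
      also have "\<dots> = (\<Oplus>p\<in>supp g \<times> supp f. c \<otimes> ?t g p)"
        by (rule K.finsum_cong') (use c cf cg in \<open>auto simp: F_simps m_assoc\<close>)
      also have "\<dots> = c \<otimes> (\<Oplus>p\<in>supp g \<times> supp f. ?t g p)"
        by (rule K.finsum_rdistr[symmetric]) (use fin c cf cg in auto)
      also have "\<dots> = (c \<odot>\<^bsub>F\<^esub> (g \<otimes>\<^bsub>F\<^esub> f)) z"
        using F_mult_superset[OF g f fin] by (simp add: F_simps)
      finally show "((c \<odot>\<^bsub>F\<^esub> g) \<otimes>\<^bsub>F\<^esub> f) z = (c \<odot>\<^bsub>F\<^esub> (g \<otimes>\<^bsub>F\<^esub> f)) z" .
    qed
  qed (use f in \<open>auto simp: F_mult_closed\<close>)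
qed

lemma basis_elt_mult:
  assumes "m \<in> carrier M" "n \<in> carrier M"
  shows "basis_elt K m \<otimes>\<^bsub>F\<^esub> basis_elt K n = basis_elt K (m \<otimes>\<^bsub>M\<^esub> n)"
proof
  fix z
  have "(basis_elt K m \<otimes>\<^bsub>F\<^esub> basis_elt K n) z = (\<Oplus>p\<in>{m} \<times> {n}.
      if fst p \<otimes>\<^bsub>M\<^esub> snd p = z then basis_elt K m (fst p) \<otimes> basis_elt K n (snd p) else \<zero>)"
    by (rule F_mult_superset) (use assms in \<open>auto simp: basis_elt_closed\<close>, auto simp: basis_elt_def split: if_splits)
  also have "\<dots> = basis_elt K (m \<otimes>\<^bsub>M\<^esub> n) z"
    by (auto simp: basis_elt_def)
  finally show "(basis_elt K m \<otimes>\<^bsub>F\<^esub> basis_elt K n) z = basis_elt K (m \<otimes>\<^bsub>M\<^esub> n) z" .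
qed

lemma F_linear_eqI:
  assumes "module K P" "g \<in> linear_maps K F P" "h \<in> linear_maps K F P"
    and "\<And>m. m \<in> carrier M \<Longrightarrow> g (basis_elt K m) = h (basis_elt K m)" and "x \<in> carrier F"
  shows "g x = h x"
  by (rule linear_maps_eq_on_span[OF module_F assms(1-3), of "basis_elt K ` carrier M"])
     (use assms basis_elt_closed F_span in auto)

text \<open>Both sides are linear in each of \<open>f\<close>, \<open>g\<close> and
  \<open>h\<close>. Replacing the arguments one after the other by basis elements reduces the claim
  to associativity of \<open>M\<close>.\<close>

lemma F_mult_assoc:
  assumes f: "f \<in> carrier F" and g: "g \<in> carrier F" and h: "h \<in> carrier F"
  shows "(f \<otimes>\<^bsub>F\<^esub> g) \<otimes>\<^bsub>F\<^esub> h = f \<otimes>\<^bsub>F\<^esub> (g \<otimes>\<^bsub>F\<^esub> h)"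
proof (rule F_linear_eqI[OF module_F, of "\<lambda>f. (f \<otimes>\<^bsub>F\<^esub> g) \<otimes>\<^bsub>F\<^esub> h" "\<lambda>f. f \<otimes>\<^bsub>F\<^esub> (g \<otimes>\<^bsub>F\<^esub> h)"])
  show "(\<lambda>f. (f \<otimes>\<^bsub>F\<^esub> g) \<otimes>\<^bsub>F\<^esub> h) \<in> linear_maps K F F"
    by (rule linear_maps_comp[OF F_mult_linear(2) F_mult_linear(2)]) (use assms in auto)
  show "(\<lambda>f. f \<otimes>\<^bsub>F\<^esub> (g \<otimes>\<^bsub>F\<^esub> h)) \<in> linear_maps K F F"
    by (rule F_mult_linear(2)) (use assms F_mult_closed in auto)
  fix m assume m: "m \<in> carrier M"
  note em = basis_elt_closed[OF m]
  show "basis_elt K m \<otimes>\<^bsub>F\<^esub> g \<otimes>\<^bsub>F\<^esub> h = basis_elt K m \<otimes>\<^bsub>F\<^esub> (g \<otimes>\<^bsub>F\<^esub> h)"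
  proof (rule F_linear_eqI[OF module_F, of "\<lambda>g. basis_elt K m \<otimes>\<^bsub>F\<^esub> g \<otimes>\<^bsub>F\<^esub> h"
        "\<lambda>g. basis_elt K m \<otimes>\<^bsub>F\<^esub> (g \<otimes>\<^bsub>F\<^esub> h)"])
    show "(\<lambda>g. basis_elt K m \<otimes>\<^bsub>F\<^esub> g \<otimes>\<^bsub>F\<^esub> h) \<in> linear_maps K F F"
      by (rule linear_maps_comp[OF F_mult_linear(2)[OF h] F_mult_linear(1)[OF em]])
    show "(\<lambda>g. basis_elt K m \<otimes>\<^bsub>F\<^esub> (g \<otimes>\<^bsub>F\<^esub> h)) \<in> linear_maps K F F"
      by (rule linear_maps_comp[OF F_mult_linear(1)[OF em] F_mult_linear(2)[OF h]])
    fix n assume n: "n \<in> carrier M"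
    note en = basis_elt_closed[OF n]
    show "basis_elt K m \<otimes>\<^bsub>F\<^esub> basis_elt K n \<otimes>\<^bsub>F\<^esub> h = basis_elt K m \<otimes>\<^bsub>F\<^esub> (basis_elt K n \<otimes>\<^bsub>F\<^esub> h)"
    proof (rule F_linear_eqI[OF module_F, of "\<lambda>h. basis_elt K m \<otimes>\<^bsub>F\<^esub> basis_elt K n \<otimes>\<^bsub>F\<^esub> h"
          "\<lambda>h. basis_elt K m \<otimes>\<^bsub>F\<^esub> (basis_elt K n \<otimes>\<^bsub>F\<^esub> h)"])
      show "(\<lambda>h. basis_elt K m \<otimes>\<^bsub>F\<^esub> basis_elt K n \<otimes>\<^bsub>F\<^esub> h) \<in> linear_maps K F F"
        by (rule F_mult_linear(1)) (use em en F_mult_closed in auto)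
      show "(\<lambda>h. basis_elt K m \<otimes>\<^bsub>F\<^esub> (basis_elt K n \<otimes>\<^bsub>F\<^esub> h)) \<in> linear_maps K F F"
        by (rule linear_maps_comp[OF F_mult_linear(1)[OF em] F_mult_linear(1)[OF en]])
    qed (use m n h in \<open>auto simp: basis_elt_mult Mon.m_assoc\<close>)
  qed (rule g)
qed (rule f)

lemma assoc_algebra_F: "assoc_algebra K F"
proof -
  have one: "\<one>\<^bsub>F\<^esub> \<in> carrier F" by (simp add: F_simps basis_elt_closed)
  have "ring F"
  proof (rule ringI)
    show "abelian_group F" by (rule F.abelian_group_axioms)
    show "monoid F"
    proof (rule monoidI)
      fix f assume f: "f \<in> carrier F"
      show "\<one>\<^bsub>F\<^esub> \<otimes>\<^bsub>F\<^esub> f = f"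
        by (rule F_linear_eqI[OF module_F, of "\<lambda>f. \<one>\<^bsub>F\<^esub> \<otimes>\<^bsub>F\<^esub> f" "\<lambda>f. f"])
           (use f one F_mult_linear(1) in \<open>auto simp: linear_maps_id F_simps basis_elt_mult\<close>)
      show "f \<otimes>\<^bsub>F\<^esub> \<one>\<^bsub>F\<^esub> = f"
        by (rule F_linear_eqI[OF module_F, of "\<lambda>f. f \<otimes>\<^bsub>F\<^esub> \<one>\<^bsub>F\<^esub>" "\<lambda>f. f"])
           (use f one F_mult_linear(2) in \<open>auto simp: linear_maps_id F_simps basis_elt_mult\<close>)
    qed (auto simp: one F_mult_closed F_mult_assoc)
  qed (auto simp: linear_maps_add[OF F_mult_linear(1)] linear_maps_add[OF F_mult_linear(2)])
  then show ?thesis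
    by (intro assoc_algebra.intro module_F assoc_algebra_axioms.intro)
       (auto simp: linear_maps_smult[OF F_mult_linear(1)] linear_maps_smult[OF F_mult_linear(2)])
qed

end

section \<open>Algebras presented by linear relations between basis elements\<close>

lemma (in abelian_group) minus_eq_zero_iff:
  assumes "x \<in> carrier G" "y \<in> carrier G"
  shows "x \<ominus> y = \<zero> \<longleftrightarrow> x = y"
  using assms by (metis a_minus_def add.inv_closed add.inv_equality add.inv_inv r_neg)

text \<open>With \<open>h\<close> the multiplication by a fixed element, membership of a product in
  \<open>H\<close> becomes a submodule condition, which can be tested on generators.\<close>

lemma submodule_preimage:
  assumes M: "module K M" and N: "module K N" and h: "h \<in> linear_maps K M N"
    and H: "submodule H K N"
  shows "submodule {x \<in> carrier M. h x \<in> H} K M"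
proof -
  interpret M: module K M by fact
  interpret N: module K N by fact
  show ?thesis
    by (rule M.submoduleI)
       (auto simp: linear_maps_zero[OF M N h] linear_maps_a_inv[OF M N h] linear_maps_add[OF h]
         linear_maps_smult[OF h] N.submodule_zero[OF H] N.submoduleE(3,4,5)[OF H])
qed

text \<open>\<open>Radd a b c\<close> imposes \<open>a = b + c\<close> on the basis of the monoid algebra and \<open>Rsmult k a b\<close>
  imposes \<open>a = k b\<close>; both the tensor algebra and the tensor product of two algebras are of this kind.\<close>

locale presented_algebra = monoid_ring K M
  for K :: "('k, 'm) ring_scheme" (structure) and M :: "('a, 'p) monoid_scheme" +
  fixes Radd :: "'a \<Rightarrow> 'a \<Rightarrow> 'a \<Rightarrow> bool" and Rsmult :: "'k \<Rightarrow> 'a \<Rightarrow> 'a \<Rightarrow> bool"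
  assumes Radd_carrier: "Radd a b c \<Longrightarrow> a \<in> carrier M \<and> b \<in> carrier M \<and> c \<in> carrier M"
    and Rsmult_carrier: "Rsmult k a b \<Longrightarrow> k \<in> carrier K \<and> a \<in> carrier M \<and> b \<in> carrier M"
    and Radd_mult: "Radd a b c \<Longrightarrow> m \<in> carrier M \<Longrightarrow>
      Radd (m \<otimes>\<^bsub>M\<^esub> a) (m \<otimes>\<^bsub>M\<^esub> b) (m \<otimes>\<^bsub>M\<^esub> c) \<and> Radd (a \<otimes>\<^bsub>M\<^esub> m) (b \<otimes>\<^bsub>M\<^esub> m) (c \<otimes>\<^bsub>M\<^esub> m)"
    and Rsmult_mult: "Rsmult k a b \<Longrightarrow> m \<in> carrier M \<Longrightarrow>
      Rsmult k (m \<otimes>\<^bsub>M\<^esub> a) (m \<otimes>\<^bsub>M\<^esub> b) \<and> Rsmult k (a \<otimes>\<^bsub>M\<^esub> m) (b \<otimes>\<^bsub>M\<^esub> m)"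
begin

abbreviation e :: "'a \<Rightarrow> 'a \<Rightarrow> 'k" where "e \<equiv> basis_elt K"

definition rels :: "('a \<Rightarrow> 'k) set"
  where "rels = {e a \<ominus>\<^bsub>F\<^esub> (e b \<oplus>\<^bsub>F\<^esub> e c) | a b c. Radd a b c} \<union>
    {e a \<ominus>\<^bsub>F\<^esub> (k \<odot>\<^bsub>F\<^esub> e b) | k a b. Rsmult k a b}"

definition N :: "('a \<Rightarrow> 'k) set" where "N = submodule_span K F rels"

definition A :: "('k, ('a \<Rightarrow> 'k) set) module" where "A = quotient_algebra F N"

definition cls :: "'a \<Rightarrow> ('a \<Rightarrow> 'k) set" where "cls m = N +>\<^bsub>F\<^esub> e m"

sublocale F: assoc_algebra K F by (rule assoc_algebra_F)

lemma rels_subset: "rels \<subseteq> carrier F"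
  unfolding rels_def using Radd_carrier Rsmult_carrier by (fastforce intro!: basis_elt_closed)

lemma submodule_N: "submodule N K F"
  unfolding N_def by (rule F.submodule_submodule_span[OF rels_subset])

lemma rels_N: "rels \<subseteq> N"
  unfolding N_def by (rule submodule_span_superset)

lemma N_least: "submodule H K F \<Longrightarrow> rels \<subseteq> H \<Longrightarrow> N \<subseteq> H"
  unfolding N_def by (rule submodule_span_least)

lemma F_submodule_eq:
  assumes "submodule H K F" "\<And>m. m \<in> carrier M \<Longrightarrow> e m \<in> H" "x \<in> carrier F"
  shows "x \<in> H"
  using submodule_span_least[OF assms(1), of "e ` carrier M"] assms F_span by blast

text \<open>The stability of \<open>Radd\<close> and \<open>Rsmult\<close> under the monoid product
  is used here; it makes the span of the relations an ideal and not only a submodule.\<close>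

lemma rels_mult:
  assumes m: "m \<in> carrier M" and r: "r \<in> rels"
  shows "e m \<otimes>\<^bsub>F\<^esub> r \<in> rels" "r \<otimes>\<^bsub>F\<^esub> e m \<in> rels"
proof -
  note em = basis_elt_closed[OF m]
  note L1 = F_mult_linear(1)[OF em] and L2 = F_mult_linear(2)[OF em]
  have "e m \<otimes>\<^bsub>F\<^esub> r \<in> rels \<and> r \<otimes>\<^bsub>F\<^esub> e m \<in> rels"
    using r[unfolded rels_def]
  proof (elim UnE CollectE exE conjE)
    fix a b c assume r: "r = e a \<ominus>\<^bsub>F\<^esub> (e b \<oplus>\<^bsub>F\<^esub> e c)" and R: "Radd a b c"
    have abc: "a \<in> carrier M" "b \<in> carrier M" "c \<in> carrier M" using Radd_carrier[OF R] by auto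
    note eabc = basis_elt_closed[OF abc(1)] basis_elt_closed[OF abc(2)] basis_elt_closed[OF abc(3)]
    have "e m \<otimes>\<^bsub>F\<^esub> r = e (m \<otimes>\<^bsub>M\<^esub> a) \<ominus>\<^bsub>F\<^esub> (e (m \<otimes>\<^bsub>M\<^esub> b) \<oplus>\<^bsub>F\<^esub> e (m \<otimes>\<^bsub>M\<^esub> c))"
      unfolding r using eabc abc m
      by (simp add: linear_maps_minus[OF module_F module_F L1] linear_maps_add[OF L1] basis_elt_mult)
    moreover have "r \<otimes>\<^bsub>F\<^esub> e m = e (a \<otimes>\<^bsub>M\<^esub> m) \<ominus>\<^bsub>F\<^esub> (e (b \<otimes>\<^bsub>M\<^esub> m) \<oplus>\<^bsub>F\<^esub> e (c \<otimes>\<^bsub>M\<^esub> m))"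
      unfolding r using eabc abc m
      by (simp add: linear_maps_minus[OF module_F module_F L2] linear_maps_add[OF L2] basis_elt_mult)
    ultimately show ?thesis using Radd_mult[OF R m] unfolding rels_def by blast
  next
    fix k a b assume r: "r = e a \<ominus>\<^bsub>F\<^esub> (k \<odot>\<^bsub>F\<^esub> e b)" and R: "Rsmult k a b"
    have abc: "a \<in> carrier M" "b \<in> carrier M" "k \<in> carrier K" using Rsmult_carrier[OF R] by auto
    note eabc = basis_elt_closed[OF abc(1)] basis_elt_closed[OF abc(2)]
    have "e m \<otimes>\<^bsub>F\<^esub> r = e (m \<otimes>\<^bsub>M\<^esub> a) \<ominus>\<^bsub>F\<^esub> (k \<odot>\<^bsub>F\<^esub> e (m \<otimes>\<^bsub>M\<^esub> b))"
      unfolding r using eabc abc m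
      by (simp add: linear_maps_minus[OF module_F module_F L1] linear_maps_smult[OF L1] basis_elt_mult)
    moreover have "r \<otimes>\<^bsub>F\<^esub> e m = e (a \<otimes>\<^bsub>M\<^esub> m) \<ominus>\<^bsub>F\<^esub> (k \<odot>\<^bsub>F\<^esub> e (b \<otimes>\<^bsub>M\<^esub> m))"
      unfolding r using eabc abc m
      by (simp add: linear_maps_minus[OF module_F module_F L2] linear_maps_smult[OF L2] basis_elt_mult)
    ultimately show ?thesis using Rsmult_mult[OF R m] unfolding rels_def by blast
  qed
  then show "e m \<otimes>\<^bsub>F\<^esub> r \<in> rels" "r \<otimes>\<^bsub>F\<^esub> e m \<in> rels" by auto
qed

text \<open>Testing on generators happens twice: first in \<open>N\<close>, generated by the
  relations, with a basis element as multiplier; then in \<open>F\<close>, generated by the basis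
  elements, with \<open>a\<close> in \<open>N\<close> fixed.\<close>

lemma ideal_N: "ideal N F"
proof (rule idealI)
  show "ring F" by (rule F.A.ring_axioms)
  show "subgroup N (add_monoid F)" by (rule submodule.axioms(1)[OF submodule_N])
  fix a x assume a: "a \<in> N" and x: "x \<in> carrier F"
  have aF: "a \<in> carrier F" using a F.submoduleE(1)[OF submodule_N] by blast
  have 1: "e m \<otimes>\<^bsub>F\<^esub> a \<in> N \<and> a \<otimes>\<^bsub>F\<^esub> e m \<in> N" if m: "m \<in> carrier M" for m
  proof -
    note em = basis_elt_closed[OF m]
    have "N \<subseteq> {x \<in> carrier F. e m \<otimes>\<^bsub>F\<^esub> x \<in> N}"
      by (rule N_least[OF submodule_preimage[OF module_F module_F F_mult_linear(1)[OF em] submodule_N]])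
         (use rels_mult[OF m] rels_N rels_subset in auto)
    moreover have "N \<subseteq> {x \<in> carrier F. x \<otimes>\<^bsub>F\<^esub> e m \<in> N}"
      by (rule N_least[OF submodule_preimage[OF module_F module_F F_mult_linear(2)[OF em] submodule_N]])
         (use rels_mult[OF m] rels_N rels_subset in auto)
    ultimately show ?thesis using a by blast
  qed
  have "x \<in> {x \<in> carrier F. x \<otimes>\<^bsub>F\<^esub> a \<in> N}"
    by (rule F_submodule_eq[OF submodule_preimage[OF module_F module_F F_mult_linear(2)[OF aF] submodule_N]])
       (use 1 x basis_elt_closed in auto)
  then show "x \<otimes>\<^bsub>F\<^esub> a \<in> N" by simp
  have "x \<in> {x \<in> carrier F. a \<otimes>\<^bsub>F\<^esub> x \<in> N}"
    by (rule F_submodule_eq[OF submodule_preimage[OF module_F module_F F_mult_linear(1)[OF aF] submodule_N]])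
       (use 1 x basis_elt_closed in auto)
  then show "a \<otimes>\<^bsub>F\<^esub> x \<in> N" by simp
qed

sublocale N: ideal N F by (rule ideal_N)

lemma carrier_A: "carrier A = (\<lambda>f. N +>\<^bsub>F\<^esub> f) ` carrier F"
  by (auto simp: A_def quotient_algebra_def FactRing_simps)

lemma A_ops:
  assumes "f \<in> carrier F" "g \<in> carrier F"
  shows "(N +>\<^bsub>F\<^esub> f) \<otimes>\<^bsub>A\<^esub> (N +>\<^bsub>F\<^esub> g) = N +>\<^bsub>F\<^esub> (f \<otimes>\<^bsub>F\<^esub> g)"
    "(N +>\<^bsub>F\<^esub> f) \<oplus>\<^bsub>A\<^esub> (N +>\<^bsub>F\<^esub> g) = N +>\<^bsub>F\<^esub> (f \<oplus>\<^bsub>F\<^esub> g)"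
  using assms by (simp_all add: A_def quotient_algebra_def FactRing_def N.rcoset_mult_add N.a_rcos_sum)

lemma A_one: "\<one>\<^bsub>A\<^esub> = N +>\<^bsub>F\<^esub> \<one>\<^bsub>F\<^esub>"
  by (simp add: A_def quotient_algebra_def FactRing_def)

lemma A_zero: "\<zero>\<^bsub>A\<^esub> = N +>\<^bsub>F\<^esub> \<zero>\<^bsub>F\<^esub>"
  using F.M.a_coset_add_zero[OF F.submoduleE(1)[OF submodule_N]]
  by (simp add: A_def quotient_algebra_def FactRing_def)

lemma coset_eq_iff:
  assumes "f \<in> carrier F" "g \<in> carrier F"
  shows "N +>\<^bsub>F\<^esub> f = N +>\<^bsub>F\<^esub> g \<longleftrightarrow> f \<ominus>\<^bsub>F\<^esub> g \<in> N"
proof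
  assume "N +>\<^bsub>F\<^esub> f = N +>\<^bsub>F\<^esub> g"
  then have "f \<in> N +>\<^bsub>F\<^esub> g" using N.a_rcos_self[OF assms(1)] by simp
  then show "f \<ominus>\<^bsub>F\<^esub> g \<in> N"
    by (simp only: N.a_rcos_module_minus[OF F.A.ring_axioms assms(2,1)])
next
  assume "f \<ominus>\<^bsub>F\<^esub> g \<in> N"
  then have "f \<in> N +>\<^bsub>F\<^esub> g"
    by (simp only: N.a_rcos_module_minus[OF F.A.ring_axioms assms(2,1)])
  then show "N +>\<^bsub>F\<^esub> f = N +>\<^bsub>F\<^esub> g"
    by (rule N.a_repr_independence'[OF _ assms(2), symmetric])
qed

text \<open>The scalar multiple in \<open>quotient_algebra\<close> is a union over all
  representatives of the coset. They all yield the same coset because \<open>N\<close> is closed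
  under scalars, so the union collapses.\<close>

lemma A_smult:
  assumes c: "c \<in> carrier K" and f: "f \<in> carrier F"
  shows "c \<odot>\<^bsub>A\<^esub> (N +>\<^bsub>F\<^esub> f) = N +>\<^bsub>F\<^esub> (c \<odot>\<^bsub>F\<^esub> f)"
proof -
  have "N +>\<^bsub>F\<^esub> (c \<odot>\<^bsub>F\<^esub> a) = N +>\<^bsub>F\<^esub> (c \<odot>\<^bsub>F\<^esub> f)" if a: "a \<in> N +>\<^bsub>F\<^esub> f" for a
  proof -
    have aF: "a \<in> carrier F" using N.a_elemrcos_carrier[OF f a] .
    have "a \<ominus>\<^bsub>F\<^esub> f \<in> N" using N.a_rcos_module_minus[OF F.A.ring_axioms f aF] a by simp
    then have "c \<odot>\<^bsub>F\<^esub> (a \<ominus>\<^bsub>F\<^esub> f) \<in> N" using c F.submoduleE(4)[OF submodule_N] by blast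
    also have "c \<odot>\<^bsub>F\<^esub> (a \<ominus>\<^bsub>F\<^esub> f) = c \<odot>\<^bsub>F\<^esub> a \<ominus>\<^bsub>F\<^esub> c \<odot>\<^bsub>F\<^esub> f"
      using c aF f by (simp add: a_minus_def F.smult_r_distr F.smult_r_minus)
    finally show ?thesis using coset_eq_iff c aF f by simp
  qed
  then have "(\<Union>a\<in>N +>\<^bsub>F\<^esub> f. N +>\<^bsub>F\<^esub> (c \<odot>\<^bsub>F\<^esub> a)) = N +>\<^bsub>F\<^esub> (c \<odot>\<^bsub>F\<^esub> f)"
    by (intro UN_constant_eq[OF N.a_rcos_self[OF f]] ballI)
  then show ?thesis by (simp only: A_def quotient_algebra_def module.simps)
qed

lemma assoc_algebra_A: "assoc_algebra K A"
proof -
  have "ring A"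
  proof (rule ringI)
    show "abelian_group A"
    proof (rule abelian_groupI)
      fix x assume "x \<in> carrier A"
      then obtain f where f: "f \<in> carrier F" "x = N +>\<^bsub>F\<^esub> f" by (auto simp: carrier_A)
      show "\<exists>y\<in>carrier A. y \<oplus>\<^bsub>A\<^esub> x = \<zero>\<^bsub>A\<^esub>"
        by (rule bexI[of _ "N +>\<^bsub>F\<^esub> (\<ominus>\<^bsub>F\<^esub> f)"])
           (use f in \<open>auto simp: carrier_A A_ops A_zero F.M.l_neg\<close>)
    qed (auto simp: carrier_A A_ops A_zero F.M.a_ac)
    show "monoid A"
      by (rule monoidI) (auto simp: carrier_A A_ops A_one F.A.m_assoc)
  qed (auto simp: carrier_A A_ops F.A.l_distr F.A.r_distr)
  moreover from this have "module K A"
    by (intro moduleI)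
       (auto simp: is_cring carrier_A A_ops A_smult F.smult_l_distr F.smult_r_distr F.smult_assoc1
         ring.is_abelian_group)
  ultimately show ?thesis
    by (intro assoc_algebra.intro assoc_algebra_axioms.intro)
       (auto simp: carrier_A A_ops A_smult F.smult_mult_left F.smult_mult_right)
qed

sublocale A: assoc_algebra K A by (rule assoc_algebra_A)

lemma coset_linear: "(\<lambda>f. N +>\<^bsub>F\<^esub> f) \<in> linear_maps K F A"
  by (rule linear_mapsI) (auto simp: carrier_A A_ops A_smult)

lemma cls_closed: "m \<in> carrier M \<Longrightarrow> cls m \<in> carrier A"
  by (auto simp: cls_def carrier_A basis_elt_closed)

lemma cls_mult: "m \<in> carrier M \<Longrightarrow> n \<in> carrier M \<Longrightarrow> cls m \<otimes>\<^bsub>A\<^esub> cls n = cls (m \<otimes>\<^bsub>M\<^esub> n)"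
  by (simp add: cls_def A_ops basis_elt_closed basis_elt_mult)

lemma cls_one: "cls \<one>\<^bsub>M\<^esub> = \<one>\<^bsub>A\<^esub>"
  by (simp add: cls_def A_one F_simps)

lemma cls_Radd:
  assumes R: "Radd a b c"
  shows "cls a = cls b \<oplus>\<^bsub>A\<^esub> cls c"
proof -
  have abc: "e a \<in> carrier F" "e b \<in> carrier F" "e c \<in> carrier F"
    using Radd_carrier[OF R] by (auto simp: basis_elt_closed)
  have "e a \<ominus>\<^bsub>F\<^esub> (e b \<oplus>\<^bsub>F\<^esub> e c) \<in> rels" using R unfolding rels_def by blast
  then have "e a \<ominus>\<^bsub>F\<^esub> (e b \<oplus>\<^bsub>F\<^esub> e c) \<in> N" by (rule subsetD[OF rels_N])
  then have "N +>\<^bsub>F\<^esub> e a = N +>\<^bsub>F\<^esub> (e b \<oplus>\<^bsub>F\<^esub> e c)"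
    by (subst coset_eq_iff) (use abc in auto)
  then show ?thesis using abc(2,3) by (simp only: cls_def A_ops)
qed

lemma cls_Rsmult:
  assumes R: "Rsmult k a b"
  shows "cls a = k \<odot>\<^bsub>A\<^esub> cls b"
proof -
  have abc: "e a \<in> carrier F" "e b \<in> carrier F" "k \<in> carrier K"
    using Rsmult_carrier[OF R] by (auto simp: basis_elt_closed)
  have "e a \<ominus>\<^bsub>F\<^esub> (k \<odot>\<^bsub>F\<^esub> e b) \<in> rels" using R unfolding rels_def by blast
  then have "e a \<ominus>\<^bsub>F\<^esub> (k \<odot>\<^bsub>F\<^esub> e b) \<in> N" by (rule subsetD[OF rels_N])
  then have "N +>\<^bsub>F\<^esub> e a = N +>\<^bsub>F\<^esub> (k \<odot>\<^bsub>F\<^esub> e b)"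
    by (subst coset_eq_iff) (use abc in auto)
  then show ?thesis using abc(2,3) by (simp only: cls_def A_smult)
qed

text \<open>The preimage of \<open>H\<close> under the projection is a submodule of \<open>F\<close>
  that contains all basis elements.\<close>

lemma A_submodule_eq:
  assumes H: "submodule H K A" and cls: "\<And>m. m \<in> carrier M \<Longrightarrow> cls m \<in> H" and x: "x \<in> carrier A"
  shows "x \<in> H"
proof -
  obtain f where f: "f \<in> carrier F" "x = N +>\<^bsub>F\<^esub> f" using x by (auto simp: carrier_A)
  have "f \<in> {f \<in> carrier F. N +>\<^bsub>F\<^esub> f \<in> H}"
    by (rule F_submodule_eq[OF submodule_preimage[OF module_F A.module_axioms coset_linear H]])
       (use cls f basis_elt_closed in \<open>auto simp: cls_def\<close>)
  then show ?thesis using f by simp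
qed

lemma A_linear_eqI:
  assumes P: "module K P" and g: "g \<in> linear_maps K A P" and h: "h \<in> linear_maps K A P"
    and "\<And>m. m \<in> carrier M \<Longrightarrow> g (cls m) = h (cls m)" and "x \<in> carrier A"
  shows "g x = h x"
proof -
  have "x \<in> {x \<in> carrier A. g x = h x}"
    by (rule A_submodule_eq[OF submodule_equalizer[OF A.module_axioms P g h]])
       (use assms cls_closed in auto)
  then show ?thesis by simp
qed

text \<open>The choice of a representative is harmless when \<open>\<phi>\<close> respects the
  relations, because \<open>free_ext P \<phi>\<close> then vanishes on \<open>N\<close>.\<close>

definition lift :: "('k, 'b, 'r) module_scheme \<Rightarrow> ('a \<Rightarrow> 'b) \<Rightarrow> ('a \<Rightarrow> 'k) set \<Rightarrow> 'b"
  where "lift P \<phi> X = free_ext P \<phi> (SOME f. f \<in> carrier F \<and> N +>\<^bsub>F\<^esub> f = X)"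

context
  fixes P :: "('k, 'b, 'r) module_scheme" and \<phi> :: "'a \<Rightarrow> 'b"
  assumes P: "module K P" and \<phi>: "\<And>z. z \<in> carrier M \<Longrightarrow> \<phi> z \<in> carrier P"
    and \<phi>_add: "\<And>a b c. Radd a b c \<Longrightarrow> \<phi> a = \<phi> b \<oplus>\<^bsub>P\<^esub> \<phi> c"
    and \<phi>_smult: "\<And>k a b. Rsmult k a b \<Longrightarrow> \<phi> a = k \<odot>\<^bsub>P\<^esub> \<phi> b"
begin

interpretation P: module K P by (rule P)

text \<open>The kernel of the free extension is a submodule, and the hypotheses on
  \<open>\<phi>\<close> say precisely that it contains the generators of \<open>N\<close>.\<close>

lemma free_ext_N: "f \<in> N \<Longrightarrow> free_ext P \<phi> f = \<zero>\<^bsub>P\<^esub>"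
proof -
  have lin: "free_ext P \<phi> \<in> linear_maps K F P"
    by (rule free_ext_linear[OF P]) (rule \<phi>)
  have "N \<subseteq> {f \<in> carrier F. free_ext P \<phi> f = \<zero>\<^bsub>P\<^esub>}"
  proof (rule N_least)
    show "submodule {f \<in> carrier F. free_ext P \<phi> f = \<zero>\<^bsub>P\<^esub>} K F"
      by (rule submodule_equalizer[OF module_F P lin linear_maps_const_zero[OF module_F P]])
    have "free_ext P \<phi> f = \<zero>\<^bsub>P\<^esub>" if "f \<in> rels" for f
      using that unfolding rels_def
    proof (elim UnE CollectE exE conjE)
      fix a b c assume f: "f = e a \<ominus>\<^bsub>F\<^esub> (e b \<oplus>\<^bsub>F\<^esub> e c)" and R: "Radd a b c"
      then show ?thesis using Radd_carrier[OF R] \<phi>_add[OF R] \<phi>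
        by (simp add: linear_maps_minus[OF module_F P lin] linear_maps_add[OF lin] basis_elt_closed
          free_ext_basis_elt[OF P \<phi>] P.M.minus_eq_zero_iff)
    next
      fix k a b assume f: "f = e a \<ominus>\<^bsub>F\<^esub> (k \<odot>\<^bsub>F\<^esub> e b)" and R: "Rsmult k a b"
      then show ?thesis using Rsmult_carrier[OF R] \<phi>_smult[OF R] \<phi>
        by (simp add: linear_maps_minus[OF module_F P lin] linear_maps_smult[OF lin] basis_elt_closed
          free_ext_basis_elt[OF P \<phi>] P.M.minus_eq_zero_iff)
    qed
    then show "rels \<subseteq> {f \<in> carrier F. free_ext P \<phi> f = \<zero>\<^bsub>P\<^esub>}" using rels_subset by blast
  qed
  then show "f \<in> N \<Longrightarrow> free_ext P \<phi> f = \<zero>\<^bsub>P\<^esub>" by blast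
qed

lemma lift_coset:
  assumes f: "f \<in> carrier F"
  shows "lift P \<phi> (N +>\<^bsub>F\<^esub> f) = free_ext P \<phi> f"
proof -
  have lin: "free_ext P \<phi> \<in> linear_maps K F P"
    by (rule free_ext_linear[OF P]) (rule \<phi>)
  let ?g = "SOME g. g \<in> carrier F \<and> N +>\<^bsub>F\<^esub> g = N +>\<^bsub>F\<^esub> f"
  have g: "?g \<in> carrier F" "N +>\<^bsub>F\<^esub> ?g = N +>\<^bsub>F\<^esub> f"
    using someI[of "\<lambda>g. g \<in> carrier F \<and> N +>\<^bsub>F\<^esub> g = N +>\<^bsub>F\<^esub> f" f] f by auto
  then have "?g \<ominus>\<^bsub>F\<^esub> f \<in> N" using coset_eq_iff f by blast
  then have "free_ext P \<phi> ?g \<ominus>\<^bsub>P\<^esub> free_ext P \<phi> f = \<zero>\<^bsub>P\<^esub>"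
    using free_ext_N linear_maps_minus[OF module_F P lin g(1) f] by simp
  then show ?thesis
    unfolding lift_def using linear_maps_closed[OF lin] f g(1) by (simp add: P.M.minus_eq_zero_iff)
qed

lemma lift_linear: "lift P \<phi> \<in> linear_maps K A P"
proof -
  have lin: "free_ext P \<phi> \<in> linear_maps K F P"
    by (rule free_ext_linear[OF P]) (rule \<phi>)
  show ?thesis
    by (rule linear_mapsI)
       (auto simp: carrier_A A_ops A_smult lift_coset linear_maps_closed[OF lin]
         linear_maps_add[OF lin] linear_maps_smult[OF lin])
qed

lemma lift_cls: "m \<in> carrier M \<Longrightarrow> lift P \<phi> (cls m) = \<phi> m"
  by (simp add: cls_def lift_coset basis_elt_closed free_ext_basis_elt[OF P \<phi>])

end

end

section \<open>Sums over deshufflings and multilinear maps on words\<close>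

text \<open>These rules replace membership in \<open>lists S\<close> by a statement about the letters, to which the
  hypotheses about words below no longer apply.\<close>

declare in_listsD [rule del] in_listsI [rule del]

text \<open>The sum of \<open>B\<close> over all pairs of complementary subwords: the Sweedler sum of the coproduct of a word.\<close>

primrec deshuffle_sum ::
    "('c, 'r) ring_scheme \<Rightarrow> ('v list \<Rightarrow> 'v list \<Rightarrow> 'c) \<Rightarrow> 'v list \<Rightarrow> 'c"
  where
    "deshuffle_sum P B [] = B [] []"
  | "deshuffle_sum P B (y # w) =
      deshuffle_sum P (\<lambda>a b. B (y # a) b) w \<oplus>\<^bsub>P\<^esub> deshuffle_sum P (\<lambda>a b. B a (y # b)) w"

text \<open>The sum of \<open>B\<close> over the words obtained from a word by multiplying one letter by \<open>y\<close>.\<close>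

primrec derivation_sum ::
    "('c, 'r) ring_scheme \<Rightarrow> ('v \<Rightarrow> 'v \<Rightarrow> 'v) \<Rightarrow> ('v list \<Rightarrow> 'c) \<Rightarrow> 'v \<Rightarrow> 'v list \<Rightarrow> 'c"
  where
    "derivation_sum P prd B y [] = \<zero>\<^bsub>P\<^esub>"
  | "derivation_sum P prd B y (z # w) =
      B (prd z y # w) \<oplus>\<^bsub>P\<^esub> derivation_sum P prd (\<lambda>v. B (z # v)) y w"

text \<open>Such a \<open>\<phi>\<close> is a family of multilinear maps, one on each power of
  \<open>V\<close>, with a mere element of \<open>P\<close> for the empty word: the data of a linear
  map from T(V) to \<open>P\<close>.\<close>

definition multilinear ::
    "('k, 'm) ring_scheme \<Rightarrow> ('k, 'v, 'p) module_scheme \<Rightarrow> ('k, 'c, 'r) module_scheme \<Rightarrow>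
      ('v list \<Rightarrow> 'c) \<Rightarrow> bool"
  where "multilinear K V P \<phi> \<longleftrightarrow> \<phi> [] \<in> carrier P \<and>
    (\<forall>u\<in>lists (carrier V). \<forall>w\<in>lists (carrier V). (\<lambda>x. \<phi> (u @ x # w)) \<in> linear_maps K V P)"

lemma multilinearI:
  assumes "\<phi> [] \<in> carrier P"
    and "\<And>u w. u \<in> lists (carrier V) \<Longrightarrow> w \<in> lists (carrier V) \<Longrightarrow>
      (\<lambda>x. \<phi> (u @ x # w)) \<in> linear_maps K V P"
  shows "multilinear K V P \<phi>"
  using assms by (simp add: multilinear_def)

lemma multilinear_linear:
  assumes "multilinear K V P \<phi>" "u \<in> lists (carrier V)" "w \<in> lists (carrier V)"
  shows "(\<lambda>x. \<phi> (u @ x # w)) \<in> linear_maps K V P"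
  using assms by (simp add: multilinear_def)

lemma multilinear_closed:
  assumes "multilinear K V P \<phi>" "w \<in> lists (carrier V)"
  shows "\<phi> w \<in> carrier P"
proof (cases w)
  case Nil
  then show ?thesis using assms by (simp add: multilinear_def)
next
  case (Cons x v)
  then have "(\<lambda>x. \<phi> ([] @ x # v)) \<in> linear_maps K V P" "x \<in> carrier V"
    using assms(2) multilinear_linear[OF assms(1), of "[]" v] by auto
  then show ?thesis using linear_maps_closed Cons by fastforce
qed

lemma multilinear_comp:
  assumes "g \<in> linear_maps K P Q" "multilinear K V P \<phi>"
  shows "multilinear K V Q (\<lambda>w. g (\<phi> w))"
  by (intro multilinearI linear_maps_comp[OF assms(1)] linear_maps_closed[OF assms(1)]
      multilinear_linear[OF assms(2)] multilinear_closed[OF assms(2)]) auto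

lemma multilinear_Cons:
  assumes "multilinear K V P \<phi>" "x \<in> carrier V"
  shows "multilinear K V P (\<lambda>w. \<phi> (x # w))"
proof (rule multilinearI)
  show "\<phi> [x] \<in> carrier P" using multilinear_closed[OF assms(1)] assms(2) by simp
  fix u w assume "u \<in> lists (carrier V)" "w \<in> lists (carrier V)"
  then show "(\<lambda>y. \<phi> (x # u @ y # w)) \<in> linear_maps K V P"
    using multilinear_linear[OF assms(1), of "x # u" w] assms(2) by simp
qed

lemma bilinear_maps_right:
  "\<beta> \<in> bilinear_maps K M N P \<Longrightarrow> x \<in> carrier M \<Longrightarrow> (\<lambda>y. \<beta> x y) \<in> linear_maps K N P"
  by (simp add: bilinear_maps_def)

lemma bilinear_maps_left:
  "\<beta> \<in> bilinear_maps K M N P \<Longrightarrow> y \<in> carrier N \<Longrightarrow> (\<lambda>x. \<beta> x y) \<in> linear_maps K M P"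
  by (simp add: bilinear_maps_def)

lemma bilinear_maps_closed:
  "\<beta> \<in> bilinear_maps K M N P \<Longrightarrow> x \<in> carrier M \<Longrightarrow> y \<in> carrier N \<Longrightarrow> \<beta> x y \<in> carrier P"
  using linear_maps_closed[OF bilinear_maps_right] .

section \<open>Coalgebra laws for sums over splittings of a word\<close>

lemma deshuffle_sum_cong:
  assumes "w \<in> lists S" "\<And>a b. a \<in> lists S \<Longrightarrow> b \<in> lists S \<Longrightarrow> B a b = C a b"
  shows "deshuffle_sum P B w = deshuffle_sum P C w"
  using assms
proof (induction w arbitrary: B C rule: list.induct)
  case (Cons y w)
  have "deshuffle_sum P (\<lambda>a b. B (y # a) b) w = deshuffle_sum P (\<lambda>a b. C (y # a) b) w"
    "deshuffle_sum P (\<lambda>a b. B a (y # b)) w = deshuffle_sum P (\<lambda>a b. C a (y # b)) w"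
    using Cons.prems(1) by (auto intro!: Cons.IH Cons.prems(2))
  then show ?case by simp
qed simp

text \<open>The condition on the length matters: substituting a letter keeps the length. This feeds
  the inductions on the length and lets \<open>letter_star\<close> replace
  \<open>letter_star_aux\<close> at a fixed index.\<close>

lemma derivation_sum_cong:
  assumes "w \<in> lists S" "\<And>x. x \<in> S \<Longrightarrow> prd x y \<in> S"
    and "\<And>v. v \<in> lists S \<Longrightarrow> length v = length w \<Longrightarrow> B v = C v"
  shows "derivation_sum P prd B y w = derivation_sum P prd C y w"
  using assms(1,3)
proof (induction w arbitrary: B C rule: list.induct)
  case (Cons z w)
  then have "derivation_sum P prd (\<lambda>v. B (z # v)) y w = derivation_sum P prd (\<lambda>v. C (z # v)) y w"
    by (intro Cons.IH) simp_all
  then show ?case using Cons.prems(1) Cons.prems(2)[of "prd z y # w"] assms(2) by simp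
qed simp

text \<open>A splitting of \<open>u @ v\<close> is a splitting of \<open>u\<close> followed by one
  of \<open>v\<close>. For coproducts this is the multiplicativity of the deshuffling.\<close>

lemma deshuffle_sum_append:
  "deshuffle_sum P B (u @ v) =
    deshuffle_sum P (\<lambda>a b. deshuffle_sum P (\<lambda>a' b'. B (a @ a') (b @ b')) v) u"
  by (induction u arbitrary: B rule: list.induct) simp_all

lemma (in abelian_monoid) deshuffle_sum_closed:
  assumes "w \<in> lists S" "\<And>a b. a \<in> lists S \<Longrightarrow> b \<in> lists S \<Longrightarrow> B a b \<in> carrier G"
  shows "deshuffle_sum G B w \<in> carrier G"
  using assms by (induction w arbitrary: B rule: list.induct) auto

lemma (in abelian_monoid) derivation_sum_closed:
  assumes "w \<in> lists S" "\<And>x. x \<in> S \<Longrightarrow> prd x y \<in> S" "\<And>v. v \<in> lists S \<Longrightarrow> B v \<in> carrier G"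
  shows "derivation_sum G prd B y w \<in> carrier G"
  using assms(1,3)
proof (induction w arbitrary: B rule: list.induct)
  case (Cons z w)
  moreover have "B (prd z y # w) \<in> carrier G" using Cons.prems assms(2) by simp
  ultimately show ?case by auto
qed simp

lemma (in abelian_monoid) deshuffle_sum_add:
  assumes "w \<in> lists S" "\<And>a b. a \<in> lists S \<Longrightarrow> b \<in> lists S \<Longrightarrow> B a b \<in> carrier G"
    "\<And>a b. a \<in> lists S \<Longrightarrow> b \<in> lists S \<Longrightarrow> C a b \<in> carrier G"
  shows "deshuffle_sum G (\<lambda>a b. B a b \<oplus> C a b) w = deshuffle_sum G B w \<oplus> deshuffle_sum G C w"
  using assms
proof (induction w arbitrary: B C rule: list.induct)
  case (Cons y w)
  then have y: "y \<in> S" and w: "w \<in> lists S" by auto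
  have cl: "deshuffle_sum G (\<lambda>a b. B (y # a) b) w \<in> carrier G"
    "deshuffle_sum G (\<lambda>a b. B a (y # b)) w \<in> carrier G"
    "deshuffle_sum G (\<lambda>a b. C (y # a) b) w \<in> carrier G"
    "deshuffle_sum G (\<lambda>a b. C a (y # b)) w \<in> carrier G"
    by (rule deshuffle_sum_closed[OF w]; use Cons.prems y in simp)+
  have "deshuffle_sum G (\<lambda>a b. B (y # a) b \<oplus> C (y # a) b) w =
      deshuffle_sum G (\<lambda>a b. B (y # a) b) w \<oplus> deshuffle_sum G (\<lambda>a b. C (y # a) b) w"
    by (rule Cons.IH) (use Cons.prems y w in auto)
  moreover have "deshuffle_sum G (\<lambda>a b. B a (y # b) \<oplus> C a (y # b)) w =
      deshuffle_sum G (\<lambda>a b. B a (y # b)) w \<oplus> deshuffle_sum G (\<lambda>a b. C a (y # b)) w"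
    by (rule Cons.IH) (use Cons.prems y w in auto)
  ultimately show ?case using cl by (simp add: a_ac)
qed simp

lemma (in abelian_monoid) deshuffle_sum_zero: "deshuffle_sum G (\<lambda>a b. \<zero>) w = \<zero>"
  by (induction w) simp_all

text \<open>These are the counit laws: of all splittings only the one with the prescribed side empty
  survives.\<close>

lemma (in abelian_monoid) deshuffle_sum_counit:
  assumes "w \<in> lists S" "\<And>a. a \<in> lists S \<Longrightarrow> g a \<in> carrier G"
  shows "deshuffle_sum G (\<lambda>a b. if b = [] then g a else \<zero>) w = g w"
    and "deshuffle_sum G (\<lambda>a b. if a = [] then g b else \<zero>) w = g w"
  using assms by (induction w arbitrary: g rule: list.induct) (simp_all add: deshuffle_sum_zero)

text \<open>Both sides sum \<open>C\<close> over all splittings of \<open>w\<close> into three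
  complementary subwords.\<close>

lemma (in abelian_monoid) deshuffle_sum_coassoc:
  assumes "w \<in> lists S"
    and "\<And>a b c. a \<in> lists S \<Longrightarrow> b \<in> lists S \<Longrightarrow> c \<in> lists S \<Longrightarrow> C a b c \<in> carrier G"
  shows "deshuffle_sum G (\<lambda>a b. deshuffle_sum G (\<lambda>a1 a2. C a1 a2 b) a) w =
    deshuffle_sum G (\<lambda>a b. deshuffle_sum G (\<lambda>b1 b2. C a b1 b2) b) w"
  using assms
proof (induction w arbitrary: C rule: list.induct)
  case (Cons y w)
  then have y: "y \<in> S" and w: "w \<in> lists S" by auto
  let ?D = "deshuffle_sum G"
  let ?c = "\<lambda>C w. ?D (\<lambda>a b. ?D (\<lambda>a1 a2. C a1 a2 b) a) w"
  let ?c' = "\<lambda>C w. ?D (\<lambda>a b. ?D (\<lambda>b1 b2. C a b1 b2) b) w"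
  \<comment> \<open>The first letter \<open>y\<close> goes to the first, second or third subword;
    the two sides only bracket these three contributions differently.\<close>
  let ?C1 = "\<lambda>a b c. C (y # a) b c" and ?C2 = "\<lambda>a b c. C a (y # b) c" and ?C3 = "\<lambda>a b c. C a b (y # c)"
  have cl: "?c C w \<in> carrier G" "?c' C w \<in> carrier G"
    if "\<And>a b c. a \<in> lists S \<Longrightarrow> b \<in> lists S \<Longrightarrow> c \<in> lists S \<Longrightarrow> C a b c \<in> carrier G" for C
    using w that by (auto intro!: deshuffle_sum_closed[where S = S])
  have c123: "?C1 a b c \<in> carrier G" "?C2 a b c \<in> carrier G" "?C3 a b c \<in> carrier G"
    if "a \<in> lists S" "b \<in> lists S" "c \<in> lists S" for a b c
    using Cons.prems(2) y that by auto
  have IH: "?c ?C1 w = ?c' ?C1 w" "?c ?C2 w = ?c' ?C2 w" "?c ?C3 w = ?c' ?C3 w"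
    by (rule Cons.IH[OF w c123(1)] Cons.IH[OF w c123(2)] Cons.IH[OF w c123(3)]; assumption)+
  have "?c C (y # w) = (?c ?C1 w \<oplus> ?c ?C2 w) \<oplus> ?c ?C3 w"
    using c123 w by (simp, subst deshuffle_sum_add[where S = S]) (auto intro!: deshuffle_sum_closed[where S = S])
  moreover have "?c' C (y # w) = ?c' ?C1 w \<oplus> (?c' ?C2 w \<oplus> ?c' ?C3 w)"
    using c123 w by (simp, subst deshuffle_sum_add[where S = S]) (auto intro!: deshuffle_sum_closed[where S = S])
  ultimately show ?case using IH cl[of ?C1, OF c123(1)] cl[of ?C2, OF c123(2)] cl[of ?C3, OF c123(3)]
    by (simp add: a_assoc)
qed simp

section \<open>Linearity of the sums over splittings and substitutions\<close>

context
  fixes K :: "('k, 'm) ring_scheme" and P :: "('k, 'c, 'r) module_scheme"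
    and Q :: "('k, 'd, 's) module_scheme"
  assumes P: "module K P" and Q: "module K Q"
begin

interpretation P: module K P by (rule P)
interpretation Q: module K Q by (rule Q)

lemma linear_maps_deshuffle_sum:
  assumes h: "h \<in> linear_maps K P Q" and "w \<in> lists S"
    and "\<And>a b. a \<in> lists S \<Longrightarrow> b \<in> lists S \<Longrightarrow> B a b \<in> carrier P"
  shows "h (deshuffle_sum P B w) = deshuffle_sum Q (\<lambda>a b. h (B a b)) w"
  using assms(2,3)
proof (induction w arbitrary: B rule: list.induct)
  case (Cons y w)
  then have cl: "deshuffle_sum P (\<lambda>a b. B (y # a) b) w \<in> carrier P"
    "deshuffle_sum P (\<lambda>a b. B a (y # b)) w \<in> carrier P"
    by (auto intro!: P.M.deshuffle_sum_closed[where S = S])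
  show ?case using Cons by (simp add: linear_maps_add[OF h] cl)
qed simp

lemma linear_maps_derivation_sum:
  assumes h: "h \<in> linear_maps K P Q" and "w \<in> lists S" and prd: "\<And>x. x \<in> S \<Longrightarrow> prd x y \<in> S"
    and "\<And>v. v \<in> lists S \<Longrightarrow> B v \<in> carrier P"
  shows "h (derivation_sum P prd B y w) = derivation_sum Q prd (\<lambda>v. h (B v)) y w"
  using assms(2,4)
proof (induction w arbitrary: B rule: list.induct)
  case Nil
  then show ?case using linear_maps_zero[OF P Q h] by simp
next
  case (Cons z w)
  then have cl: "derivation_sum P prd (\<lambda>v. B (z # v)) y w \<in> carrier P"
    "B (prd z y # w) \<in> carrier P"
    using prd by (auto intro!: P.M.derivation_sum_closed[where S = S])
  show ?case using Cons by (simp add: linear_maps_add[OF h] cl)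
qed

lemma deshuffle_sum_linear:
  assumes "w \<in> lists S"
    and "\<And>a b. a \<in> lists S \<Longrightarrow> b \<in> lists S \<Longrightarrow> (\<lambda>x. B x a b) \<in> linear_maps K Q P"
  shows "(\<lambda>x. deshuffle_sum P (B x) w) \<in> linear_maps K Q P"
  using assms by (induction w arbitrary: B rule: list.induct) (auto intro!: linear_maps_plus[OF Q P])

lemma derivation_sum_linear:
  assumes "w \<in> lists S" and prd: "\<And>x. x \<in> S \<Longrightarrow> prd x y \<in> S"
    and "\<And>v. v \<in> lists S \<Longrightarrow> (\<lambda>x. B x v) \<in> linear_maps K Q P"
  shows "(\<lambda>x. derivation_sum P prd (B x) y w) \<in> linear_maps K Q P"
  using assms(1,3)
proof (induction w arbitrary: B rule: list.induct)
  case Nil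
  then show ?case by (simp add: linear_maps_const_zero[OF Q P])
next
  case (Cons z w)
  have "(\<lambda>x. derivation_sum P prd (\<lambda>v. B x (z # v)) y w) \<in> linear_maps K Q P"
    by (rule Cons.IH) (use Cons.prems in simp_all)
  then show ?case
    using Cons.prems prd by (simp, intro linear_maps_plus[OF Q P]) simp_all
qed

end

context
  fixes K :: "('k, 'm) ring_scheme" and V :: "('k, 'v, 'p) module_scheme"
    and P :: "('k, 'c, 'r) module_scheme"
  assumes V: "module K V" and P: "module K P"
begin

interpretation V: module K V by (rule V)
interpretation P: module K P by (rule P)

text \<open>Each letter lies in exactly one of the two subwords, so every term of the sum is linear
  in it. The induction walks along the prefix \<open>u\<close> up to the varying letter.\<close>

lemma deshuffle_sum_multilinear:
  assumes "\<And>b. b \<in> lists (carrier V) \<Longrightarrow> multilinear K V P (\<lambda>a. B a b)"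
    and "\<And>a. a \<in> lists (carrier V) \<Longrightarrow> multilinear K V P (\<lambda>b. B a b)"
  shows "multilinear K V P (deshuffle_sum P B)"
proof (rule multilinearI)
  show "deshuffle_sum P B [] \<in> carrier P" using multilinear_closed[OF assms(1)] by simp
  fix u v assume u: "u \<in> lists (carrier V)" and v: "v \<in> lists (carrier V)"
  from u assms show "(\<lambda>x. deshuffle_sum P B (u @ x # v)) \<in> linear_maps K V P"
  proof (induction u arbitrary: B rule: list.induct)
    case Nil
    have "(\<lambda>x. B (x # a) b) \<in> linear_maps K V P" "(\<lambda>x. B a (x # b)) \<in> linear_maps K V P"
      if ab: "a \<in> lists (carrier V)" "b \<in> lists (carrier V)" for a b
      using multilinear_linear[OF Nil.prems(2)[OF ab(2)] _ ab(1), of "[]"]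
        multilinear_linear[OF Nil.prems(3)[OF ab(1)] _ ab(2), of "[]"] by simp_all
    then show ?case
      by (simp, intro linear_maps_plus[OF V P] deshuffle_sum_linear[OF P V v]) auto
  next
    case (Cons z u)
    then have "(\<lambda>x. deshuffle_sum P (\<lambda>a b. B (z # a) b) (u @ x # v)) \<in> linear_maps K V P"
      by (intro Cons.IH) (auto intro: multilinear_Cons)
    moreover have "(\<lambda>x. deshuffle_sum P (\<lambda>a b. B a (z # b)) (u @ x # v)) \<in> linear_maps K V P"
      using Cons by (intro Cons.IH) (auto intro: multilinear_Cons)
    ultimately show ?case by (simp, intro linear_maps_plus[OF V P])
  qed
qed

context
  fixes prd assumes prd: "prd \<in> bilinear_maps K V V V"
begin

text \<open>In each term the varying letter is either multiplied by \<open>y\<close>, which is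
  linear because \<open>prd\<close> is, or left untouched as an argument of
  \<open>B\<close>.\<close>

lemma derivation_sum_multilinear:
  assumes "multilinear K V P B" and y: "y \<in> carrier V"
  shows "multilinear K V P (derivation_sum P prd B y)"
proof (rule multilinearI)
  fix u v assume u: "u \<in> lists (carrier V)" and v: "v \<in> lists (carrier V)"
  note pl = bilinear_maps_left[OF prd y]
  have pc: "\<And>x. x \<in> carrier V \<Longrightarrow> prd x y \<in> carrier V" using bilinear_maps_closed[OF prd _ y] .
  from u assms(1) show "(\<lambda>x. derivation_sum P prd B y (u @ x # v)) \<in> linear_maps K V P"
  proof (induction u arbitrary: B rule: list.induct)
    case Nil
    have "(\<lambda>x. B (x # a)) \<in> linear_maps K V P" if "a \<in> lists (carrier V)" for a
      using multilinear_linear[OF Nil.prems(2) _ that, of "[]"] by simp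
    then show ?case
      using linear_maps_comp[OF _ pl, of "\<lambda>x. B (x # v)"] v
      by (simp, intro linear_maps_plus[OF V P] derivation_sum_linear[OF P V v]) (auto intro: pc)
  next
    case (Cons z u)
    then have "(\<lambda>x. derivation_sum P prd (\<lambda>v. B (z # v)) y (u @ x # v)) \<in> linear_maps K V P"
      by (intro Cons.IH) (auto intro: multilinear_Cons)
    moreover have "(\<lambda>x. B (prd z y # u @ x # v)) \<in> linear_maps K V P"
      using multilinear_linear[OF Cons.prems(2), of "prd z y # u" v] Cons.prems pc v by simp
    ultimately show ?case by (simp, intro linear_maps_plus[OF V P])
  qed
qed simp

text \<open>The letter \<open>y\<close> occurs exactly once in every term, as the right argument of
  \<open>prd\<close>.\<close>

lemma derivation_sum_linear_right:
  assumes "w \<in> lists (carrier V)" "multilinear K V P B"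
  shows "(\<lambda>y. derivation_sum P prd B y w) \<in> linear_maps K V P"
  using assms
proof (induction w arbitrary: B rule: list.induct)
  case Nil
  then show ?case by (simp add: linear_maps_const_zero[OF V P])
next
  case (Cons z w)
  have "(\<lambda>x. B (x # w)) \<in> linear_maps K V P"
    using multilinear_linear[OF Cons.prems(2), of "[]" w] Cons.prems by simp
  from linear_maps_comp[OF this bilinear_maps_right[OF prd]] show ?case
    using Cons by (simp, intro linear_maps_plus[OF V P]) (auto intro: multilinear_Cons)
qed

end

end

section \<open>Products of a letter with a word\<close>

text \<open>The product of a letter with a word of length \<open>n\<close>, extended by \<open>0\<close> to words of other lengths
  so that it is multilinear on all words.\<close>

primrec letter_star_aux ::
    "('k, 'v, 'p) module_scheme \<Rightarrow> ('v \<Rightarrow> 'v \<Rightarrow> 'v) \<Rightarrow> nat \<Rightarrow> 'v \<Rightarrow> 'v list \<Rightarrow> 'v"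
  where
    "letter_star_aux V prd 0 x w = (if w = [] then x else \<zero>\<^bsub>V\<^esub>)"
  | "letter_star_aux V prd (Suc n) x w = (if w = [] then \<zero>\<^bsub>V\<^esub> else
      prd (letter_star_aux V prd n x (butlast w)) (last w) \<ominus>\<^bsub>V\<^esub>
      derivation_sum V prd (letter_star_aux V prd n x) (last w) (butlast w))"

text \<open>The index has to be carried separately, because the derivation term is evaluated at
  words of the previous length that need not be parts of \<open>w\<close>; setting it to the length
  of \<open>w\<close> gives the actual product.\<close>

definition letter_star ::
    "('k, 'v, 'p) module_scheme \<Rightarrow> ('v \<Rightarrow> 'v \<Rightarrow> 'v) \<Rightarrow> 'v \<Rightarrow> 'v list \<Rightarrow> 'v"
  where "letter_star V prd x w = letter_star_aux V prd (length w) x w"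

context
  fixes K :: "('k, 'm) ring_scheme" and V :: "('k, 'v, 'p) module_scheme" and prd
  assumes V: "module K V" and prd: "prd \<in> bilinear_maps K V V V"
begin

interpretation V: module K V by (rule V)

lemma letter_star_aux_multilinear:
  assumes x: "x \<in> carrier V"
  shows "multilinear K V V (letter_star_aux V prd n x)"
proof (induction n)
  case 0
  then show ?case using x by (auto intro!: multilinearI linear_maps_const_zero[OF V V])
next
  case (Suc n)
  show ?case
  proof (rule multilinearI)
    fix u v assume u: "u \<in> lists (carrier V)" and v: "v \<in> lists (carrier V)"
    show "(\<lambda>y. letter_star_aux V prd (Suc n) x (u @ y # v)) \<in> linear_maps K V V"
    \<comment> \<open>The varying letter is either the last one, which acts as the multiplier, or
      belongs to the part that is acted on. Linearity has a different source in the two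
      roles.\<close>
    proof (cases v rule: rev_cases)
      case Nil
      show ?thesis unfolding Nil
        using u multilinear_closed[OF Suc u]
        by (simp, intro linear_maps_diff[OF V V] bilinear_maps_right[OF prd]
            derivation_sum_linear_right[OF V V prd _ Suc]) auto
    next
      case (snoc v' z)
      have v': "v' \<in> lists (carrier V)" "z \<in> carrier V" using v snoc by auto
      have "(\<lambda>y. prd (letter_star_aux V prd n x (u @ y # v')) z) \<in> linear_maps K V V"
        by (rule linear_maps_comp[OF bilinear_maps_left[OF prd v'(2)] multilinear_linear[OF Suc u v'(1)]])
      moreover have "(\<lambda>y. derivation_sum V prd (letter_star_aux V prd n x) z (u @ y # v'))
          \<in> linear_maps K V V"
        by (rule multilinear_linear[OF derivation_sum_multilinear[OF V V prd Suc v'(2)] u v'(1)])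
      ultimately show ?thesis unfolding snoc
        using linear_maps_diff[OF V V] by (simp add: butlast_append)
    qed
  qed simp
qed

lemma letter_star_aux_linear:
  assumes "w \<in> lists (carrier V)"
  shows "(\<lambda>x. letter_star_aux V prd n x w) \<in> linear_maps K V V"
  using assms
proof (induction n arbitrary: w)
  case 0
  then show ?case by (cases "w = []") (simp_all add: linear_maps_const_zero[OF V V] linear_maps_id)
next
  case (Suc n)
  show ?case
  proof (cases w rule: rev_cases)
    case Nil
    then show ?thesis by (simp add: linear_maps_const_zero[OF V V])
  next
    case (snoc v z)
    have v: "v \<in> lists (carrier V)" "z \<in> carrier V" using Suc.prems snoc by auto
    have "(\<lambda>x. prd (letter_star_aux V prd n x v) z) \<in> linear_maps K V V"
      by (rule linear_maps_comp[OF bilinear_maps_left[OF prd v(2)] Suc.IH[OF v(1)]])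
    moreover have "(\<lambda>x. derivation_sum V prd (letter_star_aux V prd n x) z v) \<in> linear_maps K V V"
      by (rule derivation_sum_linear[OF V V v(1)]) (auto intro: bilinear_maps_closed[OF prd _ v(2)] Suc.IH)
    ultimately show ?thesis unfolding snoc
      using linear_maps_diff[OF V V] by simp
  qed
qed

lemma letter_star_multilinear:
  assumes x: "x \<in> carrier V"
  shows "multilinear K V V (letter_star V prd x)"
proof (rule multilinearI)
  show "letter_star V prd x [] \<in> carrier V" using x by (simp add: letter_star_def)
  fix u v assume uv: "u \<in> lists (carrier V)" "v \<in> lists (carrier V)"
  show "(\<lambda>y. letter_star V prd x (u @ y # v)) \<in> linear_maps K V V"
    \<comment> \<open>Changing the letter \<open>y\<close> keeps the length of the word, so a single
      index serves for all \<open>y\<close>.\<close>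
    using multilinear_linear[OF letter_star_aux_multilinear[OF x, of "length u + Suc (length v)"] uv]
    by (simp add: letter_star_def)
qed

lemma letter_star_linear:
  "w \<in> lists (carrier V) \<Longrightarrow> (\<lambda>x. letter_star V prd x w) \<in> linear_maps K V V"
  unfolding letter_star_def by (rule letter_star_aux_linear)

lemma letter_star_closed:
  "x \<in> carrier V \<Longrightarrow> w \<in> lists (carrier V) \<Longrightarrow> letter_star V prd x w \<in> carrier V"
  by (rule multilinear_closed[OF letter_star_multilinear])

text \<open>This is condition 3 for a word \<open>w\<close>, read inside V: the derivation sum
  stands for \<open>x * (w * y)\<close>.\<close>

lemma letter_star_snoc:
  assumes "w \<in> lists (carrier V)" "y \<in> carrier V"
  shows "letter_star V prd x (w @ [y]) =
    prd (letter_star V prd x w) y \<ominus>\<^bsub>V\<^esub> derivation_sum V prd (letter_star V prd x) y w"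
proof -
  have "derivation_sum V prd (letter_star_aux V prd (length w) x) y w =
      derivation_sum V prd (letter_star V prd x) y w"
    by (rule derivation_sum_cong[OF assms(1)])
       (auto simp: letter_star_def intro: bilinear_maps_closed[OF prd _ assms(2)])
  then show ?thesis by (simp add: letter_star_def)
qed

end

lemma letter_star_Nil: "letter_star V prd x [] = x"
  by (simp add: letter_star_def)

section \<open>Universal properties of the tensor algebra and the tensor product\<close>

definition word_Radd :: "('k, 'v, 'p) module_scheme \<Rightarrow> 'v list \<Rightarrow> 'v list \<Rightarrow> 'v list \<Rightarrow> bool"
  where "word_Radd V a b c \<longleftrightarrow> (\<exists>u w x y. a = u @ [x \<oplus>\<^bsub>V\<^esub> y] @ w \<and> b = u @ [x] @ w \<and> c = u @ [y] @ w \<and>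
    u \<in> lists (carrier V) \<and> w \<in> lists (carrier V) \<and> x \<in> carrier V \<and> y \<in> carrier V)"

definition word_Rsmult ::
    "('k, 'm) ring_scheme \<Rightarrow> ('k, 'v, 'p) module_scheme \<Rightarrow> 'k \<Rightarrow> 'v list \<Rightarrow> 'v list \<Rightarrow> bool"
  where "word_Rsmult K V c a b \<longleftrightarrow> (\<exists>u w x. a = u @ [c \<odot>\<^bsub>V\<^esub> x] @ w \<and> b = u @ [x] @ w \<and>
    u \<in> lists (carrier V) \<and> w \<in> lists (carrier V) \<and> c \<in> carrier K \<and> x \<in> carrier V)"

lemma word_monoid_simps:
  "carrier (word_monoid V) = lists (carrier V)" "u \<otimes>\<^bsub>word_monoid V\<^esub> w = u @ w"
  "\<one>\<^bsub>word_monoid V\<^esub> = []"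
  by (simp_all add: word_monoid_def)

lemma monoid_word_monoid: "monoid (word_monoid V)"
  by (rule monoidI) (auto simp: word_monoid_simps)

text \<open>Concatenation with \<open>m\<close> only enlarges the words \<open>u\<close> and
  \<open>w\<close> around the letter in which a relation takes place.\<close>

lemma presented_algebra_words:
  assumes "module K V"
  shows "presented_algebra K (word_monoid V) (word_Radd V) (word_Rsmult K V)"
proof -
  interpret module K V by fact
  show ?thesis
  proof (intro presented_algebra.intro monoid_ring.intro presented_algebra_axioms.intro)
    show "cring K" by (rule R.is_cring)
    show "monoid (word_monoid V)" by (rule monoid_word_monoid)
  next
    fix a b c m assume R: "word_Radd V a b c" and "m \<in> carrier (word_monoid V)"
    then have m: "m \<in> lists (carrier V)" by (simp add: word_monoid_simps)
    from R obtain u w x y where *: "a = u @ [x \<oplus>\<^bsub>V\<^esub> y] @ w" "b = u @ [x] @ w" "c = u @ [y] @ w"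
      "u \<in> lists (carrier V)" "w \<in> lists (carrier V)" "x \<in> carrier V" "y \<in> carrier V"
      by (auto simp: word_Radd_def)
    have "word_Radd V (m @ a) (m @ b) (m @ c)" unfolding word_Radd_def
      by (rule exI[of _ "m @ u"]) (use * m in auto)
    moreover have "word_Radd V (a @ m) (b @ m) (c @ m)" unfolding word_Radd_def
      by (rule exI[of _ u], rule exI[of _ "w @ m"]) (use * m in auto)
    ultimately show "word_Radd V (m \<otimes>\<^bsub>word_monoid V\<^esub> a) (m \<otimes>\<^bsub>word_monoid V\<^esub> b) (m \<otimes>\<^bsub>word_monoid V\<^esub> c) \<and>
        word_Radd V (a \<otimes>\<^bsub>word_monoid V\<^esub> m) (b \<otimes>\<^bsub>word_monoid V\<^esub> m) (c \<otimes>\<^bsub>word_monoid V\<^esub> m)"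
      by (simp add: word_monoid_simps)
  next
    fix k a b m assume R: "word_Rsmult K V k a b" and "m \<in> carrier (word_monoid V)"
    then have m: "m \<in> lists (carrier V)" by (simp add: word_monoid_simps)
    from R obtain u w x where *: "a = u @ [k \<odot>\<^bsub>V\<^esub> x] @ w" "b = u @ [x] @ w"
      "u \<in> lists (carrier V)" "w \<in> lists (carrier V)" "x \<in> carrier V" "k \<in> carrier K"
      by (auto simp: word_Rsmult_def)
    have "word_Rsmult K V k (m @ a) (m @ b)" unfolding word_Rsmult_def
      by (rule exI[of _ "m @ u"]) (use * m in auto)
    moreover have "word_Rsmult K V k (a @ m) (b @ m)" unfolding word_Rsmult_def
      by (rule exI[of _ u], rule exI[of _ "w @ m"]) (use * m in auto)
    ultimately show "word_Rsmult K V k (m \<otimes>\<^bsub>word_monoid V\<^esub> a) (m \<otimes>\<^bsub>word_monoid V\<^esub> b) \<and>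
        word_Rsmult K V k (a \<otimes>\<^bsub>word_monoid V\<^esub> m) (b \<otimes>\<^bsub>word_monoid V\<^esub> m)"
      by (simp add: word_monoid_simps)
  qed (auto simp: word_Radd_def word_Rsmult_def word_monoid_simps)
qed

text \<open>This is the universal property of T(V) as an operator. A choice is good enough, since a
  linear map on T(V) is determined on the carrier by its values on words.\<close>

definition word_lift ::
    "('k, 'm) ring_scheme \<Rightarrow> ('k, 'v, 'p) module_scheme \<Rightarrow> ('k, 'c, 'r) module_scheme \<Rightarrow>
      ('v list \<Rightarrow> 'c) \<Rightarrow> ('v list \<Rightarrow> 'k) set \<Rightarrow> 'c"
  where "word_lift K V P \<phi> = (SOME h. h \<in> linear_maps K (tensor_algebra K V) P \<and>
    (\<forall>w\<in>lists (carrier V). h (word_tensor K V w) = \<phi> w))"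

context
  fixes K :: "('k, 'm) ring_scheme" and V :: "('k, 'v, 'p) module_scheme"
  assumes V: "module K V"
begin

interpretation V: module K V by (rule V)

interpretation W: presented_algebra K "word_monoid V" "word_Radd V" "word_Rsmult K V"
  by (rule presented_algebra_words[OF V])

private lemma W_N: "W.N = multilinear_null K V"
proof -
  have "W.rels = multilinear_relations K V"
    unfolding W.rels_def multilinear_relations_def word_Radd_def word_Rsmult_def Let_def
    by (intro arg_cong2[where f = "(\<union>)"] Collect_cong) blast+
  then show ?thesis by (simp add: W.N_def multilinear_null_def)
qed

private lemma W_A: "W.A = tensor_algebra K V"
  by (simp add: W.A_def tensor_algebra_def W_N)

private lemma W_cls: "W.cls = word_tensor K V"
  by (simp add: fun_eq_iff W.cls_def word_tensor_def W_N)

lemma assoc_algebra_tensor_algebra: "assoc_algebra K (tensor_algebra K V)"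
  using W.assoc_algebra_A by (simp add: W_A)

lemma module_tensor_algebra: "module K (tensor_algebra K V)"
  using assoc_algebra_tensor_algebra by (rule assoc_algebra.axioms)

lemma word_tensor_closed: "w \<in> lists (carrier V) \<Longrightarrow> word_tensor K V w \<in> carrier (tensor_algebra K V)"
  using W.cls_closed by (simp add: W_A W_cls word_monoid_simps)

lemma word_tensor_append:
  "u \<in> lists (carrier V) \<Longrightarrow> w \<in> lists (carrier V) \<Longrightarrow>
    word_tensor K V u \<otimes>\<^bsub>tensor_algebra K V\<^esub> word_tensor K V w = word_tensor K V (u @ w)"
  using W.cls_mult by (simp add: W_A W_cls word_monoid_simps)

lemma word_tensor_Nil: "word_tensor K V [] = \<one>\<^bsub>tensor_algebra K V\<^esub>"
  using W.cls_one by (simp add: W_A W_cls word_monoid_simps)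

lemma word_tensor_Cons:
  "x \<in> carrier V \<Longrightarrow> w \<in> lists (carrier V) \<Longrightarrow>
    word_tensor K V (x # w) = letter K V x \<otimes>\<^bsub>tensor_algebra K V\<^esub> word_tensor K V w"
  by (simp add: letter_def word_tensor_append)

lemma word_tensor_snoc:
  "x \<in> carrier V \<Longrightarrow> w \<in> lists (carrier V) \<Longrightarrow>
    word_tensor K V (w @ [x]) = word_tensor K V w \<otimes>\<^bsub>tensor_algebra K V\<^esub> letter K V x"
  by (simp add: letter_def word_tensor_append)

lemma multilinear_word_tensor: "multilinear K V (tensor_algebra K V) (word_tensor K V)"
proof (rule multilinearI)
  fix u w assume uw: "u \<in> lists (carrier V)" "w \<in> lists (carrier V)"
  show "(\<lambda>x. word_tensor K V (u @ x # w)) \<in> linear_maps K V (tensor_algebra K V)"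
  proof (rule linear_mapsI)
    fix x y assume xy: "x \<in> carrier V" "y \<in> carrier V"
    have "word_Radd V (u @ (x \<oplus>\<^bsub>V\<^esub> y) # w) (u @ x # w) (u @ y # w)"
      unfolding word_Radd_def using uw xy by fastforce
    then show "word_tensor K V (u @ (x \<oplus>\<^bsub>V\<^esub> y) # w) =
        word_tensor K V (u @ x # w) \<oplus>\<^bsub>tensor_algebra K V\<^esub> word_tensor K V (u @ y # w)"
      using W.cls_Radd by (simp add: W_A W_cls)
  next
    fix c x assume xy: "c \<in> carrier K" "x \<in> carrier V"
    have "word_Rsmult K V c (u @ (c \<odot>\<^bsub>V\<^esub> x) # w) (u @ x # w)"
      unfolding word_Rsmult_def using uw xy by fastforce
    then show "word_tensor K V (u @ (c \<odot>\<^bsub>V\<^esub> x) # w) =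
        c \<odot>\<^bsub>tensor_algebra K V\<^esub> word_tensor K V (u @ x # w)"
      using W.cls_Rsmult by (simp add: W_A W_cls)
  qed (use uw word_tensor_closed in auto)
qed (simp add: word_tensor_closed)

lemma linear_letter: "letter K V \<in> linear_maps K V (tensor_algebra K V)"
  using multilinear_linear[OF multilinear_word_tensor, of "[]" "[]"] unfolding letter_def[abs_def] by simp

lemma letter_closed: "x \<in> carrier V \<Longrightarrow> letter K V x \<in> carrier (tensor_algebra K V)"
  by (rule linear_maps_closed[OF linear_letter])

lemma tensor_algebra_linear_eqI:
  assumes "module K P" "g \<in> linear_maps K (tensor_algebra K V) P"
    "h \<in> linear_maps K (tensor_algebra K V) P"
    and "\<And>w. w \<in> lists (carrier V) \<Longrightarrow> g (word_tensor K V w) = h (word_tensor K V w)"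
    and "x \<in> carrier (tensor_algebra K V)"
  shows "g x = h x"
  using W.A_linear_eqI[of P g h x] assms by (simp add: W_A W_cls word_monoid_simps)

lemma word_lift_props:
  assumes P: "module K P" and \<phi>: "multilinear K V P \<phi>"
  shows "word_lift K V P \<phi> \<in> linear_maps K (tensor_algebra K V) P \<and>
    (\<forall>w\<in>lists (carrier V). word_lift K V P \<phi> (word_tensor K V w) = \<phi> w)"
proof -
  have cl: "\<phi> z \<in> carrier P" if "z \<in> carrier (word_monoid V)" for z
    using multilinear_closed[OF \<phi>] that by (simp add: word_monoid_simps)
  have add: "\<phi> a = \<phi> b \<oplus>\<^bsub>P\<^esub> \<phi> c" if "word_Radd V a b c" for a b c
    using that unfolding word_Radd_def
    by (elim exE conjE) (simp add: linear_maps_add[OF multilinear_linear[OF \<phi>]])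
  have smult: "\<phi> a = k \<odot>\<^bsub>P\<^esub> \<phi> b" if "word_Rsmult K V k a b" for k a b
    using that unfolding word_Rsmult_def
    by (elim exE conjE) (simp add: linear_maps_smult[OF multilinear_linear[OF \<phi>]])
  have "W.lift P \<phi> \<in> linear_maps K (tensor_algebra K V) P"
    using W.lift_linear[of P \<phi>, OF P cl add smult] by (simp add: W_A)
  moreover have "\<forall>w\<in>lists (carrier V). W.lift P \<phi> (word_tensor K V w) = \<phi> w"
    using W.lift_cls[of P \<phi>, OF P cl add smult] by (simp add: W_cls word_monoid_simps)
  ultimately have "\<exists>h. h \<in> linear_maps K (tensor_algebra K V) P \<and>
      (\<forall>w\<in>lists (carrier V). h (word_tensor K V w) = \<phi> w)" by blast
  from someI_ex[OF this] show ?thesis unfolding word_lift_def .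
qed

lemmas word_lift_linear = word_lift_props[THEN conjunct1]
  and word_lift_word = word_lift_props[THEN conjunct2, rule_format]

text \<open>One argument is lifted at a time: first the right word with \<open>u\<close> fixed, then
  the left word with an arbitrary element of T(V) on the right.\<close>

lemma bilinear_word_lift:
  assumes P: "module K P"
    and l: "\<And>w. w \<in> lists (carrier V) \<Longrightarrow> multilinear K V P (\<lambda>u. B u w)"
    and r: "\<And>u. u \<in> lists (carrier V) \<Longrightarrow> multilinear K V P (\<lambda>w. B u w)"
  obtains \<beta> where "\<beta> \<in> bilinear_maps K (tensor_algebra K V) (tensor_algebra K V) P"
    "\<And>u w. u \<in> lists (carrier V) \<Longrightarrow> w \<in> lists (carrier V) \<Longrightarrow>
      \<beta> (word_tensor K V u) (word_tensor K V w) = B u w"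
proof
  let ?T = "tensor_algebra K V" and ?S = "lists (carrier V)" and ?w = "word_tensor K V"
  interpret T: module K ?T by (rule module_tensor_algebra)
  interpret P: module K P by (rule P)
  note T = module_tensor_algebra
  define L where "L u = word_lift K V P (B u)" for u
  define \<beta> where "\<beta> f h = word_lift K V P (\<lambda>u. L u h) f" for f h
  have L: "L u \<in> linear_maps K ?T P" and Lw: "\<And>w. w \<in> ?S \<Longrightarrow> L u (?w w) = B u w" if "u \<in> ?S" for u
    unfolding L_def using word_lift_linear[OF P r[OF that]] word_lift_word[OF P r[OF that]] by auto
  \<comment> \<open>The hypothesis \<open>l\<close> gives linearity in the letters of
    \<open>u\<close> only against words on the right. Both sides of each identity are linear in
    \<open>h\<close>, so it extends from words to all \<open>h\<close>.\<close>
  have LL: "multilinear K V P (\<lambda>u. L u h)" if h: "h \<in> carrier ?T" for h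
  proof (rule multilinearI)
    show "L [] h \<in> carrier P" by (rule linear_maps_closed[OF L h]) simp
    fix u v assume uv: "u \<in> ?S" "v \<in> ?S"
    have c: "u @ x # v \<in> ?S" if "x \<in> carrier V" for x using uv that by simp
    have lin: "(\<lambda>x. B (u @ x # v) w) \<in> linear_maps K V P" if "w \<in> ?S" for w
      by (rule multilinear_linear[OF l[OF that] uv])
    show "(\<lambda>x. L (u @ x # v) h) \<in> linear_maps K V P"
    proof (rule linear_mapsI)
      fix x y assume x: "x \<in> carrier V" and y: "y \<in> carrier V"
      show "L (u @ (x \<oplus>\<^bsub>V\<^esub> y) # v) h = L (u @ x # v) h \<oplus>\<^bsub>P\<^esub> L (u @ y # v) h"
        by (rule tensor_algebra_linear_eqI[OF P _ _ _ h])
           (use x y c in \<open>simp_all add: L linear_maps_plus[OF T P] Lw linear_maps_add[OF lin]\<close>)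
    next
      fix k x assume k: "k \<in> carrier K" and x: "x \<in> carrier V"
      show "L (u @ (k \<odot>\<^bsub>V\<^esub> x) # v) h = k \<odot>\<^bsub>P\<^esub> L (u @ x # v) h"
        by (rule tensor_algebra_linear_eqI[OF P _ _ _ h])
           (use x k c in \<open>simp_all add: L linear_maps_scale[OF T P] Lw linear_maps_smult[OF lin]\<close>)
    qed (use c linear_maps_closed[OF L h] in blast)
  qed
  have b1: "(\<lambda>f. \<beta> f h) \<in> linear_maps K ?T P" and bw: "\<And>u. u \<in> ?S \<Longrightarrow> \<beta> (?w u) h = L u h"
    if "h \<in> carrier ?T" for h
    unfolding \<beta>_def using word_lift_linear[OF P LL[OF that]] word_lift_word[OF P LL[OF that]] by auto
  \<comment> \<open>The outer lift is chosen separately for every \<open>h\<close>, so linearity in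
    \<open>h\<close> is not built in; it holds when \<open>f\<close> is a word and extends by
    linearity in \<open>f\<close>.\<close>
  have b2: "(\<lambda>h. \<beta> f h) \<in> linear_maps K ?T P" if f: "f \<in> carrier ?T" for f
  proof (rule linear_mapsI)
    fix x y assume x: "x \<in> carrier ?T" and y: "y \<in> carrier ?T"
    show "\<beta> f (x \<oplus>\<^bsub>?T\<^esub> y) = \<beta> f x \<oplus>\<^bsub>P\<^esub> \<beta> f y"
      by (rule tensor_algebra_linear_eqI[OF P _ _ _ f])
         (use x y in \<open>simp_all add: b1 linear_maps_plus[OF T P] bw linear_maps_add[OF L]\<close>)
  next
    fix k x assume k: "k \<in> carrier K" and x: "x \<in> carrier ?T"
    show "\<beta> f (k \<odot>\<^bsub>?T\<^esub> x) = k \<odot>\<^bsub>P\<^esub> \<beta> f x"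
      by (rule tensor_algebra_linear_eqI[OF P _ _ _ f])
         (use x k in \<open>simp_all add: b1 linear_maps_scale[OF T P] bw linear_maps_smult[OF L]\<close>)
  qed (use f linear_maps_closed[OF b1] in blast)
  show "\<beta> \<in> bilinear_maps K ?T ?T P"
    unfolding bilinear_maps_def using b1 b2 by blast
  show "\<beta> (?w u) (?w w) = B u w" if "u \<in> ?S" "w \<in> ?S" for u w
    using bw Lw that word_tensor_closed by simp
qed

end

section \<open>The tensor product of two algebras\<close>

definition tensor_Radd ::
    "('k, 'a, 'p) module_scheme \<Rightarrow> ('k, 'b, 'q) module_scheme \<Rightarrow> 'a \<times> 'b \<Rightarrow> 'a \<times> 'b \<Rightarrow> 'a \<times> 'b \<Rightarrow> bool"
  where "tensor_Radd A B p q r \<longleftrightarrow>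
    (\<exists>a a' b. p = (a \<oplus>\<^bsub>A\<^esub> a', b) \<and> q = (a, b) \<and> r = (a', b) \<and>
      a \<in> carrier A \<and> a' \<in> carrier A \<and> b \<in> carrier B) \<or>
    (\<exists>a b b'. p = (a, b \<oplus>\<^bsub>B\<^esub> b') \<and> q = (a, b) \<and> r = (a, b') \<and>
      a \<in> carrier A \<and> b \<in> carrier B \<and> b' \<in> carrier B)"

definition tensor_Rsmult ::
    "('k, 'm) ring_scheme \<Rightarrow> ('k, 'a, 'p) module_scheme \<Rightarrow> ('k, 'b, 'q) module_scheme \<Rightarrow>
      'k \<Rightarrow> 'a \<times> 'b \<Rightarrow> 'a \<times> 'b \<Rightarrow> bool"
  where "tensor_Rsmult K A B c p q \<longleftrightarrow>
    (\<exists>a b. p = (c \<odot>\<^bsub>A\<^esub> a, b) \<and> q = (a, b) \<and> c \<in> carrier K \<and> a \<in> carrier A \<and> b \<in> carrier B) \<or>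
    (\<exists>a b. p = (a, c \<odot>\<^bsub>B\<^esub> b) \<and> q = (a, b) \<and> c \<in> carrier K \<and> a \<in> carrier A \<and> b \<in> carrier B)"

text \<open>Stability under multiplication by a pair \<open>(m1, m2)\<close> is distributivity, or
  compatibility with scalars, in the factor where the relation takes place.\<close>

lemma presented_algebra_tensor:
  assumes "assoc_algebra K A" "assoc_algebra K B"
  shows "presented_algebra K (A \<times>\<times> B) (tensor_Radd A B) (tensor_Rsmult K A B)"
proof -
  interpret A: assoc_algebra K A by fact
  interpret B: assoc_algebra K B by fact
  show ?thesis
  proof (intro presented_algebra.intro monoid_ring.intro presented_algebra_axioms.intro)
    show "cring K" by (rule A.R.is_cring)
    show "monoid (A \<times>\<times> B)" by (rule DirProd_monoid[OF A.A.monoid_axioms B.A.monoid_axioms])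
  next
    fix p q r m assume R: "tensor_Radd A B p q r" and "m \<in> carrier (A \<times>\<times> B)"
    then obtain m1 m2 where m: "m = (m1, m2)" "m1 \<in> carrier A" "m2 \<in> carrier B" by auto
    from R show "tensor_Radd A B (m \<otimes>\<^bsub>A \<times>\<times> B\<^esub> p) (m \<otimes>\<^bsub>A \<times>\<times> B\<^esub> q) (m \<otimes>\<^bsub>A \<times>\<times> B\<^esub> r) \<and>
        tensor_Radd A B (p \<otimes>\<^bsub>A \<times>\<times> B\<^esub> m) (q \<otimes>\<^bsub>A \<times>\<times> B\<^esub> m) (r \<otimes>\<^bsub>A \<times>\<times> B\<^esub> m)"
      unfolding tensor_Radd_def
    proof (elim disjE exE conjE, goal_cases)
      case (1 a a' b)
      then show ?case using m
        by (intro conjI disjI1, intro exI[of _ "m1 \<otimes>\<^bsub>A\<^esub> a"] exI[of _ "m1 \<otimes>\<^bsub>A\<^esub> a'"] exI[of _ "m2 \<otimes>\<^bsub>B\<^esub> b"])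
           (simp add: A.A.r_distr, intro exI[of _ "a \<otimes>\<^bsub>A\<^esub> m1"] exI[of _ "a' \<otimes>\<^bsub>A\<^esub> m1"] exI[of _ "b \<otimes>\<^bsub>B\<^esub> m2"],
            simp add: A.A.l_distr)
    next
      case (2 a b b')
      then show ?case using m
        by (intro conjI disjI2, intro exI[of _ "m1 \<otimes>\<^bsub>A\<^esub> a"] exI[of _ "m2 \<otimes>\<^bsub>B\<^esub> b"] exI[of _ "m2 \<otimes>\<^bsub>B\<^esub> b'"])
           (simp add: B.A.r_distr, intro exI[of _ "a \<otimes>\<^bsub>A\<^esub> m1"] exI[of _ "b \<otimes>\<^bsub>B\<^esub> m2"] exI[of _ "b' \<otimes>\<^bsub>B\<^esub> m2"],
            simp add: B.A.l_distr)
    qed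
  next
    fix k p q m assume R: "tensor_Rsmult K A B k p q" and "m \<in> carrier (A \<times>\<times> B)"
    then obtain m1 m2 where m: "m = (m1, m2)" "m1 \<in> carrier A" "m2 \<in> carrier B" by auto
    from R show "tensor_Rsmult K A B k (m \<otimes>\<^bsub>A \<times>\<times> B\<^esub> p) (m \<otimes>\<^bsub>A \<times>\<times> B\<^esub> q) \<and>
        tensor_Rsmult K A B k (p \<otimes>\<^bsub>A \<times>\<times> B\<^esub> m) (q \<otimes>\<^bsub>A \<times>\<times> B\<^esub> m)"
      unfolding tensor_Rsmult_def
    proof (elim disjE exE conjE, goal_cases)
      case (1 a b)
      then show ?case using m
        by (intro conjI disjI1) (auto simp: A.smult_mult_left A.smult_mult_right)
    next
      case (2 a b)
      then show ?case using m
        by (intro conjI disjI2) (auto simp: B.smult_mult_left B.smult_mult_right)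
    qed
  qed (auto simp: tensor_Radd_def tensor_Rsmult_def)
qed

context
  fixes K :: "('k, 'm) ring_scheme" and A :: "('k, 'a, 'p) module_scheme"
    and B :: "('k, 'b, 'q) module_scheme"
  assumes A: "assoc_algebra K A" and B: "assoc_algebra K B"
begin

interpretation A: assoc_algebra K A by (rule A)
interpretation B: assoc_algebra K B by (rule B)

interpretation Z: presented_algebra K "A \<times>\<times> B" "tensor_Radd A B" "tensor_Rsmult K A B"
  by (rule presented_algebra_tensor[OF A B])

private lemma Z_N: "Z.N = tensor_prod_null K A B"
proof -
  have "Z.rels = tensor_prod_relations K A B"
  proof
    show "Z.rels \<subseteq> tensor_prod_relations K A B"
      unfolding Z.rels_def tensor_prod_relations_def tensor_Radd_def tensor_Rsmult_def Let_def by blast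
    show "tensor_prod_relations K A B \<subseteq> Z.rels"
      unfolding Z.rels_def tensor_prod_relations_def tensor_Radd_def tensor_Rsmult_def Let_def by blast
  qed
  then show ?thesis by (simp add: Z.N_def tensor_prod_null_def)
qed

private lemma Z_A: "Z.A = tensor_prod K A B"
  by (simp add: Z.A_def tensor_prod_def Z_N)

private lemma Z_cls: "Z.cls (a, b) = pure_tensor K A B a b"
  by (simp add: Z.cls_def pure_tensor_def Z_N)

lemma assoc_algebra_tensor_prod: "assoc_algebra K (tensor_prod K A B)"
  using Z.assoc_algebra_A by (simp add: Z_A)

lemma module_tensor_prod: "module K (tensor_prod K A B)"
  using assoc_algebra_tensor_prod by (rule assoc_algebra.axioms)

lemma pure_tensor_bilinear: "pure_tensor K A B \<in> bilinear_maps K A B (tensor_prod K A B)"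
proof -
  have cl: "pure_tensor K A B a b \<in> carrier (tensor_prod K A B)"
    if "a \<in> carrier A" "b \<in> carrier B" for a b
    using Z.cls_closed[of "(a, b)"] that by (simp add: Z_A Z_cls)
  have "pure_tensor K A B (a \<oplus>\<^bsub>A\<^esub> a') b =
      pure_tensor K A B a b \<oplus>\<^bsub>tensor_prod K A B\<^esub> pure_tensor K A B a' b"
    if "a \<in> carrier A" "a' \<in> carrier A" "b \<in> carrier B" for a a' b
    using Z.cls_Radd[of "(a \<oplus>\<^bsub>A\<^esub> a', b)" "(a, b)" "(a', b)"] that
    by (auto simp: Z_A Z_cls tensor_Radd_def)
  moreover have "pure_tensor K A B a (b \<oplus>\<^bsub>B\<^esub> b') =
      pure_tensor K A B a b \<oplus>\<^bsub>tensor_prod K A B\<^esub> pure_tensor K A B a b'"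
    if "a \<in> carrier A" "b \<in> carrier B" "b' \<in> carrier B" for a b b'
    using Z.cls_Radd[of "(a, b \<oplus>\<^bsub>B\<^esub> b')" "(a, b)" "(a, b')"] that
    by (auto simp: Z_A Z_cls tensor_Radd_def)
  moreover have "pure_tensor K A B (c \<odot>\<^bsub>A\<^esub> a) b = c \<odot>\<^bsub>tensor_prod K A B\<^esub> pure_tensor K A B a b"
    if "a \<in> carrier A" "c \<in> carrier K" "b \<in> carrier B" for a b c
    using Z.cls_Rsmult[of c "(c \<odot>\<^bsub>A\<^esub> a, b)" "(a, b)"] that
    by (auto simp: Z_A Z_cls tensor_Rsmult_def)
  moreover have "pure_tensor K A B a (c \<odot>\<^bsub>B\<^esub> b) = c \<odot>\<^bsub>tensor_prod K A B\<^esub> pure_tensor K A B a b"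
    if "a \<in> carrier A" "c \<in> carrier K" "b \<in> carrier B" for a b c
    using Z.cls_Rsmult[of c "(a, c \<odot>\<^bsub>B\<^esub> b)" "(a, b)"] that
    by (auto simp: Z_A Z_cls tensor_Rsmult_def)
  ultimately show ?thesis
    unfolding bilinear_maps_def using cl by (auto intro!: linear_mapsI)
qed

lemma pure_tensor_mult:
  "a \<in> carrier A \<Longrightarrow> a' \<in> carrier A \<Longrightarrow> b \<in> carrier B \<Longrightarrow> b' \<in> carrier B \<Longrightarrow>
    pure_tensor K A B a b \<otimes>\<^bsub>tensor_prod K A B\<^esub> pure_tensor K A B a' b' =
      pure_tensor K A B (a \<otimes>\<^bsub>A\<^esub> a') (b \<otimes>\<^bsub>B\<^esub> b')"
  using Z.cls_mult[of "(a, b)" "(a', b')"] by (simp add: Z_A Z_cls)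

lemma pure_tensor_one: "pure_tensor K A B \<one>\<^bsub>A\<^esub> \<one>\<^bsub>B\<^esub> = \<one>\<^bsub>tensor_prod K A B\<^esub>"
  using Z.cls_one by (simp add: Z_A Z_cls)

lemma tensor_prod_submodule_eq:
  assumes "submodule H K (tensor_prod K A B)"
    "\<And>a b. a \<in> carrier A \<Longrightarrow> b \<in> carrier B \<Longrightarrow> pure_tensor K A B a b \<in> H"
    "x \<in> carrier (tensor_prod K A B)"
  shows "x \<in> H"
  using Z.A_submodule_eq[of H x] assms by (auto simp: Z_A Z_cls)

lemma tensor_prod_linear_eqI:
  assumes "module K P" "g \<in> linear_maps K (tensor_prod K A B) P"
    "h \<in> linear_maps K (tensor_prod K A B) P"
    and "\<And>a b. a \<in> carrier A \<Longrightarrow> b \<in> carrier B \<Longrightarrow> g (pure_tensor K A B a b) = h (pure_tensor K A B a b)"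
    and "x \<in> carrier (tensor_prod K A B)"
  shows "g x = h x"
  using Z.A_linear_eqI[of P g h x] assms by (auto simp: Z_A Z_cls)

text \<open>For a function on pairs, respecting the two kinds of relations amounts to
  bilinearity.\<close>

lemma bilinear_factors_tensor_prod:
  assumes P: "module K P" and \<beta>: "\<beta> \<in> bilinear_maps K A B P"
  obtains h where "h \<in> linear_maps K (tensor_prod K A B) P"
    "\<And>a b. a \<in> carrier A \<Longrightarrow> b \<in> carrier B \<Longrightarrow> h (pure_tensor K A B a b) = \<beta> a b"
proof -
  let ?\<phi> = "\<lambda>p. \<beta> (fst p) (snd p)"
  have cl: "?\<phi> z \<in> carrier P" if "z \<in> carrier (A \<times>\<times> B)" for z
    using bilinear_maps_closed[OF \<beta>] that by auto
  have add: "?\<phi> p = ?\<phi> q \<oplus>\<^bsub>P\<^esub> ?\<phi> r" if "tensor_Radd A B p q r" for p q r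
    using that linear_maps_add[OF bilinear_maps_left[OF \<beta>]] linear_maps_add[OF bilinear_maps_right[OF \<beta>]]
    by (auto simp: tensor_Radd_def)
  have smult: "?\<phi> p = k \<odot>\<^bsub>P\<^esub> ?\<phi> q" if "tensor_Rsmult K A B k p q" for k p q
    using that linear_maps_smult[OF bilinear_maps_left[OF \<beta>]] linear_maps_smult[OF bilinear_maps_right[OF \<beta>]]
    by (auto simp: tensor_Rsmult_def)
  show thesis
  proof (rule that[of "Z.lift P ?\<phi>"])
    show "Z.lift P ?\<phi> \<in> linear_maps K (tensor_prod K A B) P"
      using Z.lift_linear[of P ?\<phi>, OF P cl add smult] by (simp add: Z_A)
    fix a b assume "a \<in> carrier A" "b \<in> carrier B"
    then show "Z.lift P ?\<phi> (pure_tensor K A B a b) = \<beta> a b"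
      using Z.lift_cls[of P ?\<phi> "(a, b)", OF P cl add smult] by (simp add: Z_cls)
  qed
qed

text \<open>Coefficients are unnecessary because a scalar can be moved into the left factor; so the
  finite sums of pure tensors already form a submodule. Applied to a coproduct, this shows that a
  Sweedler sum ranges over at least one expression.\<close>

lemma tensor_prod_sum_of_pure:
  assumes "x \<in> carrier (tensor_prod K A B)"
  obtains n :: nat and a b where "\<And>i. i < n \<Longrightarrow> a i \<in> carrier A \<and> b i \<in> carrier B"
    "x = (\<Oplus>\<^bsub>tensor_prod K A B\<^esub>i\<in>{..<n}. pure_tensor K A B (a i) (b i))"
proof -
  let ?Z = "tensor_prod K A B" and ?p = "pure_tensor K A B"
  interpret ZZ: module K ?Z by (rule module_tensor_prod)
  let ?H = "{x. \<exists>(n::nat) a b. (\<forall>i<n. a i \<in> carrier A \<and> b i \<in> carrier B) \<and>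
      x = (\<Oplus>\<^bsub>?Z\<^esub>i\<in>{..<n}. ?p (a i) (b i))}"
  have pc: "?p a b \<in> carrier ?Z" if "a \<in> carrier A" "b \<in> carrier B" for a b
    using bilinear_maps_closed[OF pure_tensor_bilinear] that .
  have smult: "c \<odot>\<^bsub>?Z\<^esub> x \<in> ?H" if c: "c \<in> carrier K" and x: "x \<in> ?H" for c x
  proof -
    obtain n :: nat and a b where ab: "\<forall>i<n. a i \<in> carrier A \<and> b i \<in> carrier B"
      "x = (\<Oplus>\<^bsub>?Z\<^esub>i\<in>{..<n}. ?p (a i) (b i))" using x by blast
    have "c \<odot>\<^bsub>?Z\<^esub> x = (\<Oplus>\<^bsub>?Z\<^esub>i\<in>{..<n}. c \<odot>\<^bsub>?Z\<^esub> ?p (a i) (b i))"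
      unfolding ab(2) by (rule ZZ.finsum_smult_ldistr) (use ab(1) pc c in auto)
    also have "\<dots> = (\<Oplus>\<^bsub>?Z\<^esub>i\<in>{..<n}. ?p (c \<odot>\<^bsub>A\<^esub> a i) (b i))"
      by (rule ZZ.M.finsum_cong')
         (use ab(1) pc c linear_maps_smult[OF bilinear_maps_left[OF pure_tensor_bilinear]] in auto)
    finally have "c \<odot>\<^bsub>?Z\<^esub> x = (\<Oplus>\<^bsub>?Z\<^esub>i\<in>{..<n}. ?p (c \<odot>\<^bsub>A\<^esub> a i) (b i))" .
    moreover have "\<forall>i<n. c \<odot>\<^bsub>A\<^esub> a i \<in> carrier A \<and> b i \<in> carrier B" using ab(1) c by simp
    ultimately show ?thesis
      by (intro CollectI exI[of _ n] exI[of _ "\<lambda>i. c \<odot>\<^bsub>A\<^esub> a i"] exI[of _ b] conjI)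
  qed
  have sub: "?H \<subseteq> carrier ?Z" using pc by (auto intro!: ZZ.M.finsum_closed)
  have "submodule ?H K ?Z"
  proof (rule ZZ.submoduleI)
    have "\<zero>\<^bsub>?Z\<^esub> = (\<Oplus>\<^bsub>?Z\<^esub>i\<in>{..<0::nat}. ?p \<one>\<^bsub>A\<^esub> \<one>\<^bsub>B\<^esub>)" by simp
    then show "\<zero>\<^bsub>?Z\<^esub> \<in> ?H"
      by (intro CollectI exI[of _ "0::nat"] exI[of _ "\<lambda>_. \<one>\<^bsub>A\<^esub>"] exI[of _ "\<lambda>_. \<one>\<^bsub>B\<^esub>"]) simp
    fix x assume x: "x \<in> ?H"
    have "\<ominus>\<^bsub>?Z\<^esub> x = (\<ominus>\<^bsub>K\<^esub> \<one>\<^bsub>K\<^esub>) \<odot>\<^bsub>?Z\<^esub> x"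
      using subsetD[OF sub x] by (simp add: ZZ.smult_l_minus)
    then show "\<ominus>\<^bsub>?Z\<^esub> x \<in> ?H" using smult[OF _ x] by simp
  next
    fix x y assume "x \<in> ?H" "y \<in> ?H"
    then obtain n :: nat and a b and m :: nat and c d where ab: "\<forall>i<n. a i \<in> carrier A \<and> b i \<in> carrier B"
      "x = (\<Oplus>\<^bsub>?Z\<^esub>i\<in>{..<n}. ?p (a i) (b i))" and cd: "\<forall>i<m. c i \<in> carrier A \<and> d i \<in> carrier B"
      "y = (\<Oplus>\<^bsub>?Z\<^esub>i\<in>{..<m}. ?p (c i) (d i))" by blast
    \<comment> \<open>The two sums are concatenated: indices from \<open>n\<close> on address the
      second one, shifted by \<open>n\<close>.\<close>
    let ?a = "\<lambda>i. if i < n then a i else c (i - n)" and ?b = "\<lambda>i. if i < n then b i else d (i - n)"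
    have 1: "\<forall>i<n + m. ?a i \<in> carrier A \<and> ?b i \<in> carrier B" using ab(1) cd(1) by auto
    have "{..<n + m} = {..<n} \<union> (\<lambda>i. i + n) ` {..<m}"
    proof (intro equalityI subsetI)
      fix i assume "i \<in> {..<n + m}"
      then show "i \<in> {..<n} \<union> (\<lambda>i. i + n) ` {..<m}"
        by (cases "i < n") (auto intro!: rev_image_eqI[of "i - n"])
    qed auto
    then have "(\<Oplus>\<^bsub>?Z\<^esub>i\<in>{..<n + m}. ?p (?a i) (?b i)) = (\<Oplus>\<^bsub>?Z\<^esub>i\<in>{..<n} \<union> (\<lambda>i. i + n) ` {..<m}. ?p (?a i) (?b i))"
      by simp
    also have "\<dots> = (\<Oplus>\<^bsub>?Z\<^esub>i\<in>{..<n}. ?p (?a i) (?b i)) \<oplus>\<^bsub>?Z\<^esub>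
        (\<Oplus>\<^bsub>?Z\<^esub>i\<in>(\<lambda>i. i + n) ` {..<m}. ?p (?a i) (?b i))"
      by (rule ZZ.M.finsum_Un_disjoint) (use ab(1) cd(1) pc in auto)
    also have "(\<Oplus>\<^bsub>?Z\<^esub>i\<in>{..<n}. ?p (?a i) (?b i)) = x"
      unfolding ab(2) by (rule ZZ.M.finsum_cong') (use ab(1) pc in auto)
    also have "(\<Oplus>\<^bsub>?Z\<^esub>i\<in>(\<lambda>i. i + n) ` {..<m}. ?p (?a i) (?b i)) =
        (\<Oplus>\<^bsub>?Z\<^esub>i\<in>{..<m}. ?p (?a (i + n)) (?b (i + n)))"
      by (rule ZZ.M.finsum_reindex) (use ab(1) cd(1) pc in \<open>auto simp: inj_on_def\<close>)
    also have "\<dots> = y" unfolding cd(2) by simp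
    finally show "x \<oplus>\<^bsub>?Z\<^esub> y \<in> ?H" using 1 by (intro CollectI exI[of _ "n + m"] exI[of _ ?a] exI[of _ ?b]) simp
  qed (use sub smult in auto)
  moreover have "?p a b \<in> ?H" if "a \<in> carrier A" "b \<in> carrier B" for a b
    by (intro CollectI exI[of _ "1::nat"] exI[of _ "\<lambda>_. a"] exI[of _ "\<lambda>_. b"])
       (use that pc in \<open>simp add: lessThan_Suc\<close>)
  ultimately have "x \<in> ?H" using assms by (rule tensor_prod_submodule_eq)
  then show thesis using that by blast
qed

end

section \<open>The coproduct and the extension of the product\<close>

lemma module_self_module: "cring K \<Longrightarrow> module K (self_module K)"
proof -
  assume "cring K"
  then interpret cring K .
  show ?thesis
    by (rule moduleI, rule is_cring, rule abelian_groupI)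
       (auto simp: self_module_def a_ac m_assoc l_distr r_distr l_neg intro!: bexI[of _ "\<ominus>\<^bsub>K\<^esub> _"])
qed

text \<open>Conditions 2 and 4 as a recursion on the left word: the base case is the counit of
  \<open>w\<close> times the unit, and in the step the coproduct of \<open>w\<close> is shared
  between the first letter and the rest.\<close>

primrec word_star ::
    "('k, 'm) ring_scheme \<Rightarrow> ('k, 'v, 'p) module_scheme \<Rightarrow> ('v \<Rightarrow> 'v \<Rightarrow> 'v) \<Rightarrow>
      'v list \<Rightarrow> 'v list \<Rightarrow> ('v list \<Rightarrow> 'k) set"
  where
    "word_star K V prd [] w =
      (if w = [] then \<one>\<^bsub>tensor_algebra K V\<^esub> else \<zero>\<^bsub>tensor_algebra K V\<^esub>)"
  | "word_star K V prd (x # u) w = deshuffle_sum (tensor_algebra K V)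
      (\<lambda>a b. letter K V (letter_star V prd x a) \<otimes>\<^bsub>tensor_algebra K V\<^esub> word_star K V prd u b) w"

text \<open>Phrased for a curried \<open>\<sigma>\<close>, so that the argument runs with bilinear
  maps on T(V); the tensor square as source of the extended product comes in only in the last
  theorem.\<close>

definition star_extension ::
    "('k, 'm) ring_scheme \<Rightarrow> ('k, 'v, 'p) module_scheme \<Rightarrow> ('v \<Rightarrow> 'v \<Rightarrow> 'v) \<Rightarrow>
      (('v list \<Rightarrow> 'k) set \<Rightarrow> ('v list \<Rightarrow> 'k) set \<Rightarrow> ('v list \<Rightarrow> 'k) set) \<Rightarrow> bool"
  where "star_extension K V prd \<sigma> \<longleftrightarrow> (let T = tensor_algebra K V; \<iota> = letter K V in
    (\<forall>x\<in>carrier V. \<forall>y\<in>carrier V. \<sigma> (\<iota> x) (\<iota> y) = \<iota> (prd x y)) \<and>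
    (\<forall>f\<in>carrier T. \<sigma> f \<one>\<^bsub>T\<^esub> = f) \<and>
    (\<forall>f\<in>carrier T. \<sigma> \<one>\<^bsub>T\<^esub> f = counit K V f \<odot>\<^bsub>T\<^esub> \<one>\<^bsub>T\<^esub>) \<and>
    (\<forall>f\<in>carrier T. \<forall>x\<in>carrier V. \<forall>y\<in>carrier V.
      \<sigma> (\<iota> x) (f \<otimes>\<^bsub>T\<^esub> \<iota> y) = \<sigma> (\<sigma> (\<iota> x) f) (\<iota> y) \<ominus>\<^bsub>T\<^esub> \<sigma> (\<iota> x) (\<sigma> f (\<iota> y))) \<and>
    (\<forall>f\<in>carrier T. \<forall>g\<in>carrier T. \<forall>h\<in>carrier T.
      sweedler_sum_eq K V T (\<lambda>a b. \<sigma> f a \<otimes>\<^bsub>T\<^esub> \<sigma> g b) h (\<sigma> (f \<otimes>\<^bsub>T\<^esub> g) h)))"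

section \<open>Counit, coproduct and Sweedler sums on words\<close>

context
  fixes K :: "('k, 'm) ring_scheme" and V :: "('k, 'v, 'p) module_scheme"
  assumes V: "module K V"
begin

private abbreviation (input) "T \<equiv> tensor_algebra K V"
private abbreviation (input) "TT \<equiv> tensor_prod K T T"
private abbreviation (input) "pure \<equiv> pure_tensor K T T"
private abbreviation (input) "word \<equiv> word_tensor K V"
private abbreviation (input) "words \<equiv> lists (carrier V)"

interpretation V: module K V by (rule V)
interpretation T: assoc_algebra K T by (rule assoc_algebra_tensor_algebra[OF V])
interpretation TT: assoc_algebra K TT
  by (rule assoc_algebra_tensor_prod) (rule T.assoc_algebra_axioms)+

private lemmas T = module_tensor_algebra[OF V]
private lemmas TT = TT.module_axioms
private lemmas T_eqI = tensor_algebra_linear_eqI[OF V]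
private lemmas wc = word_tensor_closed[OF V]
private lemmas pure_bilinear = pure_tensor_bilinear[OF T.assoc_algebra_axioms T.assoc_algebra_axioms]
private lemmas pc = bilinear_maps_closed[OF pure_bilinear]

text \<open>The definite description needs unique existence. Existence lifts the indicator of the
  empty word. Uniqueness holds because a word of length n lies in the n-th tensor power, while
  extensionality fixes the values outside the carrier.\<close>

lemma counit_props:
  "counit K V \<in> extensional (carrier T) \<and> counit K V \<in> linear_maps K T (self_module K) \<and>
    counit K V \<one>\<^bsub>T\<^esub> = \<one>\<^bsub>K\<^esub> \<and> (\<forall>n\<ge>1. \<forall>z\<in>tensor_power K V n. counit K V z = \<zero>\<^bsub>K\<^esub>)"
proof -
  have self: "module K (self_module K)" by (rule module_self_module[OF V.R.is_cring])
  define \<delta> :: "'v list \<Rightarrow> 'k" where "\<delta> w = (if w = [] then \<one>\<^bsub>K\<^esub> else \<zero>\<^bsub>K\<^esub>)" for w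
  have zero: "\<zero>\<^bsub>self_module K\<^esub> = \<zero>\<^bsub>K\<^esub>" "\<one>\<^bsub>K\<^esub> \<in> carrier (self_module K)" by (simp_all add: self_module_def)
  \<comment> \<open>\<open>\<delta>\<close> is zero on every nonempty word, and only those have a
    letter to vary.\<close>
  have "multilinear K V (self_module K) \<delta>"
    by (rule multilinearI) (use linear_maps_const_zero[OF V self] in \<open>simp_all add: \<delta>_def zero\<close>)
  note e = word_lift_linear[OF V self this] and ew = word_lift_word[OF V self this]
  let ?e = "restrict (word_lift K V (self_module K) \<delta>) (carrier T)"
  have e': "?e \<in> linear_maps K T (self_module K)"
    using e by (subst linear_maps_cong[OF T]) auto
  have pw: "{word w |w. w \<in> words \<and> length w = n} \<subseteq> carrier T" for n using wc by auto
  have e1: "?e \<one>\<^bsub>T\<^esub> = \<one>\<^bsub>K\<^esub>"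
      using ew[of "[]"] by (simp add: word_tensor_Nil[OF V] \<delta>_def)
  have e0: "?e z = \<zero>\<^bsub>K\<^esub>" if n: "1 \<le> n" and z: "z \<in> tensor_power K V n" for n :: nat and z
      unfolding zero(1)[symmetric]
    proof (rule linear_maps_eq_on_span[OF T self e' linear_maps_const_zero[OF T self] pw _
          z[unfolded tensor_power_def]])
      fix y assume "y \<in> {word w |w. w \<in> words \<and> length w = n}"
      then obtain w where w: "y = word w" "w \<in> words" "length w = n" by blast
      then have "w \<noteq> []" using n by auto
      with w show "?e y = \<zero>\<^bsub>self_module K\<^esub>" using ew wc by (simp add: \<delta>_def zero)
    qed
  have uniq: "e = ?e" if e: "e \<in> extensional (carrier T) \<and> e \<in> linear_maps K T (self_module K) \<and>
      e \<one>\<^bsub>T\<^esub> = \<one>\<^bsub>K\<^esub> \<and> (\<forall>n\<ge>1. \<forall>z\<in>tensor_power K V n. e z = \<zero>\<^bsub>K\<^esub>)" for e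
    proof (rule extensionalityI)
      fix z assume z: "z \<in> carrier T"
      show "e z = ?e z"
      proof (rule T_eqI[OF self _ e' _ z])
        fix w assume w: "w \<in> words"
        have "word w \<in> tensor_power K V (length w)"
          unfolding tensor_power_def using w submodule_span_superset by fast
        then have "w \<noteq> [] \<Longrightarrow> e (word w) = \<zero>\<^bsub>K\<^esub>" using e by (cases w) auto
        then show "e (word w) = ?e (word w)"
          using e w wc[OF w] ew[of "[]"] by (cases "w = []") (simp_all add: ew \<delta>_def word_tensor_Nil[OF V])
      qed (use e in blast)
    qed (use e in auto)
  have "\<exists>!e. e \<in> extensional (carrier T) \<and> e \<in> linear_maps K T (self_module K) \<and>
      e \<one>\<^bsub>T\<^esub> = \<one>\<^bsub>K\<^esub> \<and> (\<forall>n\<ge>1. \<forall>z\<in>tensor_power K V n. e z = \<zero>\<^bsub>K\<^esub>)"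
    by (rule ex1I[of _ ?e]) (use e' e1 e0 uniq in \<open>blast intro: restrict_extensional\<close>)+
  from theI'[OF this] show ?thesis unfolding counit_def .
qed

lemma linear_counit: "counit K V \<in> linear_maps K T (self_module K)"
  using counit_props by blast

lemma counit_word:
  assumes w: "w \<in> words"
  shows "counit K V (word w) = (if w = [] then \<one>\<^bsub>K\<^esub> else \<zero>\<^bsub>K\<^esub>)"
proof -
  have "word w \<in> tensor_power K V (length w)"
    unfolding tensor_power_def using w submodule_span_superset by fast
  then show ?thesis using counit_props by (cases w) (auto simp: word_tensor_Nil[OF V])
qed

private lemma multilinear_pure_left:
  "b \<in> carrier T \<Longrightarrow> multilinear K V TT (\<lambda>a. pure (word a) b)"
  by (rule multilinear_comp[OF bilinear_maps_left[OF pure_bilinear] multilinear_word_tensor[OF V]])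

private lemma multilinear_pure_right:
  "a \<in> carrier T \<Longrightarrow> multilinear K V TT (\<lambda>b. pure a (word b))"
  by (rule multilinear_comp[OF bilinear_maps_right[OF pure_bilinear] multilinear_word_tensor[OF V]])

text \<open>Existence lifts the sum over splittings of a word; uniqueness holds because a word is
  the product of its letters. The explicit formula on words comes out of the same construction and
  is what later computations use.\<close>

lemma deshuffle_props:
  "deshuffle K V \<in> extensional (carrier T) \<and> deshuffle K V \<in> algebra_homs K T TT \<and>
    (\<forall>x\<in>carrier V. deshuffle K V (letter K V x) =
      pure (letter K V x) \<one>\<^bsub>T\<^esub> \<oplus>\<^bsub>TT\<^esub> pure \<one>\<^bsub>T\<^esub> (letter K V x))" (is ?props)
  and deshuffle_word:
  "w \<in> words \<Longrightarrow> deshuffle K V (word w) = deshuffle_sum TT (\<lambda>a b. pure (word a) (word b)) w"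
proof -
  let ?B = "\<lambda>a b. pure (word a) (word b)"
  have "multilinear K V TT (deshuffle_sum TT ?B)"
    by (rule deshuffle_sum_multilinear[OF V TT])
       (simp_all add: multilinear_pure_left multilinear_pure_right wc)
  note d = word_lift_linear[OF V TT this] and dw = word_lift_word[OF V TT this]
  let ?lift = "word_lift K V TT (deshuffle_sum TT ?B)"
  let ?d = "restrict ?lift (carrier T)"
  have d': "?d \<in> linear_maps K T TT"
    using d by (subst linear_maps_cong[OF T]) auto
  have Bc: "?B a b \<in> carrier TT" if "a \<in> words" "b \<in> words" for a b
    using that pc wc by simp
  have dsc: "deshuffle_sum TT ?B w \<in> carrier TT" if "w \<in> words" for w
    by (rule TT.M.deshuffle_sum_closed[OF that]) (rule Bc)
  \<comment> \<open>Multiplicativity on words: \<open>deshuffle_sum_append\<close> separates the two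
    splittings, and pure tensors multiply factor by factor.\<close>
  have mw: "deshuffle_sum TT ?B (u @ v) = deshuffle_sum TT ?B u \<otimes>\<^bsub>TT\<^esub> deshuffle_sum TT ?B v"
    if u: "u \<in> words" and v: "v \<in> words" for u v
  proof -
    have "deshuffle_sum TT ?B (u @ v) =
        deshuffle_sum TT (\<lambda>a b. deshuffle_sum TT (\<lambda>a' b'. ?B (a @ a') (b @ b')) v) u"
      by (rule deshuffle_sum_append)
    also have "\<dots> = deshuffle_sum TT (\<lambda>a b. ?B a b \<otimes>\<^bsub>TT\<^esub> deshuffle_sum TT ?B v) u"
    proof (rule deshuffle_sum_cong[OF u])
      fix a b assume ab: "a \<in> words" "b \<in> words"
      have "?B a b \<otimes>\<^bsub>TT\<^esub> deshuffle_sum TT ?B v =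
          deshuffle_sum TT (\<lambda>a' b'. ?B a b \<otimes>\<^bsub>TT\<^esub> ?B a' b') v"
        by (rule linear_maps_deshuffle_sum[OF TT TT TT.linear_maps_mult_left[OF Bc[OF ab]] v]) (rule Bc)
      also have "\<dots> = deshuffle_sum TT (\<lambda>a' b'. ?B (a @ a') (b @ b')) v"
        by (rule deshuffle_sum_cong[OF v])
           (use ab wc in \<open>simp add: pure_tensor_mult[OF T.assoc_algebra_axioms T.assoc_algebra_axioms]
              word_tensor_append[OF V]\<close>)
      finally show "deshuffle_sum TT (\<lambda>a' b'. ?B (a @ a') (b @ b')) v =
          ?B a b \<otimes>\<^bsub>TT\<^esub> deshuffle_sum TT ?B v" ..
    qed
    also have "\<dots> = deshuffle_sum TT ?B u \<otimes>\<^bsub>TT\<^esub> deshuffle_sum TT ?B v"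
      by (rule linear_maps_deshuffle_sum[OF TT TT TT.linear_maps_mult_right[OF dsc[OF v]] u, symmetric])
         (rule Bc)
    finally show ?thesis .
  qed
  \<comment> \<open>Both sides are linear in \<open>f\<close> and in \<open>g\<close>, which carries
    multiplicativity from words to T(V).\<close>
  have mult: "?lift (f \<otimes>\<^bsub>T\<^esub> g) = ?lift f \<otimes>\<^bsub>TT\<^esub> ?lift g" if f: "f \<in> carrier T" and g: "g \<in> carrier T" for f g
  proof (rule T_eqI[OF TT _ _ _ f])
    note dc = linear_maps_closed[OF d]
    show "(\<lambda>f. ?lift (f \<otimes>\<^bsub>T\<^esub> g)) \<in> linear_maps K T TT"
      by (rule linear_maps_comp[OF d T.linear_maps_mult_right[OF g]])
    show "(\<lambda>f. ?lift f \<otimes>\<^bsub>TT\<^esub> ?lift g) \<in> linear_maps K T TT"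
      by (rule linear_maps_comp[OF TT.linear_maps_mult_right[OF dc[OF g]] d])
    fix u assume u: "u \<in> words"
    show "?lift (word u \<otimes>\<^bsub>T\<^esub> g) = ?lift (word u) \<otimes>\<^bsub>TT\<^esub> ?lift g"
    proof (rule T_eqI[OF TT _ _ _ g])
      show "(\<lambda>g. ?lift (word u \<otimes>\<^bsub>T\<^esub> g)) \<in> linear_maps K T TT"
        by (rule linear_maps_comp[OF d T.linear_maps_mult_left[OF wc[OF u]]])
      show "(\<lambda>g. ?lift (word u) \<otimes>\<^bsub>TT\<^esub> ?lift g) \<in> linear_maps K T TT"
        by (rule linear_maps_comp[OF TT.linear_maps_mult_left[OF dc[OF wc[OF u]]] d])
    qed (use u mw in \<open>simp add: word_tensor_append[OF V] dw\<close>)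
  qed
  have one: "?lift \<one>\<^bsub>T\<^esub> = \<one>\<^bsub>TT\<^esub>"
    using dw[of "[]"] pure_tensor_one[OF T.assoc_algebra_axioms T.assoc_algebra_axioms]
    by (simp add: word_tensor_Nil[OF V])
  have hom: "?d \<in> algebra_homs K T TT"
    unfolding algebra_homs_def
    by (intro IntI d' ring_hom_memI)
       (use linear_maps_closed[OF d] mult one linear_maps_add[OF d] in auto)
  have letter: "?d (letter K V x) = pure (letter K V x) \<one>\<^bsub>T\<^esub> \<oplus>\<^bsub>TT\<^esub> pure \<one>\<^bsub>T\<^esub> (letter K V x)"
    if "x \<in> carrier V" for x
    using dw[of "[x]"] that letter_closed[OF V that] by (simp add: letter_def word_tensor_Nil[OF V])
  have uniq: "d = ?d" if "d \<in> extensional (carrier T)" "d \<in> algebra_homs K T TT"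
    "\<forall>x\<in>carrier V. d (letter K V x) = pure (letter K V x) \<one>\<^bsub>T\<^esub> \<oplus>\<^bsub>TT\<^esub> pure \<one>\<^bsub>T\<^esub> (letter K V x)" for d
  proof (rule extensionalityI[OF that(1)])
    have dl: "d \<in> linear_maps K T TT" and dh: "d \<in> ring_hom T TT"
      and dh': "?d \<in> ring_hom T TT" using that(2) hom by (auto simp: algebra_homs_def)
    fix z assume z: "z \<in> carrier T"
    show "d z = ?d z"
    proof (rule T_eqI[OF TT dl d' _ z])
      fix w assume "w \<in> words"
      then show "d (word w) = ?d (word w)"
      proof (induction w rule: list.induct)
        case Nil
        then show ?case by (simp only: word_tensor_Nil[OF V] ring_hom_one[OF dh] ring_hom_one[OF dh'])
      next
        case (Cons x w)
        then have x: "x \<in> carrier V" and w: "w \<in> words" by auto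
        show ?case unfolding word_tensor_Cons[OF V x w]
            ring_hom_mult[OF dh letter_closed[OF V x] wc[OF w]]
            ring_hom_mult[OF dh' letter_closed[OF V x] wc[OF w]]
          using Cons.IH w that(3) x letter[OF x] by simp
      qed
    qed
  qed simp
  have eq: "deshuffle K V = ?d"
    unfolding deshuffle_def Let_def
  proof (rule the_equality)
    show "?d \<in> extensional (carrier T) \<and> ?d \<in> algebra_homs K T TT \<and>
      (\<forall>x\<in>carrier V. ?d (letter K V x) =
        pure (letter K V x) \<one>\<^bsub>T\<^esub> \<oplus>\<^bsub>TT\<^esub> pure \<one>\<^bsub>T\<^esub> (letter K V x))"
      using hom letter by (intro conjI ballI) simp_all
  qed (use uniq in blast)
  show ?props unfolding eq using hom letter by (intro conjI ballI) simp_all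
  show "deshuffle K V (word w) = deshuffle_sum TT ?B w" if "w \<in> words"
    unfolding eq using that wc by (simp add: dw)
qed

lemma linear_deshuffle: "deshuffle K V \<in> linear_maps K T TT"
  using deshuffle_props by (simp add: algebra_homs_def)

text \<open>A linear \<open>g\<close> through which \<open>\<beta>\<close> factors sends every
  expression of the coproduct by pure tensors to the matching sum of values of
  \<open>\<beta>\<close>. Hence all these sums coincide with
  \<open>g (deshuffle K V h)\<close>.\<close>

lemma sweedler_sum_eq_iff:
  assumes P: "module K P" and \<beta>: "\<beta> \<in> bilinear_maps K T T P"
    and g: "g \<in> linear_maps K TT P"
    and g\<beta>: "\<And>a b. a \<in> carrier T \<Longrightarrow> b \<in> carrier T \<Longrightarrow> g (pure a b) = \<beta> a b"
    and h: "h \<in> carrier T"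
  shows "sweedler_sum_eq K V P \<beta> h s \<longleftrightarrow> s = g (deshuffle K V h)"
proof -
  interpret P: module K P by (rule P)
  have *: "g (\<Oplus>\<^bsub>TT\<^esub>i\<in>{..<n}. pure (a i) (b i)) = (\<Oplus>\<^bsub>P\<^esub>i\<in>{..<n}. \<beta> (a i) (b i))"
    if ab: "\<forall>i<n. a i \<in> carrier T \<and> b i \<in> carrier T" for n :: nat and a b
  proof -
    have "g (\<Oplus>\<^bsub>TT\<^esub>i\<in>{..<n}. pure (a i) (b i)) = (\<Oplus>\<^bsub>P\<^esub>i\<in>{..<n}. g (pure (a i) (b i)))"
      by (rule linear_maps_finsum[OF TT P g]) (use ab pc in auto)
    also have "\<dots> = (\<Oplus>\<^bsub>P\<^esub>i\<in>{..<n}. \<beta> (a i) (b i))"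
      by (rule P.M.finsum_cong') (use ab g\<beta> bilinear_maps_closed[OF \<beta>] in auto)
    finally show ?thesis .
  qed
  \<comment> \<open>Without some expression of the coproduct, \<open>sweedler_sum_eq\<close> would
    hold vacuously for every \<open>s\<close>.\<close>
  obtain n :: nat and a b where ab: "\<And>i. i < n \<Longrightarrow> a i \<in> carrier T \<and> b i \<in> carrier T"
    "deshuffle K V h = (\<Oplus>\<^bsub>TT\<^esub>i\<in>{..<n}. pure (a i) (b i))"
    using tensor_prod_sum_of_pure[OF T.assoc_algebra_axioms T.assoc_algebra_axioms
        linear_maps_closed[OF linear_deshuffle h]] by blast
  show ?thesis
  proof
    assume "sweedler_sum_eq K V P \<beta> h s"
    then have "s = (\<Oplus>\<^bsub>P\<^esub>i\<in>{..<n}. \<beta> (a i) (b i))"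
      unfolding sweedler_sum_eq_def Let_def using ab by blast
    then show "s = g (deshuffle K V h)" using *[of n a b] ab by simp
  next
    assume s: "s = g (deshuffle K V h)"
    show "sweedler_sum_eq K V P \<beta> h s"
      unfolding sweedler_sum_eq_def Let_def
    proof (intro allI impI, elim conjE)
      fix m :: nat and c d
      assume "\<forall>i<m. c i \<in> carrier T \<and> d i \<in> carrier T"
        "deshuffle K V h = (\<Oplus>\<^bsub>TT\<^esub>i\<in>{..<m}. pure (c i) (d i))"
      then show "s = (\<Oplus>\<^bsub>P\<^esub>i\<in>{..<m}. \<beta> (c i) (d i))" using * s by simp
    qed
  qed
qed

lemma deshuffle_word_factor:
  assumes P: "module K P" and g: "g \<in> linear_maps K TT P"
    and g\<beta>: "\<And>a b. a \<in> carrier T \<Longrightarrow> b \<in> carrier T \<Longrightarrow> g (pure a b) = \<beta> a b"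
    and w: "w \<in> words"
  shows "g (deshuffle K V (word w)) = deshuffle_sum P (\<lambda>a b. \<beta> (word a) (word b)) w"
proof -
  have "g (deshuffle K V (word w)) = deshuffle_sum P (\<lambda>a b. g (pure (word a) (word b))) w"
    unfolding deshuffle_word[OF w]
    by (rule linear_maps_deshuffle_sum[OF TT P g w]) (simp add: pc wc)
  also have "\<dots> = deshuffle_sum P (\<lambda>a b. \<beta> (word a) (word b)) w"
    by (rule deshuffle_sum_cong[OF w]) (simp add: g\<beta> wc)
  finally show ?thesis .
qed

text \<open>This makes condition 4 computable: against a word, the Sweedler sum is the finite
  recursion \<open>deshuffle_sum\<close>.\<close>

lemma sweedler_sum_eq_word:
  assumes P: "module K P" and \<beta>: "\<beta> \<in> bilinear_maps K T T P" and w: "w \<in> words"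
  shows "sweedler_sum_eq K V P \<beta> (word w) s \<longleftrightarrow>
    s = deshuffle_sum P (\<lambda>a b. \<beta> (word a) (word b)) w"
proof -
  obtain g where g: "g \<in> linear_maps K TT P"
    "\<And>a b. a \<in> carrier T \<Longrightarrow> b \<in> carrier T \<Longrightarrow> g (pure a b) = \<beta> a b"
    using bilinear_factors_tensor_prod[OF T.assoc_algebra_axioms T.assoc_algebra_axioms P \<beta>] by blast
  show ?thesis
    using sweedler_sum_eq_iff[OF P \<beta> g wc[OF w]] deshuffle_word_factor[OF P g w] by simp
qed

lemma bilinear_mult:
  assumes g: "g \<in> linear_maps K M T" and h: "h \<in> linear_maps K N T"
  shows "(\<lambda>a b. g a \<otimes>\<^bsub>T\<^esub> h b) \<in> bilinear_maps K M N T"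
  unfolding bilinear_maps_def
  using linear_maps_comp[OF T.linear_maps_mult_left h] linear_maps_comp[OF T.linear_maps_mult_right g]
    linear_maps_closed[OF g] linear_maps_closed[OF h] by auto

section \<open>The extended product on words, its existence and uniqueness\<close>

context
  fixes prd assumes prd: "prd \<in> bilinear_maps K V V V"
begin

private abbreviation (input) "R \<equiv> letter_star V prd"
private abbreviation (input) "W \<equiv> word_star K V prd"
private abbreviation (input) "der \<equiv> derivation_sum T prd"

private lemmas Rc = letter_star_closed[OF V prd]
private lemmas lc = letter_closed[OF V]

text \<open>Supplies the term of the Leibniz rule in which the first letter is left
  unchanged.\<close>

lemma letter_mult_derivation_sum:
  assumes x: "x \<in> carrier V" and y: "y \<in> carrier V" and u: "u \<in> words"
  shows "letter K V x \<otimes>\<^bsub>T\<^esub> der word y u = der (\<lambda>v. word (x # v)) y u"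
proof -
  have pcl: "\<And>z. z \<in> carrier V \<Longrightarrow> prd z y \<in> carrier V" using bilinear_maps_closed[OF prd _ y] .
  have "letter K V x \<otimes>\<^bsub>T\<^esub> der word y u = der (\<lambda>v. letter K V x \<otimes>\<^bsub>T\<^esub> word v) y u"
    by (rule linear_maps_derivation_sum[OF T T T.linear_maps_mult_left[OF lc[OF x]] u]) (simp_all add: pcl wc)
  also have "\<dots> = der (\<lambda>v. word (x # v)) y u"
    by (rule derivation_sum_cong[OF u]) (simp_all add: pcl word_tensor_Cons[OF V x])
  finally show ?thesis .
qed

lemma word_star_closed: "u \<in> words \<Longrightarrow> w \<in> words \<Longrightarrow> W u w \<in> carrier T"
proof (induction u arbitrary: w rule: list.induct)
  case (Cons x u)
  show ?case unfolding word_star.simps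
    by (rule T.M.deshuffle_sum_closed[OF Cons.prems(2)])
       (use Cons in \<open>auto intro!: T.A.m_closed lc Rc\<close>)
qed simp

lemma word_star_multilinear_right:
  assumes "u \<in> words"
  shows "multilinear K V T (W u)"
  using assms
proof (induction u rule: list.induct)
  case Nil
  show ?case
    by (rule multilinearI) (use linear_maps_const_zero[OF V T] in simp_all)
next
  case (Cons x u)
  then have x: "x \<in> carrier V" and u: "u \<in> words" by auto
  have "multilinear K V T (deshuffle_sum T (\<lambda>a b. letter K V (R x a) \<otimes>\<^bsub>T\<^esub> W u b))"
  proof (rule deshuffle_sum_multilinear[OF V T])
    fix b assume b: "b \<in> words"
    show "multilinear K V T (\<lambda>a. letter K V (R x a) \<otimes>\<^bsub>T\<^esub> W u b)"
      by (rule multilinear_comp[OF linear_maps_comp[OF T.linear_maps_mult_right linear_letter[OF V]]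
            letter_star_multilinear[OF V prd x]])
         (rule word_star_closed[OF u b])
  next
    fix a assume a: "a \<in> words"
    show "multilinear K V T (\<lambda>b. letter K V (R x a) \<otimes>\<^bsub>T\<^esub> W u b)"
      by (rule multilinear_comp[OF T.linear_maps_mult_left[OF lc[OF Rc[OF x a]]] Cons.IH[OF u]])
  qed
  then show ?case by (simp add: word_star.simps(2)[abs_def])
qed

text \<open>The recursion on the left word arrives at the varying letter, which enters there only
  through \<open>letter_star\<close>, linear in its letter argument.\<close>

lemma word_star_multilinear_left:
  assumes "w \<in> words"
  shows "multilinear K V T (\<lambda>u. W u w)"
proof (rule multilinearI)
  show "W [] w \<in> carrier T" by simp
  fix u v assume u: "u \<in> words" and v: "v \<in> words"
  from u assms show "(\<lambda>x. W (u @ x # v) w) \<in> linear_maps K V T"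
  proof (induction u arbitrary: w rule: list.induct)
    case Nil
    have "(\<lambda>x. letter K V (R x a) \<otimes>\<^bsub>T\<^esub> W v b) \<in> linear_maps K V T" if "a \<in> words" "b \<in> words" for a b
      by (rule linear_maps_comp[OF linear_maps_comp[OF T.linear_maps_mult_right linear_letter[OF V]]
            letter_star_linear[OF V prd that(1)]])
         (rule word_star_closed[OF v that(2)])
    then show ?case
      by (simp, intro deshuffle_sum_linear[OF T V Nil.prems(2)])
  next
    case (Cons z u)
    then have z: "z \<in> carrier V" and u: "u \<in> words" by auto
    have "(\<lambda>x. letter K V (R z a) \<otimes>\<^bsub>T\<^esub> W (u @ x # v) b) \<in> linear_maps K V T"
      if "a \<in> words" "b \<in> words" for a b
      by (rule linear_maps_comp[OF T.linear_maps_mult_left[OF lc[OF Rc[OF z that(1)]]]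
            Cons.IH[OF u that(2)]])
    then show ?case
      by (simp, intro deshuffle_sum_linear[OF T V Cons.prems(2)])
  qed
qed

text \<open>\<open>W [] b\<close> vanishes unless \<open>b\<close> is empty, so the counit law
  leaves only the term in which all of \<open>w\<close> goes to \<open>x\<close>.\<close>

lemma word_star_letter:
  assumes x: "x \<in> carrier V" and w: "w \<in> words"
  shows "W [x] w = letter K V (R x w)"
proof -
  have "W [x] w = deshuffle_sum T (\<lambda>a b. if b = [] then letter K V (R x a) else \<zero>\<^bsub>T\<^esub>) w"
    unfolding word_star.simps
    by (rule deshuffle_sum_cong[OF w]) (use lc Rc x in auto)
  also have "\<dots> = letter K V (R x w)"
    by (rule T.M.deshuffle_sum_counit(1)[OF w]) (use lc Rc x in auto)
  finally show ?thesis .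
qed

lemma word_star_Nil_right: "u \<in> words \<Longrightarrow> W u [] = word u"
  by (induction u rule: list.induct)
     (auto simp: word_tensor_Nil[OF V] word_tensor_Cons[OF V] letter_star_Nil)

text \<open>A one-letter word has two splittings, and they give the Leibniz rule: \<open>y\<close>
  acts on the first letter or on the rest.\<close>

lemma word_star_derivation:
  assumes "u \<in> words" and y: "y \<in> carrier V"
  shows "W u [y] = der word y u"
  using assms(1)
proof (induction u rule: list.induct)
  case (Cons x u)
  then have x: "x \<in> carrier V" and u: "u \<in> words" by auto
  have pxy: "prd x y \<in> carrier V" using bilinear_maps_closed[OF prd x y] .
  \<comment> \<open>The derivation sum over the empty word is zero, so the recursion starts with the
    given product.\<close>
  have "R x [y] = prd x y"
    using letter_star_snoc[OF V prd, of "[]" y x] y pxy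
    by (simp add: letter_star_Nil a_minus_def)
  then have "W (x # u) [y] = letter K V (prd x y) \<otimes>\<^bsub>T\<^esub> W u [] \<oplus>\<^bsub>T\<^esub> letter K V x \<otimes>\<^bsub>T\<^esub> W u [y]"
    by (simp add: letter_star_Nil)
  then show ?case
    using Cons.IH[OF u] x y u pxy
    by (simp add: word_star_Nil_right letter_mult_derivation_sum word_tensor_Cons[OF V])
qed simp

text \<open>Besides coassociativity the induction needs the counit law, for the empty left word, and
  associativity in T(V), which detaches the factor of \<open>v\<close> from that of
  \<open>u\<close>.\<close>

lemma word_star_append:
  assumes "u \<in> words" "v \<in> words" "w \<in> words"
  shows "W (u @ v) w = deshuffle_sum T (\<lambda>a b. W u a \<otimes>\<^bsub>T\<^esub> W v b) w"
  using assms
proof (induction u arbitrary: w rule: list.induct)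
  case Nil
  have "deshuffle_sum T (\<lambda>a b. W [] a \<otimes>\<^bsub>T\<^esub> W v b) w =
      deshuffle_sum T (\<lambda>a b. if a = [] then W v b else \<zero>\<^bsub>T\<^esub>) w"
    by (rule deshuffle_sum_cong[OF Nil.prems(3)]) (use word_star_closed Nil.prems in auto)
  also have "\<dots> = W v w"
    by (rule T.M.deshuffle_sum_counit(2)[OF Nil.prems(3)]) (use word_star_closed Nil.prems in auto)
  finally show ?case by simp
next
  case (Cons x u)
  then have x: "x \<in> carrier V" and u: "u \<in> words" and v: "v \<in> words" and w: "w \<in> words" by auto
  let ?C = "\<lambda>a b c. letter K V (R x a) \<otimes>\<^bsub>T\<^esub> W u b \<otimes>\<^bsub>T\<^esub> W v c"
  note cl = lc[OF Rc[OF x]] word_star_closed[OF u] word_star_closed[OF v]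
  have "W ((x # u) @ v) w = deshuffle_sum T (\<lambda>a b. letter K V (R x a) \<otimes>\<^bsub>T\<^esub> W (u @ v) b) w"
    by simp
  also have "\<dots> = deshuffle_sum T (\<lambda>a b. deshuffle_sum T (\<lambda>b1 b2. ?C a b1 b2) b) w"
  proof (rule deshuffle_sum_cong[OF w])
    fix a b assume a: "a \<in> words" and b: "b \<in> words"
    have "letter K V (R x a) \<otimes>\<^bsub>T\<^esub> W (u @ v) b =
        deshuffle_sum T (\<lambda>b1 b2. letter K V (R x a) \<otimes>\<^bsub>T\<^esub> (W u b1 \<otimes>\<^bsub>T\<^esub> W v b2)) b"
      unfolding Cons.IH[OF u v b]
      by (rule linear_maps_deshuffle_sum[OF T T T.linear_maps_mult_left[OF cl(1)[OF a]] b])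
         (simp add: cl)
    also have "\<dots> = deshuffle_sum T (\<lambda>b1 b2. ?C a b1 b2) b"
      by (rule deshuffle_sum_cong[OF b]) (simp add: cl a T.A.m_assoc)
    finally show "letter K V (R x a) \<otimes>\<^bsub>T\<^esub> W (u @ v) b = deshuffle_sum T (\<lambda>b1 b2. ?C a b1 b2) b" .
  qed
  \<comment> \<open>Instead of the part left over by \<open>x\<close>, the part shared by
    \<open>x\<close> and \<open>u\<close> is now the one that is split again.\<close>
  also have "\<dots> = deshuffle_sum T (\<lambda>a b. deshuffle_sum T (\<lambda>a1 a2. ?C a1 a2 b) a) w"
    by (rule T.M.deshuffle_sum_coassoc[OF w, symmetric]) (simp add: cl)
  also have "\<dots> = deshuffle_sum T (\<lambda>a b. W (x # u) a \<otimes>\<^bsub>T\<^esub> W v b) w"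
  proof (rule deshuffle_sum_cong[OF w])
    fix a b assume a: "a \<in> words" and b: "b \<in> words"
    show "deshuffle_sum T (\<lambda>a1 a2. ?C a1 a2 b) a = W (x # u) a \<otimes>\<^bsub>T\<^esub> W v b"
      unfolding word_star.simps
      by (rule linear_maps_deshuffle_sum[OF T T T.linear_maps_mult_right[OF cl(3)[OF b]] a, symmetric])
         (simp add: cl)
  qed
  finally show ?case .
qed

text \<open>Conditions 1, 2 and 4 pin down the action of a letter from the right, condition 3 the
  action of a word on a letter, and condition 4 once more the general product.\<close>

lemma star_extension_word:
  assumes \<sigma>: "\<sigma> \<in> bilinear_maps K T T T" and ext: "star_extension K V prd \<sigma>"
    and u: "u \<in> words" and w: "w \<in> words"
  shows "\<sigma> (word u) (word w) = W u w"
proof -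
  have letters: "\<sigma> (letter K V x) (letter K V y) = letter K V (prd x y)"
    if "x \<in> carrier V" "y \<in> carrier V" for x y
    using ext that by (simp add: star_extension_def Let_def)
  have one_right: "\<sigma> f \<one>\<^bsub>T\<^esub> = f"
    and one_left: "\<sigma> \<one>\<^bsub>T\<^esub> f = counit K V f \<odot>\<^bsub>T\<^esub> \<one>\<^bsub>T\<^esub>" if "f \<in> carrier T" for f
    using ext that by (simp_all add: star_extension_def Let_def)
  have letter_mult: "\<sigma> (letter K V x) (f \<otimes>\<^bsub>T\<^esub> letter K V y) =
      \<sigma> (\<sigma> (letter K V x) f) (letter K V y) \<ominus>\<^bsub>T\<^esub> \<sigma> (letter K V x) (\<sigma> f (letter K V y))"
    if "f \<in> carrier T" "x \<in> carrier V" "y \<in> carrier V" for f x y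
    using ext that by (simp add: star_extension_def Let_def)
  have mult: "sweedler_sum_eq K V T (\<lambda>a b. \<sigma> f a \<otimes>\<^bsub>T\<^esub> \<sigma> g b) h (\<sigma> (f \<otimes>\<^bsub>T\<^esub> g) h)"
    if "f \<in> carrier T" "g \<in> carrier T" "h \<in> carrier T" for f g h
    using ext that by (simp add: star_extension_def Let_def)
  have mult_word: "\<sigma> (f \<otimes>\<^bsub>T\<^esub> g) (word w) =
      deshuffle_sum T (\<lambda>a b. \<sigma> f (word a) \<otimes>\<^bsub>T\<^esub> \<sigma> g (word b)) w"
    if f: "f \<in> carrier T" and g: "g \<in> carrier T" and w: "w \<in> words" for f g w
    using mult[OF f g wc[OF w]]
      sweedler_sum_eq_word[OF T bilinear_mult[OF bilinear_maps_right[OF \<sigma> f] bilinear_maps_right[OF \<sigma> g]] w]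
    by blast
  \<comment> \<open>The coproduct of a letter has two terms, so condition 4 is the Leibniz rule
    here; condition 1 evaluates the products with the unit on the right, condition 2 the case of the
    empty word.\<close>
  have der: "\<sigma> (word u) (letter K V y) = der word y u" if "u \<in> words" and y: "y \<in> carrier V" for u y
    using that(1)
  proof (induction u rule: list.induct)
    case Nil
    then show ?case using one_left[OF lc[OF y]] counit_word[of "[y]"] y
      by (simp add: word_tensor_Nil[OF V] letter_def)
  next
    case (Cons x u)
    then have x: "x \<in> carrier V" and u: "u \<in> words" by auto
    have "\<sigma> (word (x # u)) (letter K V y) =
        \<sigma> (letter K V x) (letter K V y) \<otimes>\<^bsub>T\<^esub> \<sigma> (word u) \<one>\<^bsub>T\<^esub> \<oplus>\<^bsub>T\<^esub>
        \<sigma> (letter K V x) \<one>\<^bsub>T\<^esub> \<otimes>\<^bsub>T\<^esub> \<sigma> (word u) (letter K V y)"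
      using mult_word[OF lc[OF x] wc[OF u], of "[y]"] y
      by (simp add: word_tensor_Cons[OF V x u] word_tensor_Nil[OF V] letter_def[of K V y])
    then show ?case
      using Cons.IH[OF u] bilinear_maps_closed[OF prd x y] x y u
      by (simp add: letters one_right lc wc letter_mult_derivation_sum word_tensor_Cons[OF V])
  qed
  \<comment> \<open>Induction on the length, because \<open>der word y v\<close> involves words
    other than \<open>v\<close> of which only the length is known.\<close>
  have letter: "\<sigma> (letter K V x) (word w) = letter K V (R x w)"
    if "length w = n" "w \<in> words" and x: "x \<in> carrier V" for x w n
    using that(1,2)
  proof (induction n arbitrary: w)
    case 0
    then show ?case by (simp add: word_tensor_Nil[OF V] one_right lc x letter_star_Nil)
  next
    case (Suc n)
    then obtain v y where w: "w = v @ [y]" "length v = n" by (cases w rule: rev_cases) auto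
    then have v: "v \<in> words" and y: "y \<in> carrier V" using Suc.prems(2) by auto
    have pcl: "\<And>z. z \<in> carrier V \<Longrightarrow> prd z y \<in> carrier V" using bilinear_maps_closed[OF prd _ y] .
    have "\<sigma> (letter K V x) (word w) = \<sigma> (letter K V (R x v)) (letter K V y) \<ominus>\<^bsub>T\<^esub>
        \<sigma> (letter K V x) (der word y v)"
      using letter_mult[OF wc[OF v] x y] Suc.IH[OF w(2) v]
      by (simp add: w(1) word_tensor_snoc[OF V y v] der[OF v y])
    also have "\<sigma> (letter K V x) (der word y v) = der (\<lambda>v. \<sigma> (letter K V x) (word v)) y v"
      by (rule linear_maps_derivation_sum[OF T T bilinear_maps_right[OF \<sigma> lc[OF x]] v]) (simp_all add: pcl wc)
    \<comment> \<open>The induction hypothesis covers every word in the derivation, since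
      \<open>derivation_sum_cong\<close> asks only about words as long as \<open>v\<close>.\<close>
    also have "\<dots> = der (\<lambda>v. letter K V (R x v)) y v"
      by (rule derivation_sum_cong[OF v]) (use Suc.IH w(2) pcl in auto)
    also have "\<dots> = letter K V (derivation_sum V prd (R x) y v)"
      by (rule linear_maps_derivation_sum[OF V T linear_letter[OF V] v, symmetric]) (simp_all add: pcl Rc x)
    also have "\<sigma> (letter K V (R x v)) (letter K V y) = letter K V (prd (R x v) y)"
      by (rule letters[OF Rc[OF x v] y])
    also have "letter K V (prd (R x v) y) \<ominus>\<^bsub>T\<^esub> letter K V (derivation_sum V prd (R x) y v) =
        letter K V (R x w)"
      unfolding w(1) letter_star_snoc[OF V prd v y]
      by (rule linear_maps_minus[OF V T linear_letter[OF V], symmetric])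
         (use pcl Rc x v in \<open>auto intro!: V.M.derivation_sum_closed[OF v]\<close>)
    finally show ?case .
  qed
  show ?thesis using u w
  proof (induction u arbitrary: w rule: list.induct)
    case Nil
    then show ?case
      using one_left[OF wc[OF Nil.prems(2)]] counit_word[OF Nil.prems(2)]
      by (simp add: word_tensor_Nil[OF V])
  next
    case (Cons x u)
    then have x: "x \<in> carrier V" and u: "u \<in> words" and w: "w \<in> words" by auto
    have "\<sigma> (word (x # u)) (word w) =
        deshuffle_sum T (\<lambda>a b. \<sigma> (letter K V x) (word a) \<otimes>\<^bsub>T\<^esub> \<sigma> (word u) (word b)) w"
      unfolding word_tensor_Cons[OF V x u] by (rule mult_word[OF lc[OF x] wc[OF u] w])
    also have "\<dots> = W (x # u) w"
      unfolding word_star.simps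
      by (rule deshuffle_sum_cong[OF w]) (simp add: letter[OF refl _ x] Cons.IH[OF u])
    finally show ?case .
  qed
qed

text \<open>Each condition is linear in every argument that runs through T(V), so it can be checked
  on words, where it is a property of \<open>word_star\<close> or of \<open>letter_star\<close>
  established above.\<close>

lemma star_extension_if_word:
  assumes \<sigma>: "\<sigma> \<in> bilinear_maps K T T T"
    and \<sigma>w: "\<And>u w. u \<in> words \<Longrightarrow> w \<in> words \<Longrightarrow> \<sigma> (word u) (word w) = W u w"
  shows "star_extension K V prd \<sigma>"
proof -
  note \<sigma>1 = bilinear_maps_left[OF \<sigma>] and \<sigma>2 = bilinear_maps_right[OF \<sigma>]
    and \<sigma>c = bilinear_maps_closed[OF \<sigma>]
  have \<sigma>lw: "\<sigma> (letter K V x) (word w) = letter K V (R x w)" if "x \<in> carrier V" "w \<in> words" for x w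
    using \<sigma>w[of "[x]" w] that by (simp add: letter_def[of K V x] word_star_letter del: word_star.simps)
  have \<sigma>wl: "\<sigma> (word w) (letter K V y) = der word y w" if "y \<in> carrier V" "w \<in> words" for y w
    using \<sigma>w[of w "[y]"] that by (simp add: letter_def[of K V y] word_star_derivation)
  have letters: "\<sigma> (letter K V x) (letter K V y) = letter K V (prd x y)"
    if x: "x \<in> carrier V" and y: "y \<in> carrier V" for x y
  proof -
    have "R x [y] = prd x y"
      using letter_star_snoc[OF V prd, of "[]" y x] y bilinear_maps_closed[OF prd x y]
      by (simp add: letter_star_Nil a_minus_def)
    then show ?thesis using \<sigma>lw[OF x, of "[y]"] y by (simp add: letter_def)
  qed
  have one_right: "\<sigma> f \<one>\<^bsub>T\<^esub> = f" if f: "f \<in> carrier T" for f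
    by (rule T_eqI[OF T \<sigma>1 linear_maps_id _ f])
       (use \<sigma>w[of _ "[]"] in \<open>auto simp: word_tensor_Nil[OF V] word_star_Nil_right\<close>)
  have one_left: "\<sigma> \<one>\<^bsub>T\<^esub> f = counit K V f \<odot>\<^bsub>T\<^esub> \<one>\<^bsub>T\<^esub>" if f: "f \<in> carrier T" for f
  proof (rule T_eqI[OF T \<sigma>2 _ _ f])
    have "(\<lambda>c. c \<odot>\<^bsub>T\<^esub> \<one>\<^bsub>T\<^esub>) \<in> linear_maps K (self_module K) T"
      by (rule linear_mapsI) (auto simp: self_module_def T.smult_l_distr T.smult_assoc1)
    then show "(\<lambda>f. counit K V f \<odot>\<^bsub>T\<^esub> \<one>\<^bsub>T\<^esub>) \<in> linear_maps K T T"
      by (rule linear_maps_comp[OF _ linear_counit])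
    fix w assume "w \<in> words"
    then show "\<sigma> \<one>\<^bsub>T\<^esub> (word w) = counit K V (word w) \<odot>\<^bsub>T\<^esub> \<one>\<^bsub>T\<^esub>"
      using \<sigma>w[of "[]" w] by (auto simp: word_tensor_Nil[OF V] counit_word)
  qed simp
  \<comment> \<open>For a word \<open>f\<close> this is the recursion
    \<open>letter_star_snoc\<close>, carried from V into T(V) by the linear map
    \<open>letter\<close>.\<close>
  have letter_mult: "\<sigma> (letter K V x) (f \<otimes>\<^bsub>T\<^esub> letter K V y) =
      \<sigma> (\<sigma> (letter K V x) f) (letter K V y) \<ominus>\<^bsub>T\<^esub> \<sigma> (letter K V x) (\<sigma> f (letter K V y))"
    if f: "f \<in> carrier T" and x: "x \<in> carrier V" and y: "y \<in> carrier V" for f x y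
  proof (rule T_eqI[OF T _ linear_maps_diff[OF T T] _ f])
    note lx = lc[OF x] and ly = lc[OF y]
    show "(\<lambda>f. \<sigma> (letter K V x) (f \<otimes>\<^bsub>T\<^esub> letter K V y)) \<in> linear_maps K T T"
      by (rule linear_maps_comp[OF \<sigma>2[OF lx] T.linear_maps_mult_right[OF ly]])
    show "(\<lambda>f. \<sigma> (\<sigma> (letter K V x) f) (letter K V y)) \<in> linear_maps K T T"
      by (rule linear_maps_comp[OF \<sigma>1[OF ly] \<sigma>2[OF lx]])
    show "(\<lambda>f. \<sigma> (letter K V x) (\<sigma> f (letter K V y))) \<in> linear_maps K T T"
      by (rule linear_maps_comp[OF \<sigma>2[OF lx] \<sigma>1[OF ly]])
    fix w assume w: "w \<in> words"
    have pcl: "\<And>z. z \<in> carrier V \<Longrightarrow> prd z y \<in> carrier V" using bilinear_maps_closed[OF prd _ y] .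
    have "\<sigma> (letter K V x) (der word y w) = der (\<lambda>v. \<sigma> (letter K V x) (word v)) y w"
      by (rule linear_maps_derivation_sum[OF T T \<sigma>2[OF lx] w]) (simp_all add: pcl wc)
    also have "\<dots> = der (\<lambda>v. letter K V (R x v)) y w"
      by (rule derivation_sum_cong[OF w]) (simp_all add: pcl \<sigma>lw x)
    also have "\<dots> = letter K V (derivation_sum V prd (R x) y w)"
      by (rule linear_maps_derivation_sum[OF V T linear_letter[OF V] w, symmetric]) (simp_all add: pcl Rc x)
    finally have 1: "\<sigma> (letter K V x) (\<sigma> (word w) (letter K V y)) =
        letter K V (derivation_sum V prd (R x) y w)" by (simp add: \<sigma>wl w y)
    have "\<sigma> (letter K V x) (word w \<otimes>\<^bsub>T\<^esub> letter K V y) =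
        letter K V (prd (R x w) y \<ominus>\<^bsub>V\<^esub> derivation_sum V prd (R x) y w)"
      using \<sigma>lw[OF x, of "w @ [y]"] w y
      by (simp add: word_tensor_snoc[OF V] letter_star_snoc[OF V prd])
    also have "\<dots> = letter K V (prd (R x w) y) \<ominus>\<^bsub>T\<^esub> letter K V (derivation_sum V prd (R x) y w)"
      by (rule linear_maps_minus[OF V T linear_letter[OF V]])
         (use pcl Rc x w in \<open>auto intro!: V.M.derivation_sum_closed[OF w]\<close>)
    finally show "\<sigma> (letter K V x) (word w \<otimes>\<^bsub>T\<^esub> letter K V y) =
        \<sigma> (\<sigma> (letter K V x) (word w)) (letter K V y) \<ominus>\<^bsub>T\<^esub>
        \<sigma> (letter K V x) (\<sigma> (word w) (letter K V y))"
      by (simp add: 1 \<sigma>lw x w letters Rc y)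
  qed
  \<comment> \<open>First the right factor is a word, where the Sweedler sum is explicit; then
    \<open>f\<close> and \<open>g\<close> are reduced to words in turn, ending at
    \<open>word_star_append\<close>.\<close>
  have mult_word: "\<sigma> (f \<otimes>\<^bsub>T\<^esub> g) (word w) =
      deshuffle_sum T (\<lambda>a b. \<sigma> f (word a) \<otimes>\<^bsub>T\<^esub> \<sigma> g (word b)) w" (is "?L f g = ?R f g")
    if f: "f \<in> carrier T" and g: "g \<in> carrier T" and w: "w \<in> words" for f g w
  proof (rule T_eqI[OF T _ _ _ f, of "\<lambda>f. ?L f g" "\<lambda>f. ?R f g"])
    show "(\<lambda>f. ?L f g) \<in> linear_maps K T T"
      by (rule linear_maps_comp[OF \<sigma>1[OF wc[OF w]] T.linear_maps_mult_right[OF g]])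
    show "(\<lambda>f. ?R f g) \<in> linear_maps K T T"
      by (rule deshuffle_sum_linear[OF T T w])
         (rule linear_maps_comp[OF T.linear_maps_mult_right \<sigma>1]; simp add: \<sigma>c g wc)
    fix u assume u: "u \<in> words"
    show "?L (word u) g = ?R (word u) g"
    proof (rule T_eqI[OF T _ _ _ g, of "\<lambda>g. ?L (word u) g" "\<lambda>g. ?R (word u) g"])
      show "(\<lambda>g. ?L (word u) g) \<in> linear_maps K T T"
        by (rule linear_maps_comp[OF \<sigma>1[OF wc[OF w]] T.linear_maps_mult_left[OF wc[OF u]]])
      show "(\<lambda>g. ?R (word u) g) \<in> linear_maps K T T"
        by (rule deshuffle_sum_linear[OF T T w])
           (rule linear_maps_comp[OF T.linear_maps_mult_left \<sigma>1]; simp add: \<sigma>c u wc)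
      fix v assume v: "v \<in> words"
      have "?R (word u) (word v) = deshuffle_sum T (\<lambda>a b. W u a \<otimes>\<^bsub>T\<^esub> W v b) w"
        by (rule deshuffle_sum_cong[OF w]) (simp add: \<sigma>w u v)
      then show "?L (word u) (word v) = ?R (word u) (word v)"
        using u v w by (simp add: word_tensor_append[OF V] \<sigma>w word_star_append)
    qed
  qed
  have mult: "sweedler_sum_eq K V T (\<lambda>a b. \<sigma> f a \<otimes>\<^bsub>T\<^esub> \<sigma> g b) h (\<sigma> (f \<otimes>\<^bsub>T\<^esub> g) h)"
    if f: "f \<in> carrier T" and g: "g \<in> carrier T" and h: "h \<in> carrier T" for f g h
  proof -
    note B = bilinear_mult[OF \<sigma>2[OF f] \<sigma>2[OF g]]
    obtain G where G: "G \<in> linear_maps K TT T"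
      "\<And>a b. a \<in> carrier T \<Longrightarrow> b \<in> carrier T \<Longrightarrow> G (pure a b) = \<sigma> f a \<otimes>\<^bsub>T\<^esub> \<sigma> g b"
      using bilinear_factors_tensor_prod[OF T.assoc_algebra_axioms T.assoc_algebra_axioms T B] by blast
    \<comment> \<open>Factored through \<open>G\<close>, the Sweedler sum is visibly linear in
      \<open>h\<close>, so the case of a word is enough.\<close>
    have "\<sigma> (f \<otimes>\<^bsub>T\<^esub> g) h = G (deshuffle K V h)"
    proof (rule T_eqI[OF T \<sigma>2 linear_maps_comp[OF G(1) linear_deshuffle] _ h])
      show "f \<otimes>\<^bsub>T\<^esub> g \<in> carrier T" using f g by simp
      show "\<sigma> (f \<otimes>\<^bsub>T\<^esub> g) (word w) = G (deshuffle K V (word w))" if "w \<in> words" for w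
        using mult_word[OF f g that] deshuffle_word_factor[OF T G that] by simp
    qed
    then show ?thesis using sweedler_sum_eq_iff[OF T B G h] by blast
  qed
  show ?thesis
    unfolding star_extension_def Let_def
    by (intro conjI ballI letters one_right one_left letter_mult mult)
qed

end

end

theorem proposition1:
  fixes K :: "('k, 'm) ring_scheme"
    and V :: "('k, 'v, 'p) module_scheme"
    and prd :: "'v \<Rightarrow> 'v \<Rightarrow> 'v"
  assumes "field K"
    and "module K V"
    and "prd \<in> bilinear_maps K V V V"
  shows
    "let T = tensor_algebra K V; TT = tensor_prod K T T; \<iota> = letter K V in
     \<exists>!S. S \<in> extensional (carrier TT) \<and> S \<in> linear_maps K TT T \<and>
       (let star = (\<lambda>f g. S (pure_tensor K T T f g)) in
         (\<forall>x\<in>carrier V. \<forall>y\<in>carrier V. star (\<iota> x) (\<iota> y) = \<iota> (prd x y)) \<and>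
         (\<forall>f\<in>carrier T. star f \<one>\<^bsub>T\<^esub> = f) \<and>
         (\<forall>f\<in>carrier T. star \<one>\<^bsub>T\<^esub> f = counit K V f \<odot>\<^bsub>T\<^esub> \<one>\<^bsub>T\<^esub>) \<and>
         (\<forall>f\<in>carrier T. \<forall>x\<in>carrier V. \<forall>y\<in>carrier V.
            star (\<iota> x) (f \<otimes>\<^bsub>T\<^esub> \<iota> y) =
              star (star (\<iota> x) f) (\<iota> y) \<ominus>\<^bsub>T\<^esub> star (\<iota> x) (star f (\<iota> y))) \<and>
         (\<forall>f\<in>carrier T. \<forall>g\<in>carrier T. \<forall>h\<in>carrier T.
            sweedler_sum_eq K V T (\<lambda>a b. star f a \<otimes>\<^bsub>T\<^esub> star g b) h (star (f \<otimes>\<^bsub>T\<^esub> g) h)))"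
proof -
  note V = assms(2) and prd = assms(3)
  let ?T = "tensor_algebra K V" and ?w = "word_tensor K V" and ?S = "lists (carrier V)"
  let ?TT = "tensor_prod K ?T ?T" and ?p = "pure_tensor K ?T ?T"
  note alg = assoc_algebra_tensor_algebra[OF V] and T = module_tensor_algebra[OF V]
  note TT = module_tensor_prod[OF alg alg] and p = pure_tensor_bilinear[OF alg alg]
  have bilin: "(\<lambda>f g. S (?p f g)) \<in> bilinear_maps K ?T ?T ?T" if "S \<in> linear_maps K ?TT ?T" for S
    unfolding bilinear_maps_def
    using linear_maps_comp[OF that bilinear_maps_left[OF p]]
      linear_maps_comp[OF that bilinear_maps_right[OF p]] by blast
  have "\<exists>!S. S \<in> extensional (carrier ?TT) \<and> S \<in> linear_maps K ?TT ?T \<and>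
      star_extension K V prd (\<lambda>f g. S (?p f g))"
  proof (rule ex_ex1I)
    obtain \<sigma> where \<sigma>: "\<sigma> \<in> bilinear_maps K ?T ?T ?T"
      and \<sigma>w: "\<And>u w. u \<in> ?S \<Longrightarrow> w \<in> ?S \<Longrightarrow> \<sigma> (?w u) (?w w) = word_star K V prd u w"
      using bilinear_word_lift[OF V T word_star_multilinear_left[OF V prd]
          word_star_multilinear_right[OF V prd]] by blast
    obtain S0 where S0: "S0 \<in> linear_maps K ?TT ?T"
      "\<And>a b. a \<in> carrier ?T \<Longrightarrow> b \<in> carrier ?T \<Longrightarrow> S0 (?p a b) = \<sigma> a b"
      using bilinear_factors_tensor_prod[OF alg alg T \<sigma>] by blast
    \<comment> \<open>The values outside the carrier are normalised, as unique existence among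
      extensional maps demands.\<close>
    let ?Sr = "restrict S0 (carrier ?TT)"
    have S: "?Sr \<in> linear_maps K ?TT ?T"
      using S0(1) by (subst linear_maps_cong[OF TT]) auto
    have "star_extension K V prd (\<lambda>f g. ?Sr (?p f g))"
      by (rule star_extension_if_word[OF V prd bilin[OF S]])
         (simp add: S0(2) \<sigma>w word_tensor_closed[OF V] bilinear_maps_closed[OF p])
    then show "\<exists>S. S \<in> extensional (carrier ?TT) \<and> S \<in> linear_maps K ?TT ?T \<and>
        star_extension K V prd (\<lambda>f g. S (?p f g))"
      using S by blast
  next
    fix S S'
    assume "S \<in> extensional (carrier ?TT) \<and> S \<in> linear_maps K ?TT ?T \<and>
        star_extension K V prd (\<lambda>f g. S (?p f g))"
      and "S' \<in> extensional (carrier ?TT) \<and> S' \<in> linear_maps K ?TT ?T \<and>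
        star_extension K V prd (\<lambda>f g. S' (?p f g))"
    then have e: "S \<in> extensional (carrier ?TT)" "S' \<in> extensional (carrier ?TT)"
      and l: "S \<in> linear_maps K ?TT ?T" "S' \<in> linear_maps K ?TT ?T"
      and x: "star_extension K V prd (\<lambda>f g. S (?p f g))" "star_extension K V prd (\<lambda>f g. S' (?p f g))"
      by blast+
    \<comment> \<open>Both maps are given by \<open>word_star\<close> on pairs of words; linearity
      in each argument extends the equality to pure tensors, which generate the tensor
      square.\<close>
    have words: "S (?p (?w u) (?w w)) = S' (?p (?w u) (?w w))" if "u \<in> ?S" "w \<in> ?S" for u w
      using star_extension_word[OF V prd bilin[OF l(1)] x(1) that]
        star_extension_word[OF V prd bilin[OF l(2)] x(2) that] by simp
    show "S = S'"
    proof (rule extensionalityI[OF e])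
      fix z assume "z \<in> carrier ?TT"
      then show "S z = S' z"
      proof (rule tensor_prod_linear_eqI[OF alg alg T l, rotated])
        fix f g assume f: "f \<in> carrier ?T" and g: "g \<in> carrier ?T"
        show "S (?p f g) = S' (?p f g)"
        proof (rule tensor_algebra_linear_eqI[OF V T _ _ _ f])
          fix u assume u: "u \<in> ?S"
          note wu = word_tensor_closed[OF V u]
          show "S (?p (?w u) g) = S' (?p (?w u) g)"
            by (rule tensor_algebra_linear_eqI[OF V T bilinear_maps_right[OF bilin[OF l(1)] wu]
                  bilinear_maps_right[OF bilin[OF l(2)] wu] words[OF u] g])
        qed (rule bilinear_maps_left[OF bilin g], rule l)+
      qed
    qed
  qed
  then show ?thesis
    unfolding star_extension_def Let_def .
qed

end
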